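(* Let $\Omega\subsetneq\mathbb{C}$ be a (nonempty) proper simply connected domain with an antiholomorphic involution $\sigma$, let $\Omega^\sigma = \{z\in\Omega:\sigma(z) = z\}$, and let $f^\sharp(z) := \overline{f(\sigma(z))}$ for $f\in H^\infty(\Omega)$. The weakly continuous positive functionals $(H^\infty(\Omega),\sharp)\to\mathbb{C}$ are precisely the maps $$\eta_\mu(f) := \int_{\Omega^\sigma}f(\lambda)\,d\mu(\lambda),$$ where $\mu$ is a finite positive Borel measure on $\Omega^\sigma$.
   Context: $H^\infty(\Omega)$ is the Banach algebra of bounded holomorphic functions on $\Omega$ with the sup norm. The antiholomorphic involution is of the form $\sigma(z) = \varphi(\overline{\varphi^{-1}(z)})$ for a biholomorphic map $\varphi:\mathbb{D}\to\Omega$ from the open unit disc. With the isometric antilinear involution $\sharp$, $H^\infty(\Omega)$ is a Banach $*$-algebra; a linear functional $\eta$ on it is positive if $\eta(f^\sharp f)\geq 0$ for all $f$. By Ando's Theorem, $H^\infty(\Omega)$ has a unique predual $H^\infty(\Omega)_*\subseteq H^\infty(\Omega)^*$; the weak topology on $H^\infty(\Omega)$ is the initial topology defined by the functionals in $H^\infty(\Omega)_*$ (i.e. the weak-$*$ topology). Concretely, for a biholomorphic map $\varphi:\mathbb{D}\to\Omega$, it is the initial topology with respect to the functionals $f\mapsto\int_0^{2\pi}F(e^{it})(f\circ\varphi)^*(e^{it})\,dt$, $F\in L^1(\mathbb{T})$, where $(\cdot)^*$ denotes non-tangential boundary values. *)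

theory Defs
  imports "HOL-Complex_Analysis.Complex_Analysis"
begin

definition biholomorphic_map :: "(complex \<Rightarrow> complex) \<Rightarrow> complex set \<Rightarrow> complex set \<Rightarrow> bool" where
  "biholomorphic_map \<phi> S T \<longleftrightarrow>
     \<phi> holomorphic_on S \<and> bij_betw \<phi> S T \<and> inv_into S \<phi> holomorphic_on T"

definition antiholomorphic_involution :: "complex set \<Rightarrow> (complex \<Rightarrow> complex) \<Rightarrow> bool" where
  "antiholomorphic_involution \<Omega> \<sigma> \<longleftrightarrow>
     \<sigma> \<in> \<Omega> \<rightarrow> \<Omega> \<and> (\<forall>z\<in>\<Omega>. \<sigma> (\<sigma> z) = z) \<and> (\<lambda>z. cnj (\<sigma> z)) holomorphic_on \<Omega>"

definition fixed_points :: "complex set \<Rightarrow> (complex \<Rightarrow> complex) \<Rightarrow> complex set" where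
  "fixed_points \<Omega> \<sigma> = {z\<in>\<Omega>. \<sigma> z = z}"

text \<open>Functions on \<open>\<Omega>\<close> are represented by total functions vanishing off \<open>\<Omega>\<close>, so that
  equality in \<open>Hinf \<Omega>\<close> is equality on \<open>\<Omega>\<close> and the algebra operations are the pointwise ones.\<close>

definition Hinf :: "complex set \<Rightarrow> (complex \<Rightarrow> complex) set" where
  "Hinf \<Omega> = {f. f holomorphic_on \<Omega> \<and> bounded (f ` \<Omega>) \<and> (\<forall>z. z \<notin> \<Omega> \<longrightarrow> f z = 0)}"

definition sharp :: "complex set \<Rightarrow> (complex \<Rightarrow> complex) \<Rightarrow> (complex \<Rightarrow> complex) \<Rightarrow> complex \<Rightarrow> complex" where
  "sharp \<Omega> \<sigma> f = (\<lambda>z. if z \<in> \<Omega> then cnj (f (\<sigma> z)) else 0)"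

definition linear_functional :: "complex set \<Rightarrow> ((complex \<Rightarrow> complex) \<Rightarrow> complex) \<Rightarrow> bool" where
  "linear_functional \<Omega> \<eta> \<longleftrightarrow>
     (\<forall>f\<in>Hinf \<Omega>. \<forall>g\<in>Hinf \<Omega>. \<eta> (\<lambda>z. f z + g z) = \<eta> f + \<eta> g) \<and>
     (\<forall>c. \<forall>f\<in>Hinf \<Omega>. \<eta> (\<lambda>z. c * f z) = c * \<eta> f)"

definition positive_functional ::
    "complex set \<Rightarrow> (complex \<Rightarrow> complex) \<Rightarrow> ((complex \<Rightarrow> complex) \<Rightarrow> complex) \<Rightarrow> bool" where
  "positive_functional \<Omega> \<sigma> \<eta> \<longleftrightarrow>
     linear_functional \<Omega> \<eta> \<and>
     (\<forall>f\<in>Hinf \<Omega>. \<eta> (\<lambda>z. sharp \<Omega> \<sigma> f z * f z) \<in> \<real>\<^sub>\<ge>\<^sub>0)"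

definition stolz_region :: "real \<Rightarrow> complex \<Rightarrow> complex set" where
  "stolz_region M \<zeta> = {z \<in> ball 0 1. cmod (z - \<zeta>) < M * (1 - cmod z)}"

text \<open>The non-tangential boundary value at a point \<open>\<zeta>\<close> of the unit circle. The limit is unique
  when it exists (\<open>\<zeta>\<close> is a limit point of the region for each \<open>M > 1\<close>); for a bounded holomorphic
  function on the disc it exists at almost every \<open>\<zeta>\<close> by Fatou's theorem, so the unspecified value
  elsewhere does not affect the integrals below.\<close>

definition boundary_value :: "(complex \<Rightarrow> complex) \<Rightarrow> complex \<Rightarrow> complex" where
  "boundary_value g \<zeta> = (THE L. \<forall>M>1. (g \<longlongrightarrow> L) (at \<zeta> within stolz_region M \<zeta>))"

definition circle_integrable :: "(complex \<Rightarrow> complex) \<Rightarrow> bool" where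
  "circle_integrable F \<longleftrightarrow> set_integrable lebesgue {0..2*pi} (\<lambda>t. F (cis t))"

definition boundary_functional ::
    "(complex \<Rightarrow> complex) \<Rightarrow> (complex \<Rightarrow> complex) \<Rightarrow> (complex \<Rightarrow> complex) \<Rightarrow> complex" where
  "boundary_functional \<phi> F f =
     set_lebesgue_integral lebesgue {0..2*pi} (\<lambda>t. F (cis t) * boundary_value (f \<circ> \<phi>) (cis t))"

text \<open>The weak-* topology on \<open>Hinf \<Omega>\<close>, as the initial topology on that carrier for the functionals
  above, where \<open>\<phi>\<close> is a biholomorphic map from the unit disc onto \<open>\<Omega>\<close>. Mathematically it does not
  depend on the choice of \<open>\<phi>\<close>.\<close>

definition weak_topology :: "complex set \<Rightarrow> (complex \<Rightarrow> complex) \<Rightarrow> (complex \<Rightarrow> complex) topology" where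
  "weak_topology \<Omega> \<phi> =
     topology_generated_by
       {{f \<in> Hinf \<Omega>. boundary_functional \<phi> F f \<in> U} |F U. circle_integrable F \<and> open U}"

end

theory Submission
  imports Defs "HOL-Probability.Probability" "HOL-Real_Asymp.Real_Asymp"
begin

text \<open>A measure \<open>\<mu>\<close> on \<open>\<Omega>\<^sup>\<sigma>\<close> gives a weakly continuous functional because point evaluations in the disc
  are Poisson integrals of boundary values: averaging the Poisson kernels over \<open>\<mu>\<close> produces an
  integrable function on the circle.

  Conversely, choose a coordinate of the disc in which \<open>\<sigma>\<close> is complex conjugation. The functions
  \<open>((1 + z) / 2)\<^sup>k ((1 - z) / 2)\<^sup>l\<close> have square roots in \<open>H\<^sup>\<infinity>\<close> fixed by \<open>\<sharp>\<close>, so a positive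
  functional is nonnegative on them, and Hausdorff's moment problem represents it on polynomials by a
  measure on \<open>[-1, 1]\<close>. Weak continuity excludes mass at the end points, because
  \<open>((1 \<plusminus> z) / 2)\<^sup>n\<close> tends to \<open>0\<close> almost everywhere on the circle, and extends the representation to
  all of \<open>H\<^sup>\<infinity>\<close>, because \<open>f (r z)\<close> tends to \<open>f\<close> boundedly and almost everywhere on the circle. Both
  directions rest on Fatou's theorem.\<close>

section \<open>Fatou's theorem\<close>

text \<open>\<open>boundary_value\<close> is a definite description over all Stolz regions, so
  radial limits are not enough: at almost every point one limit must serve every opening
  \<open>M\<close>. It is obtained from a primitive \<open>h\<close> of \<open>f\<close>, which is
  Lipschitz and hence extends to the closed disc. Mean-square estimates on circles make
  \<open>h\<close> differentiable along the circle almost everywhere, and a maximum principle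
  carries that derivative into the Stolz regions, where it becomes the limit of \<open>f\<close>.
  The weak topology is tied to the given \<open>\<phi>\<close>, which need not carry \<sigma> to
  complex conjugation. The proof therefore keeps two disc coordinates: that of
  \<open>\<phi>\<close>, in which boundary values and the dilations \<open>f (r z)\<close> are
  taken, and a Moebius image of it, in which the symmetry, the polynomials and the moments live.
  Dilations in the first coordinate become functions holomorphic beyond the closed disc in the
  second, so the representation passes from polynomials to such functions and only then to all of
  \<open>Hinf\<close>.\<close>

lemma circle_integral_fourier_coeff:
  fixes f :: "complex \<Rightarrow> complex" and s :: real
  assumes f: "f holomorphic_on ball 0 1" and s: "0 < s" "s < 1"
  shows "((\<lambda>t. f (s * cis t) * cis (- (real n * t))) has_integral
           2 * pi * ((deriv ^^ n) f 0 / fact n) * s ^ n) {0..2*pi}"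
proof -
  have "((\<lambda>u. f u / (u - 0) ^ Suc n) has_contour_integral
      complex_of_real (2 * pi) * \<i> / fact n * (deriv ^^ n) f 0) (circlepath 0 s)"
    using f s by (intro Cauchy_has_contour_integral_higher_derivative_circlepath)
      (auto intro!: holomorphic_on_imp_continuous_on intro: holomorphic_on_subset)
  then have "((\<lambda>t. f (0 + s * cis t) / (0 + s * cis t - 0) ^ Suc n * s * \<i> * cis t) has_integral
      complex_of_real (2 * pi) * \<i> / fact n * (deriv ^^ n) f 0) {0..2*pi}"
    unfolding circlepath_def by (subst (asm) has_contour_integral_part_circlepath_iff) auto
  \<comment> \<open>With \<open>u = s * cis t\<close>, the form \<open>du / u ^ Suc n\<close> is
    \<open>\<i> * cis (- n t) dt / s ^ n\<close>; this factor leaves the bare Fourier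
    coefficient.\<close>
  then have "((\<lambda>t. (s ^ n / \<i>) * (f (0 + s * cis t) / (0 + s * cis t - 0) ^ Suc n * s * \<i> * cis t)) has_integral
      (s ^ n / \<i>) * (complex_of_real (2 * pi) * \<i> / fact n * (deriv ^^ n) f 0)) {0..2*pi}"
    by (rule has_integral_mult_right)
  moreover have "(s ^ n / \<i>) * (f (0 + s * cis t) / (0 + s * cis t - 0) ^ Suc n * s * \<i> * cis t)
      = f (s * cis t) * cis (- (real n * t))" for t
  proof -
    have "cis (- (real n * t)) = 1 / cis t ^ n"
      by (simp only: Complex.DeMoivre divide_inverse cis_inverse mult_1)
    then show ?thesis
      using s by (simp add: power_mult_distrib field_simps)
  qed
  ultimately show ?thesis
    by (simp add: mult_ac)
qed

text \<open>Parseval's identity with two radii, because the square of a difference of two dilations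
  has mixed terms. The Taylor series of the second factor converges uniformly on its circle and is
  integrated term by term against the Fourier coefficients of the first.\<close>

lemma circle_inner_product:
  fixes f :: "complex \<Rightarrow> complex" and s r :: real
  assumes f: "f holomorphic_on ball 0 1" and s: "0 < s" "s < 1" and r: "0 < r" "r < 1"
  defines "a \<equiv> \<lambda>n. (deriv ^^ n) f 0 / fact n"
  shows "((\<lambda>t. f (s * cis t) * cnj (f (r * cis t))) has_integral
           complex_of_real (2 * pi * (\<Sum>n. (cmod (a n))\<^sup>2 * (s * r) ^ n))) {0..2*pi}"
    and "summable (\<lambda>n. (cmod (a n))\<^sup>2 * (s * r) ^ n)"
proof -
  have contf: "continuous_on S f" if "S \<subseteq> ball 0 1" for S
    using holomorphic_on_imp_continuous_on[OF f] that continuous_on_subset by blast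
  have sums: "(\<lambda>n. a n * z ^ n) sums f z" if "cmod z < 1" for z
    using holomorphic_power_series[OF f, of z] that by (simp add: a_def)
  have abs: "summable (\<lambda>n. cmod (a n) * r ^ n)"
  proof -
    obtain q where q: "r < q" "q < 1" using r dense by blast
    have "summable (\<lambda>n. a n * (complex_of_real q) ^ n)"
      using sums[of "of_real q"] q r by (auto simp: sums_iff)
    then have "summable (\<lambda>n. norm (a n * (complex_of_real r) ^ n))"
      by (rule powser_insidea) (use q r in auto)
    then show ?thesis using r by (simp add: norm_mult norm_power)
  qed
  have lims: "uniform_limit {0..2*pi}
      (\<lambda>N t. \<Sum>n<N. cnj (a n * (r * cis t) ^ n)) (\<lambda>t. \<Sum>n. cnj (a n * (r * cis t) ^ n)) sequentially"
    by (rule Weierstrass_m_test[OF _ abs]) (use r in \<open>auto simp: norm_mult norm_power\<close>)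
  have eqs: "(\<Sum>n. cnj (a n * (r * cis t) ^ n)) = cnj (f (r * cis t))" for t
    by (intro sums_unique[symmetric], subst sums_cnj, intro sums) (use r in \<open>simp add: norm_mult\<close>)
  have bf: "bounded ((\<lambda>t. f (s * cis t)) ` {0..2*pi})"
    by (intro compact_imp_bounded compact_continuous_image continuous_on_compose2[OF contf[of "ball 0 1"]] continuous_intros)
       (use s in \<open>auto simp: norm_mult\<close>)
  have cr: "continuous_on {0..2*pi} (\<lambda>t. cnj (f (r * cis t)))"
    by (intro continuous_intros continuous_on_compose2[OF contf[of "ball 0 1"]])
       (use r in \<open>auto simp: norm_mult\<close>)
  have cs: "continuous_on {0..2*pi} (\<lambda>t. f (s * cis t))"
    by (intro continuous_intros continuous_on_compose2[OF contf[of "ball 0 1"]])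
       (use s in \<open>auto simp: norm_mult\<close>)
  have br: "bounded ((\<lambda>t. cnj (f (r * cis t))) ` {0..2*pi})"
    by (intro compact_imp_bounded compact_continuous_image cr) auto
  have lim: "uniform_limit {0..2*pi}
      (\<lambda>N t. f (s * cis t) * (\<Sum>n<N. cnj (a n * (r * cis t) ^ n)))
      (\<lambda>t. f (s * cis t) * cnj (f (r * cis t))) sequentially"
    using lims unfolding eqs by (intro uniform_lim_mult uniform_limit_const bf br)
  have cN: "continuous_on {0..2*pi} (\<lambda>t. f (s * cis t) * (\<Sum>n<N. cnj (a n * (r * cis t) ^ n)))" for N
    by (intro continuous_intros cs)
  obtain I J where I: "\<And>N. ((\<lambda>t. f (s * cis t) * (\<Sum>n<N. cnj (a n * (r * cis t) ^ n))) has_integral I N) {0..2*pi}"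
    and J: "((\<lambda>t. f (s * cis t) * cnj (f (r * cis t))) has_integral J) {0..2*pi}" and IJ: "I \<longlonglongrightarrow> J"
    by (rule uniform_limit_integral[OF lim cN sequentially_bot]) (rule that)
  have eqI: "I N = complex_of_real (\<Sum>n<N. 2 * pi * ((cmod (a n))\<^sup>2 * (s * r) ^ n))" for N
  proof -
    have "((\<lambda>t. (\<Sum>n<N. (cnj (a n) * r ^ n) * (f (s * cis t) * cis (- (real n * t))))) has_integral
          (\<Sum>n<N. (cnj (a n) * r ^ n) * (2 * pi * a n * s ^ n))) {0..2*pi}"
      unfolding a_def by (intro has_integral_sum has_integral_mult_right circle_integral_fourier_coeff f s) auto
    moreover have "(\<lambda>t. \<Sum>n<N. (cnj (a n) * r ^ n) * (f (s * cis t) * cis (- (real n * t)))) =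
        (\<lambda>t. f (s * cis t) * (\<Sum>n<N. cnj (a n * (r * cis t) ^ n)))"
      by (simp add: sum_distrib_left power_mult_distrib Complex.DeMoivre cis_cnj mult_ac)
    moreover have "(cnj (a n) * r ^ n) * (2 * pi * a n * s ^ n) =
        complex_of_real (2 * pi * ((cmod (a n))\<^sup>2 * (s * r) ^ n))" for n
      by (simp add: power_mult_distrib complex_norm_square mult_ac del: of_real_power)
    ultimately have "((\<lambda>t. f (s * cis t) * (\<Sum>n<N. cnj (a n * (r * cis t) ^ n))) has_integral
        (\<Sum>n<N. complex_of_real (2 * pi * ((cmod (a n))\<^sup>2 * (s * r) ^ n)))) {0..2*pi}"
      by (simp only:)
    from has_integral_unique[OF I this] show ?thesis by (simp only: of_real_sum)
  qed
  have *: "(\<lambda>N. complex_of_real (\<Sum>n<N. 2 * pi * ((cmod (a n))\<^sup>2 * (s * r) ^ n))) \<longlonglongrightarrow> J"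
    using IJ ext[of I, OF eqI] by (simp only:)
  have "(\<lambda>N. \<Sum>n<N. 2 * pi * ((cmod (a n))\<^sup>2 * (s * r) ^ n)) \<longlonglongrightarrow> Re J"
    using tendsto_Re[OF *] by simp
  then have "(\<lambda>n. 2 * pi * ((cmod (a n))\<^sup>2 * (s * r) ^ n)) sums Re J"
    by (simp add: sums_def)
  from sums_mult[OF this, of "1 / (2*pi)"]
  have S: "(\<lambda>n. ((cmod (a n))\<^sup>2 * (s * r) ^ n)) sums (Re J / (2 * pi))" by simp
  then show "summable (\<lambda>n. (cmod (a n))\<^sup>2 * (s * r) ^ n)" by (simp add: sums_iff)
  have "Im J = 0"
    using tendsto_Im[OF *] by (simp add: LIMSEQ_const_iff)
  then have "J = complex_of_real (2 * pi * (\<Sum>n. (cmod (a n))\<^sup>2 * (s * r) ^ n))"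
    using S by (simp add: sums_iff complex_eq_iff)
  with J show "((\<lambda>t. f (s * cis t) * cnj (f (r * cis t))) has_integral
           complex_of_real (2 * pi * (\<Sum>n. (cmod (a n))\<^sup>2 * (s * r) ^ n))) {0..2*pi}" by simp
qed

text \<open>The inner product of the dilations by \<open>s\<close> and \<open>r\<close> depends only
  on \<open>s * r\<close>; it is \<open>N (s * r)\<close>. Since
  \<open>N (r * r) \<le> N (s * r)\<close>, the squared distance
  \<open>N (s * s) - 2 * N (s * r) + N (r * r)\<close> is at most
  \<open>N (s * s) - N (r * r)\<close>. As \<open>f\<close> is bounded, so is
  \<open>N (s * s)\<close>, and it is enough that \<open>N (r * r)\<close> is within \<epsilon> of
  the supremum.\<close>

lemma circle_means_L2_Cauchy:
  fixes f :: "complex \<Rightarrow> complex"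
  assumes f: "f holomorphic_on ball 0 1" and bd: "\<And>z. z \<in> ball 0 1 \<Longrightarrow> cmod (f z) \<le> C"
    and e: "0 < \<epsilon>"
  obtains r :: real where "0 < r" "r < 1"
    "\<And>s::real. \<lbrakk>r \<le> s; s < 1\<rbrakk> \<Longrightarrow>
      integral {0..2*pi} (\<lambda>t. (cmod (f (s * cis t) - f (r * cis t)))\<^sup>2) \<le> \<epsilon>"
proof -
  define a where "a n = (deriv ^^ n) f 0 / fact n" for n
  define N where "N x = 2 * pi * (\<Sum>n. (cmod (a n))\<^sup>2 * x ^ n)" for x :: real
  have ip: "((\<lambda>t. f (s * cis t) * cnj (f (r * cis t))) has_integral complex_of_real (N (s * r))) {0..2*pi}"
    if "0 < s" "s < 1" "0 < r" "r < 1" for s r :: real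
    using circle_inner_product(1)[OF f that] by (simp add: N_def a_def)
  have sm: "summable (\<lambda>n. (cmod (a n))\<^sup>2 * (s * r) ^ n)" if "0 < s" "s < 1" "0 < r" "r < 1" for s r :: real
    using circle_inner_product(2)[OF f that] by (simp add: a_def)
  have mono: "N (r * r) \<le> N (s * r)" if "0 < r" "r \<le> s" "s < 1" for s r
    unfolding N_def using that sm
    by (intro mult_left_mono suminf_le mult_left_mono power_mono) auto
  have sq: "((\<lambda>t. (cmod (f (s * cis t)))\<^sup>2) has_integral N (s * s)) {0..2*pi}" if "0 < s" "s < 1" for s
    using has_integral_Re[OF ip[OF that that]]
    by (simp only: complex_norm_square[symmetric] Re_complex_of_real)
  have le: "N (s * s) \<le> 2 * pi * C\<^sup>2" if "0 < s" "s < 1" for s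
  proof -
    have "N (s * s) \<le> C\<^sup>2 * (2 * pi - 0)"
    proof (rule has_integral_le[OF sq[OF that]])
      show "((\<lambda>t. C\<^sup>2) has_integral C\<^sup>2 * (2 * pi - 0)) {0..2*pi}"
        using has_integral_const_real[of "C\<^sup>2" 0 "2*pi"] by (simp add: mult_ac)
      show "(cmod (f (s * cis t)))\<^sup>2 \<le> C\<^sup>2" if "t \<in> {0..2*pi}" for t
        using bd[of "s * cis t"] \<open>0 < s\<close> \<open>s < 1\<close> by (intro power_mono) (auto simp: norm_mult)
    qed
    then show ?thesis by (simp add: mult_ac)
  qed
  define A where "A = (\<lambda>s. N (s * s)) ` {0<..<1}"
  have bA: "bdd_above A" and neA: "A \<noteq> {}"
    unfolding A_def using le by (auto intro!: bdd_aboveI2[where M = "2 * pi * C\<^sup>2"])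
  have "Sup A - \<epsilon> < Sup A" using e by simp
  then obtain x where "x \<in> A" "Sup A - \<epsilon> < x"
    using less_cSup_iff[OF neA bA] by blast
  then obtain r where r: "0 < r" "r < 1" "Sup A - \<epsilon> < N (r * r)"
    unfolding A_def by auto
  have fin: "integral {0..2*pi} (\<lambda>t. (cmod (f (s * cis t) - f (r * cis t)))\<^sup>2) \<le> \<epsilon>"
    if s: "r \<le> s" "s < 1" for s :: real
  proof -
    have s0: "0 < s" using r s by simp
    have "((\<lambda>t. f (s * cis t) * cnj (f (s * cis t)) - f (s * cis t) * cnj (f (r * cis t))
             - f (r * cis t) * cnj (f (s * cis t)) + f (r * cis t) * cnj (f (r * cis t))) has_integral
           complex_of_real (N (s * s)) - complex_of_real (N (s * r)) - complex_of_real (N (r * s))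
           + complex_of_real (N (r * r))) {0..2*pi}"
      by (intro has_integral_add has_integral_diff ip) (use r s s0 in auto)
    then have "((\<lambda>t. Re (f (s * cis t) * cnj (f (s * cis t)) - f (s * cis t) * cnj (f (r * cis t))
             - f (r * cis t) * cnj (f (s * cis t)) + f (r * cis t) * cnj (f (r * cis t)))) has_integral
           Re (complex_of_real (N (s * s)) - complex_of_real (N (s * r)) - complex_of_real (N (r * s))
           + complex_of_real (N (r * r)))) {0..2*pi}"
      by (rule has_integral_Re)
    moreover have "Re (f (s * cis t) * cnj (f (s * cis t)) - f (s * cis t) * cnj (f (r * cis t))
             - f (r * cis t) * cnj (f (s * cis t)) + f (r * cis t) * cnj (f (r * cis t)))
        = (cmod (f (s * cis t) - f (r * cis t)))\<^sup>2" for t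
      by (simp only: cmod_power2) (simp add: power2_eq_square algebra_simps)
    ultimately have "((\<lambda>t. (cmod (f (s * cis t) - f (r * cis t)))\<^sup>2) has_integral
         (N (s * s) - N (s * r) - N (r * s) + N (r * r))) {0..2*pi}"
      by simp
    then have "integral {0..2*pi} (\<lambda>t. (cmod (f (s * cis t) - f (r * cis t)))\<^sup>2) =
       N (s * s) - N (s * r) - N (r * s) + N (r * r)"
      by (rule integral_unique)
    also have "\<dots> \<le> N (s * s) - N (r * r)"
      using mono[OF r(1) s] by (simp add: mult.commute)
    also have "\<dots> \<le> Sup A - N (r * r)"
      using cSup_upper[OF _ bA, of "N (s * s)"] s s0 by (auto simp: A_def)
    also have "\<dots> \<le> \<epsilon>" using r(3) by simp
    finally show ?thesis .
  qed
  show ?thesis by (rule that[OF r(1,2)]) (rule fin)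
qed

section \<open>Almost everywhere differentiability of the primitive along the circle\<close>

text \<open>Pointwise \<open>|g| \<le> l / 2 + |g|\<^sup>2 / (2 * l)\<close>, summed over disjoint
  intervals. The parameter \<open>l\<close> will be a slope threshold, so that the first term can be
  absorbed into a lower bound. Minimum and maximum occur because \<open>y i\<close> may lie on
  either side of \<open>x i\<close>; the interval between them stays in the closure of the ball used
  by the covering.\<close>

lemma sum_norm_integral_le_L2:
  fixes g :: "real \<Rightarrow> complex" and x y :: "'i \<Rightarrow> real"
  assumes cont: "continuous_on {a..b} g" and fin: "finite F" and l: "0 < l"
    and sub: "\<And>i. i \<in> F \<Longrightarrow> ball (x i) \<bar>y i - x i\<bar> \<subseteq> {a<..<b}"
    and disj: "pairwise (\<lambda>i j. disjnt (ball (x i) \<bar>y i - x i\<bar>) (ball (x j) \<bar>y j - x j\<bar>)) F"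
    and ne: "\<And>i. i \<in> F \<Longrightarrow> x i \<noteq> y i"
  shows "(\<Sum>i\<in>F. cmod (integral {min (x i) (y i)..max (x i) (y i)} g))
     \<le> l / 2 * (\<Sum>i\<in>F. \<bar>y i - x i\<bar>) + integral {a..b} (\<lambda>t. (cmod (g t))\<^sup>2) / (2 * l)"
proof -
  define J where "J i = {min (x i) (y i)<..<max (x i) (y i)}" for i
  let ?g2 = "\<lambda>t. (cmod (g t))\<^sup>2"
  have Jb: "J i \<subseteq> ball (x i) \<bar>y i - x i\<bar>" for i
    by (auto simp: J_def dist_real_def min_def max_def split: if_splits)
  have Jab: "{min (x i) (y i)..max (x i) (y i)} \<subseteq> {a..b}" if "i \<in> F" for i
  proof -
    have "closure (J i) \<subseteq> closure {a<..<b}"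
      using Jb[of i] sub[OF that] by (intro closure_mono) blast
    moreover have "closure {a<..<b} \<subseteq> {a..b}"
      by (intro closure_minimal) auto
    moreover have "closure (J i) = {min (x i) (y i)..max (x i) (y i)}"
      unfolding J_def using ne[OF that] by (intro closure_greaterThanLessThan) (auto simp: min_def max_def)
    ultimately show ?thesis by blast
  qed
  have int2: "?g2 integrable_on {min (x i) (y i)..max (x i) (y i)}" if "i \<in> F" for i
    using Jab[OF that] by (intro integrable_continuous_interval continuous_intros continuous_on_subset[OF cont])
  have int1: "(\<lambda>t. cmod (g t)) integrable_on {min (x i) (y i)..max (x i) (y i)}" if "i \<in> F" for i
    using Jab[OF that] by (intro integrable_continuous_interval continuous_intros continuous_on_subset[OF cont])
  have int0: "g integrable_on {min (x i) (y i)..max (x i) (y i)}" if "i \<in> F" for i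
    using Jab[OF that] by (intro integrable_continuous_interval continuous_intros continuous_on_subset[OF cont])
  have one: "cmod (integral {min (x i) (y i)..max (x i) (y i)} g)
      \<le> l / 2 * \<bar>y i - x i\<bar> + integral (J i) ?g2 / (2 * l)" if i: "i \<in> F" for i
  proof -
    let ?I = "{min (x i) (y i)..max (x i) (y i)}"
    have "cmod (integral ?I g) \<le> integral ?I (\<lambda>t. cmod (g t))"
      by (rule integral_norm_bound_integral[OF int0[OF i] int1[OF i]]) auto
    also have "\<dots> \<le> integral ?I (\<lambda>t. l / 2 + ?g2 t / (2 * l))"
    proof (rule integral_le[OF int1[OF i]])
      show "(\<lambda>t. l / 2 + ?g2 t / (2 * l)) integrable_on ?I"
        using int2[OF i] by (intro integrable_add integrable_on_divide integrable_const_ivl)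
      fix t
      have "2 * l * cmod (g t) \<le> l\<^sup>2 + (cmod (g t))\<^sup>2"
        using sum_squares_bound[of l "cmod (g t)"] by simp
      then show "cmod (g t) \<le> l / 2 + ?g2 t / (2 * l)"
        using l by (simp add: field_simps power2_eq_square)
    qed
    also have "\<dots> = integral ?I (\<lambda>t. l / 2) + integral ?I (\<lambda>t. ?g2 t / (2 * l))"
      using int2[OF i] by (intro integral_add integrable_on_divide integrable_const_ivl)
    also have "integral ?I (\<lambda>t. l / 2) = l / 2 * \<bar>y i - x i\<bar>"
      by (simp add: min_def max_def)
    also have "integral ?I (\<lambda>t. ?g2 t / (2 * l)) = integral ?I ?g2 / (2 * l)"
      by simp
    also have "integral ?I ?g2 = integral (J i) ?g2"
      using integrable_integral[OF int2[OF i]] unfolding J_def has_integral_Icc_iff_Ioo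
      by (rule integral_unique[symmetric])
    finally show ?thesis .
  qed
  have "((?g2) has_integral (\<Sum>i\<in>F. integral (J i) ?g2)) (\<Union>i\<in>F. J i)"
  proof (rule has_integral_UN[OF fin])
    show "(?g2 has_integral integral (J i) ?g2) (J i)" if "i \<in> F" for i
      using int2[OF that] unfolding J_def integrable_on_def has_integral_Icc_iff_Ioo
      by (meson integrable_integral integrable_on_def)
    show "pairwise (\<lambda>i j. negligible (J i \<inter> J j)) F"
    proof (rule pairwiseI)
      fix i j assume "i \<in> F" "j \<in> F" "i \<noteq> j"
      then have "disjnt (ball (x i) \<bar>y i - x i\<bar>) (ball (x j) \<bar>y j - x j\<bar>)"
        using disj by (auto simp: pairwise_def)
      then have "J i \<inter> J j = {}" using Jb[of i] Jb[of j] by (auto simp: disjnt_def)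
      then show "negligible (J i \<inter> J j)" by simp
    qed
  qed
  moreover have "(\<Union>i\<in>F. J i) \<subseteq> {a..b}" using Jb sub by fastforce
  moreover have "?g2 integrable_on {a..b}"
    by (intro integrable_continuous_interval continuous_intros cont)
  ultimately have tot: "(\<Sum>i\<in>F. integral (J i) ?g2) \<le> integral {a..b} ?g2"
    by (metis (no_types, lifting) integral_subset_le has_integral_iff zero_le_power2)
  have "(\<Sum>i\<in>F. cmod (integral {min (x i) (y i)..max (x i) (y i)} g))
     \<le> (\<Sum>i\<in>F. l / 2 * \<bar>y i - x i\<bar> + integral (J i) ?g2 / (2 * l))"
    by (rule sum_mono[OF one])
  also have "\<dots> = l / 2 * (\<Sum>i\<in>F. \<bar>y i - x i\<bar>) + (\<Sum>i\<in>F. integral (J i) ?g2) / (2 * l)"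
    by (simp add: sum.distrib sum_distrib_left sum_divide_distrib)
  also have "\<dots> \<le> l / 2 * (\<Sum>i\<in>F. \<bar>y i - x i\<bar>) + integral {a..b} ?g2 / (2 * l)"
    using tot l by (simp add: divide_right_mono)
  finally show ?thesis .
qed

text \<open>The derivative is not known in advance, so it is produced by completeness: the
  difference quotients form a Cauchy filter.\<close>

lemma differentiable_if_quotients_Cauchy:
  fixes H :: "real \<Rightarrow> 'a::banach"
  assumes "\<And>e. 0 < e \<Longrightarrow> \<exists>d>0. \<forall>y y'. y \<noteq> x \<and> \<bar>y - x\<bar> < d \<and> y' \<noteq> x \<and> \<bar>y' - x\<bar> < d \<longrightarrow>
      dist ((H y - H x) /\<^sub>R (y - x)) ((H y' - H x) /\<^sub>R (y' - x)) < e"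
  shows "\<exists>D. (H has_vector_derivative D) (at x)"
proof -
  let ?Q = "\<lambda>y. (H y - H x) /\<^sub>R (y - x)"
  have "cauchy_filter (filtermap ?Q (at x))"
    unfolding cauchy_filter_metric_filtermap
  proof (intro allI impI)
    fix e :: real assume "0 < e"
    then obtain d where d: "d > 0" "\<forall>y y'. y \<noteq> x \<and> \<bar>y - x\<bar> < d \<and> y' \<noteq> x \<and> \<bar>y' - x\<bar> < d \<longrightarrow>
      dist (?Q y) (?Q y') < e" using assms by meson
    show "\<exists>P. eventually P (at x) \<and> (\<forall>y y'. P y \<and> P y' \<longrightarrow> dist (?Q y) (?Q y') < e)"
      using d by (intro exI[of _ "\<lambda>y. y \<noteq> x \<and> \<bar>y - x\<bar> < d"]) (auto simp: eventually_at dist_real_def)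
  qed
  then have "\<exists>c. filtermap ?Q (at x) \<le> nhds c"
    by (rule cauchy_filter_complete_converges[OF _ complete_UNIV]) (auto simp: filtermap_bot_iff)
  then obtain D where "(?Q \<longlongrightarrow> D) (at x)" by (auto simp: filterlim_def)
  then have "((\<lambda>y. (H y - (H x + (y - x) *\<^sub>R D)) /\<^sub>R norm (y - x)) \<longlongrightarrow> 0) (at x)"
  proof -
    assume "(?Q \<longlongrightarrow> D) (at x)"
    then have "((\<lambda>y. norm (?Q y - D)) \<longlongrightarrow> 0) (at x)"
      by (intro tendsto_norm_zero) (simp add: LIM_zero)
    moreover have "norm (?Q y - D) = norm ((H y - (H x + (y - x) *\<^sub>R D)) /\<^sub>R norm (y - x))" if "y \<noteq> x" for y
    proof -
      have "?Q y - D = (H y - (H x + (y - x) *\<^sub>R D)) /\<^sub>R (y - x)"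
        using that by (simp add: scaleR_diff_right scaleR_add_right)
      then show ?thesis by simp
    qed
    ultimately have "((\<lambda>y. norm ((H y - (H x + (y - x) *\<^sub>R D)) /\<^sub>R norm (y - x))) \<longlongrightarrow> 0) (at x)"
      by (subst Lim_cong_within[OF refl refl refl]) auto
    then show ?thesis by (rule tendsto_norm_zero_cancel)
  qed
  then have "(H has_vector_derivative D) (at x)"
    unfolding has_vector_derivative_def has_derivative_at2
    by (auto intro: bounded_linear_scaleR_left simp: divide_inverse)
  then show ?thesis ..
qed

text \<open>With \<open>h\<close> replaced by \<open>W t = h (cis t) - h (r * cis t)\<close>, whose variation is small in the \<open>L\<^sup>2\<close> sense,
  the points with oscillating difference quotients are centres of arbitrarily short intervals on which
  \<open>W\<close> has slope at least \<open>k\<close>; Vitali's covering theorem bounds their measure.\<close>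

lemma primitive_differentiable_ae_circle:
  fixes f h :: "complex \<Rightarrow> complex"
  assumes f: "f holomorphic_on ball 0 1" and bd: "\<And>z. z \<in> ball 0 1 \<Longrightarrow> cmod (f z) \<le> C"
    and h: "continuous_on (cball 0 1) h"
    and dh: "\<And>z. z \<in> ball 0 1 \<Longrightarrow> (h has_field_derivative f z) (at z)"
  shows "negligible {t \<in> {0<..<2*pi}. \<nexists>D. ((\<lambda>t. h (cis t)) has_vector_derivative D) (at t)}"
proof -
  \<comment> \<open>The angular derivative: \<open>h (s * cis t)\<close> has derivative
    \<open>G (s * cis t)\<close> in \<open>t\<close>.\<close>
  define G where "G z = \<i> * z * f z" for z
  have G: "G holomorphic_on ball 0 1" unfolding G_def by (intro holomorphic_intros f)
  have bG: "cmod (G z) \<le> C" if "z \<in> ball 0 1" for z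
  proof -
    have "cmod (G z) = cmod z * cmod (f z)" by (simp add: G_def norm_mult)
    also have "\<dots> \<le> 1 * C" using that bd[OF that] by (intro mult_mono) auto
    finally show ?thesis by simp
  qed
  have contG: "continuous_on S (\<lambda>t. G (s * cis t))" if "0 < s" "s < 1" for S and s :: real
    by (intro continuous_intros continuous_on_compose2[OF holomorphic_on_imp_continuous_on[OF G]])
       (use that in \<open>auto simp: norm_mult\<close>)
  have dV: "((\<lambda>t. h (s * cis t)) has_vector_derivative G (s * cis t)) (at t)"
    if s: "0 < s" "s < 1" for s t :: real
  proof -
    have "((\<lambda>t. s * cis t) has_vector_derivative s * (\<i> * cis t)) (at t)"
      by (auto intro!: derivative_eq_intros simp: has_vector_derivative_def)
    from field_vector_diff_chain_at[OF this, of h "f (s * cis t)"]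
    show ?thesis using dh[of "s * cis t"] s
      by (simp add: G_def norm_mult o_def mult_ac)
  qed
  have inc: "((\<lambda>t. G (s * cis t)) has_integral h (s * cis y) - h (s * cis x)) {x..y}"
    if "0 < s" "s < 1" "x \<le> y" for s x y :: real
    by (rule fundamental_theorem_of_calculus[OF that(3)])
       (rule has_vector_derivative_at_within[OF dV[OF that(1,2)]])
  define Q where "Q x y = (h (cis y) - h (cis x)) /\<^sub>R (y - x)" for x y
  define S where "S l = {x \<in> {0<..<2*pi}. \<forall>d>0. \<exists>y y'. y \<noteq> x \<and> \<bar>y - x\<bar> < d \<and> y' \<noteq> x \<and> \<bar>y' - x\<bar> < d
      \<and> l \<le> dist (Q x y) (Q x y')}" for l
  have negS: "negligible (S l)" if l: "0 < l" for l
    unfolding negligible_outer_le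
  proof (intro allI impI)
    fix e :: real assume e: "0 < e"
    \<comment> \<open>Two quotients at distance at least \<open>4 * k\<close> both lie near
      \<open>G (r * cis x)\<close>, up to an error below \<open>k\<close> from the smooth part and
      the slope of \<open>W\<close>; so one of the two slopes of \<open>W\<close> is at least
      \<open>k\<close>.\<close>
    define k where "k = l / 4"
    have k: "0 < k" using l by (simp add: k_def)
    \<comment> \<open>Chosen backwards: the radii of the chosen intervals will sum to at most
      \<open>\<epsilon> / k\<^sup>2\<close>, hence their lengths to at most
      \<open>e\<close>.\<close>
    define \<epsilon> where "\<epsilon> = e * k\<^sup>2 / 2"
    have "0 < \<epsilon>" using e k by (simp add: \<epsilon>_def)
    obtain r :: real where r: "0 < r" "r < 1" and L2: "\<And>s::real. \<lbrakk>r \<le> s; s < 1\<rbrakk> \<Longrightarrow>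
      integral {0..2*pi} (\<lambda>t. (cmod (G (s * cis t) - G (r * cis t)))\<^sup>2) \<le> \<epsilon>"
      by (rule circle_means_L2_Cauchy[OF G bG \<open>0 < \<epsilon>\<close>]) (assumption, rule that)
    define W where "W t = h (cis t) - h (r * cis t)" for t
    define K where "K = {(x, y). ball x \<bar>y - x\<bar> \<subseteq> {0<..<2*pi} \<and> x \<noteq> y \<and> k * \<bar>y - x\<bar> \<le> cmod (W y - W x)}"
    have cover: "\<exists>i. i \<in> K \<and> x \<in> ball (fst i) \<bar>snd i - fst i\<bar> \<and> \<bar>snd i - fst i\<bar> < d"
      if x: "x \<in> S l" and d: "0 < d" for x d
    proof -
      have "x \<in> {0<..<2*pi}" using x by (simp add: S_def)
      then obtain d1 where d1: "0 < d1" "ball x d1 \<subseteq> {0<..<2*pi}"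
        by (metis open_contains_ball open_greaterThanLessThan)
      \<comment> \<open>\<open>V\<close> lives on a circle inside the disc and is differentiable;
        only \<open>W\<close>, the difference of \<open>h (cis t)\<close> and \<open>V t\<close>,
        can make the quotients oscillate.\<close>
      define V where "V t = h (r * cis t)" for t
      have "((\<lambda>y. (V y - (V x + (y - x) *\<^sub>R G (r * cis x))) /\<^sub>R norm (y - x)) \<longlongrightarrow> 0) (at x)"
        using dV[OF r, of x] unfolding has_vector_derivative_def has_derivative_at2 V_def by (auto simp: divide_inverse)
      then obtain d2 where d2: "0 < d2" "\<And>y. y \<noteq> x \<Longrightarrow> dist y x < d2 \<Longrightarrow>
          norm ((V y - (V x + (y - x) *\<^sub>R G (r * cis x))) /\<^sub>R norm (y - x)) < k"
        unfolding tendsto_iff eventually_at using k by (auto simp: dist_norm)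
      define d' where "d' = min d (min d1 d2)"
      have "0 < d'" using d d1 d2 by (simp add: d'_def)
      then obtain y y' where y: "y \<noteq> x" "\<bar>y - x\<bar> < d'" "y' \<noteq> x" "\<bar>y' - x\<bar> < d'" "l \<le> dist (Q x y) (Q x y')"
        using x by (auto simp: S_def)
      have key: "Q x y - G (r * cis x) = (V y - (V x + (y - x) *\<^sub>R G (r * cis x))) /\<^sub>R (y - x) + (W y - W x) /\<^sub>R (y - x)"
        if "y \<noteq> x" for y
        using that by (simp add: Q_def V_def W_def scaleR_diff_right scaleR_add_right)
      have small: "cmod (Q x y - G (r * cis x)) < k + cmod (W y - W x) / \<bar>y - x\<bar>" if "y \<noteq> x" "\<bar>y - x\<bar> < d'" for y
      proof -
        have "cmod (Q x y - G (r * cis x)) \<le> cmod ((V y - (V x + (y - x) *\<^sub>R G (r * cis x))) /\<^sub>R (y - x)) + cmod ((W y - W x) /\<^sub>R (y - x))"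
          unfolding key[OF that(1)] by (rule norm_triangle_ineq)
        also have "cmod ((V y - (V x + (y - x) *\<^sub>R G (r * cis x))) /\<^sub>R (y - x)) < k"
          using d2(2)[OF that(1)] that(2) by (simp add: d'_def dist_real_def)
        finally show ?thesis by (simp add: divide_inverse mult.commute)
      qed
      have "l \<le> cmod (Q x y - G (r * cis x)) + cmod (Q x y' - G (r * cis x))"
        using y(5) by (metis dist_norm dist_triangle2 order_trans)
      with small[OF y(1,2)] small[OF y(3,4)]
      have "k \<le> cmod (W y - W x) / \<bar>y - x\<bar> \<or> k \<le> cmod (W y' - W x) / \<bar>y' - x\<bar>"
        using k_def by linarith
      then obtain u where u: "u \<noteq> x" "\<bar>u - x\<bar> < d'" "k \<le> cmod (W u - W x) / \<bar>u - x\<bar>"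
        using y by blast
      have "(x, u) \<in> K"
        using u d1 subset_ball[of "\<bar>u - x\<bar>" d1 x] by (auto simp: K_def d'_def pos_le_divide_eq)
      then show ?thesis
        using u by (intro exI[of _ "(x, u)"]) (auto simp: d'_def)
    qed
    obtain D where D: "countable D" "D \<subseteq> K"
      and disj: "pairwise (\<lambda>i j. disjnt (ball (fst i) \<bar>snd i - fst i\<bar>) (ball (fst j) \<bar>snd j - fst j\<bar>)) D"
      and neg: "negligible (S l - (\<Union>i\<in>D. ball (fst i) \<bar>snd i - fst i\<bar>))"
      by (rule Vitali_covering_theorem_balls[of "S l" K fst "\<lambda>i. \<bar>snd i - fst i\<bar>", OF cover])
    have fin: "measure lebesgue (\<Union>i\<in>F. ball (fst i) \<bar>snd i - fst i\<bar>) \<le> e" if F: "F \<subseteq> D" "finite F" for F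
    proof -
      have FK: "ball (fst i) \<bar>snd i - fst i\<bar> \<subseteq> {0<..<2*pi}" "fst i \<noteq> snd i"
        "k * \<bar>snd i - fst i\<bar> \<le> cmod (W (snd i) - W (fst i))" if "i \<in> F" for i
      proof -
        have "i \<in> K" using that F D by blast
        then show "ball (fst i) \<bar>snd i - fst i\<bar> \<subseteq> {0<..<2*pi}" "fst i \<noteq> snd i"
          "k * \<bar>snd i - fst i\<bar> \<le> cmod (W (snd i) - W (fst i))"
          by (simp_all add: K_def case_prod_beta)
      qed
      let ?s = "\<Sum>i\<in>F. \<bar>snd i - fst i\<bar>"
      \<comment> \<open>The estimate is made on circles of radius \<open>s < 1\<close>, where
        increments of \<open>h\<close> are integrals of \<open>G\<close>, and reaches the unit
        circle by continuity of \<open>h\<close>.\<close>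
      define Ws where "Ws s t = h (of_real s * cis t) - h (r * cis t)" for s t
      have bnd: "(\<Sum>i\<in>F. cmod (Ws s (snd i) - Ws s (fst i))) \<le> k / 2 * ?s + \<epsilon> / (2 * k)"
        if s: "r \<le> s" "s < 1" for s
      proof -
        have s0: "0 < s" using r s by simp
        have "cmod (Ws s (snd i) - Ws s (fst i)) = cmod (integral {min (fst i) (snd i)..max (fst i) (snd i)}
            (\<lambda>t. G (s * cis t) - G (r * cis t)))" for i :: "real \<times> real"
        proof -
          have "((\<lambda>t. G (s * cis t) - G (r * cis t)) has_integral
             (h (s * cis y) - h (s * cis x)) - (h (r * cis y) - h (r * cis x))) {x..y}" if "x \<le> y" for x y :: real
            by (intro has_integral_diff inc that r s s0)
          note hi = this
          have I: "integral {x..y} (\<lambda>t. G (s * cis t) - G (r * cis t)) = Ws s y - Ws s x"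
            if "x \<le> y" for x y :: real
            by (subst integral_unique[OF hi[OF that]]) (simp add: Ws_def)
          show ?thesis
            by (cases "fst i \<le> snd i") (simp_all add: I min_def max_def norm_minus_commute)
        qed
        then have "(\<Sum>i\<in>F. cmod (Ws s (snd i) - Ws s (fst i))) \<le> k / 2 * ?s
           + integral {0..2*pi} (\<lambda>t. (cmod (G (s * cis t) - G (r * cis t)))\<^sup>2) / (2 * k)"
          using F disj r s s0
          by (simp only:) (intro sum_norm_integral_le_L2 continuous_intros contG k FK
             pairwise_mono[OF disj] | simp)+
        also have "\<dots> \<le> k / 2 * ?s + \<epsilon> / (2 * k)"
          using L2[OF s] k by (simp add: divide_right_mono)
        finally show ?thesis .
      qed
      have lim: "((\<lambda>s. \<Sum>i\<in>F. cmod (Ws s (snd i) - Ws s (fst i))) \<longlongrightarrow>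
          (\<Sum>i\<in>F. cmod (W (snd i) - W (fst i)))) (at_left 1)"
      proof -
        have "((\<lambda>s. h (complex_of_real s * cis t)) \<longlongrightarrow> h (cis t)) (at_left 1)" for t
        proof -
          have "continuous_on {0..1} (\<lambda>s. h (complex_of_real s * cis t))"
            by (intro continuous_on_compose2[OF h] continuous_intros) (auto simp: norm_mult)
          then have "((\<lambda>s. h (complex_of_real s * cis t)) \<longlongrightarrow> h (complex_of_real 1 * cis t)) (at 1 within {0..1})"
            unfolding continuous_on_def by (rule bspec) simp
          then show ?thesis by (simp add: at_within_Icc_at_left)
        qed
        then show ?thesis unfolding Ws_def W_def by (intro tendsto_intros)
      qed
      have "k * ?s \<le> (\<Sum>i\<in>F. cmod (W (snd i) - W (fst i)))"
        unfolding sum_distrib_left by (rule sum_mono) (rule FK)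
      also have "\<dots> \<le> k / 2 * ?s + \<epsilon> / (2 * k)"
      proof (rule tendsto_upperbound[OF lim])
        show "\<forall>\<^sub>F s in at_left 1. (\<Sum>i\<in>F. cmod (Ws s (snd i) - Ws s (fst i))) \<le> k / 2 * ?s + \<epsilon> / (2 * k)"
          using r by (intro eventually_mono[OF eventually_at_left_real[of r 1]] bnd) auto
      qed simp
      finally have "?s \<le> \<epsilon> / k\<^sup>2"
        using k by (simp add: field_simps power2_eq_square)
      have "measure lebesgue (\<Union>i\<in>F. ball (fst i) \<bar>snd i - fst i\<bar>) \<le> (\<Sum>i\<in>F. measure lebesgue (ball (fst i) \<bar>snd i - fst i\<bar>))"
        by (rule measure_UNION_le[OF F(2)]) auto
      also have "\<dots> = (\<Sum>i\<in>F. 2 * \<bar>snd i - fst i\<bar>)"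
        by (simp add: ball_eq_greaterThanLessThan)
      also have "\<dots> = 2 * ?s" by (simp add: sum_distrib_left)
      also have "\<dots> \<le> e"
        using \<open>?s \<le> \<epsilon> / k\<^sup>2\<close> k by (simp add: \<epsilon>_def)
      finally show ?thesis .
    qed
    let ?U = "\<Union>i\<in>D. ball (fst i) \<bar>snd i - fst i\<bar>"
    have U: "?U \<in> lmeasurable" "measure lebesgue ?U \<le> e"
      by (intro fmeasurable_UN_bound[OF D(1) _ fin] measure_UN_bound[OF D(1) _ fin]; simp)+
    show "\<exists>T. S l \<subseteq> T \<and> T \<in> lmeasurable \<and> measure lebesgue T \<le> e"
    proof (intro exI conjI)
      show "S l \<subseteq> ?U \<union> (S l - ?U)" by blast
      show "?U \<union> (S l - ?U) \<in> lmeasurable"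
        by (intro fmeasurable.Un U(1) negligible_imp_measurable[OF neg])
      have "measure lebesgue (?U \<union> (S l - ?U)) \<le> measure lebesgue ?U + measure lebesgue (S l - ?U)"
        by (rule measure_Un_le) (use U neg in \<open>auto intro: negligible_imp_sets\<close>)
      then show "measure lebesgue (?U \<union> (S l - ?U)) \<le> e"
        using U(2) negligible_imp_measure0[OF neg] by linarith
    qed
  qed
  have "{t \<in> {0<..<2*pi}. \<nexists>D. ((\<lambda>t. h (cis t)) has_vector_derivative D) (at t)} \<subseteq> (\<Union>n::nat. S (1 / real (Suc n)))"
  proof clarify
    fix x assume x: "x \<in> {0<..<2*pi}" and nd: "\<nexists>D. ((\<lambda>t. h (cis t)) has_vector_derivative D) (at x)"
    then obtain e where e: "0 < e" and ne: "\<not> (\<exists>d>0. \<forall>y y'. y \<noteq> x \<and> \<bar>y - x\<bar> < d \<and> y' \<noteq> x \<and> \<bar>y' - x\<bar> < d \<longrightarrow>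
      dist (Q x y) (Q x y') < e)"
      using differentiable_if_quotients_Cauchy[of x "\<lambda>t. h (cis t)"] unfolding Q_def by blast
    obtain n where n: "1 / real (Suc n) < e" using e nat_approx_posE by blast
    have "\<exists>y y'. y \<noteq> x \<and> \<bar>y - x\<bar> < d \<and> y' \<noteq> x \<and> \<bar>y' - x\<bar> < d \<and> 1 / real (Suc n) \<le> dist (Q x y) (Q x y')"
      if "0 < d" for d
    proof -
      from ne that obtain y y' where "y \<noteq> x \<and> \<bar>y - x\<bar> < d \<and> y' \<noteq> x \<and> \<bar>y' - x\<bar> < d" "\<not> dist (Q x y) (Q x y') < e"
        by blast
      then show ?thesis using n by (intro exI[of _ y] exI[of _ y']) linarith
    qed
    then have "x \<in> S (1 / real (Suc n))"
      unfolding S_def using x by blast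
    then show "x \<in> (\<Union>n::nat. S (1 / real (Suc n)))" by blast
  qed
  moreover have "negligible (\<Union>n::nat. S (1 / real (Suc n)))"
    by (intro negligible_countable_Union) (auto intro!: negS)
  ultimately show ?thesis by (rule negligible_subset[rotated])
qed

text \<open>A Phragmen--Lindelof argument: the barrier \<open>B\<close> is \<open>1\<close> at \<open>\<zeta>\<close> and small on the rest of the circle, and
  the quotient \<open>(K w * B w) / (w - \<zeta>)\<close>, possibly discontinuous at \<open>\<zeta>\<close>, obeys the maximum principle because
  \<open>(w - \<zeta>)\<close> times any power of it does.\<close>

lemma disc_estimate_near_boundary_point:
  fixes K :: "complex \<Rightarrow> complex"
  assumes hol: "K holomorphic_on ball 0 1" and cont: "continuous_on (cball 0 1) K" and \<zeta>: "cmod \<zeta> = 1"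
    and lip: "\<And>z. z \<in> cball 0 1 \<Longrightarrow> cmod (K z) \<le> L * cmod (z - \<zeta>)"
    and pos: "0 < \<epsilon>" "0 < \<delta>"
    and arc: "\<And>z. \<lbrakk>cmod z = 1; cmod (z - \<zeta>) < \<delta>\<rbrakk> \<Longrightarrow> cmod (K z) \<le> \<epsilon> * cmod (z - \<zeta>)"
  shows "\<exists>d>0. \<forall>z\<in>ball 0 1. cmod (z - \<zeta>) < d \<longrightarrow> cmod (K z) \<le> 2 * \<epsilon> * cmod (z - \<zeta>)"
proof -
  define L' where "L' = max L 1"
  have L': "0 < L'" and lip': "\<And>z. z \<in> cball 0 1 \<Longrightarrow> cmod (K z) \<le> L' * cmod (z - \<zeta>)"
    unfolding L'_def by (simp, rule order_trans[OF lip mult_right_mono]) auto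
  \<comment> \<open>Gives \<open>A * (\<delta>\<^sup>2 / 2) = L' / \<epsilon>\<close>. Off the arc
    \<open>1 - Re (z * cnj \<zeta>)\<close> is at least \<open>\<delta>\<^sup>2 / 2\<close>, so
    there the barrier brings the Lipschitz constant down to \<epsilon>.\<close>
  define A where "A = 2 * L' / (\<epsilon> * \<delta>\<^sup>2)"
  have A: "0 < A" using L' pos by (simp add: A_def)
  define B where "B z = exp (- of_real A * (1 - z * cnj \<zeta>))" for z
  define T where "T z = A * (1 - Re (z * cnj \<zeta>))" for z
  have nB: "cmod (B z) = exp (- T z)" for z
    by (simp add: B_def T_def)
  have re: "Re (z * cnj \<zeta>) \<le> 1" if "z \<in> cball 0 1" for z
    using complex_Re_le_cmod[of "z * cnj \<zeta>"] that \<zeta> by (simp add: norm_mult)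
  have B1: "cmod (B z) \<le> 1" if "z \<in> cball 0 1" for z
    using re[OF that] A by (simp add: nB T_def del: times_complex.sel complex_cnj)
  have KB: "cmod (K z * B z) \<le> L' * cmod (z - \<zeta>)" if "z \<in> cball 0 1" for z
    using mult_mono[OF lip'[OF that] B1[OF that]] L' by (simp add: norm_mult)
  have KBs: "cmod (K z * B z) \<le> \<epsilon> * cmod (z - \<zeta>)" if z: "cmod z = 1" for z
  proof (cases "cmod (z - \<zeta>) < \<delta>")
    case True
    have "z \<in> cball 0 1" using z by simp
    from mult_mono[OF arc[OF z True] B1[OF this]] pos show ?thesis by (simp add: norm_mult)
  next
    case False
    have zc: "z \<in> cball 0 1" using z by simp
    have "(cmod (z - \<zeta>))\<^sup>2 = 2 - 2 * Re (z * cnj \<zeta>)"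
    proof -
      have "(Re z)\<^sup>2 + (Im z)\<^sup>2 = 1" "(Re \<zeta>)\<^sup>2 + (Im \<zeta>)\<^sup>2 = 1"
        using z \<zeta> by (simp_all only: cmod_power2[symmetric] one_power2)
      then show ?thesis
        unfolding cmod_power2 by (simp add: power2_eq_square algebra_simps)
    qed
    moreover have "\<delta>\<^sup>2 \<le> (cmod (z - \<zeta>))\<^sup>2"
      using False pos by (intro power_mono) auto
    ultimately have "\<delta>\<^sup>2 / 2 \<le> 1 - Re (z * cnj \<zeta>)" by simp
    then have "A * (\<delta>\<^sup>2 / 2) \<le> T z"
      unfolding T_def using A by (intro mult_left_mono) auto
    moreover have "A * (\<delta>\<^sup>2 / 2) = L' / \<epsilon>"
      using pos by (simp add: A_def)
    ultimately have "L' / \<epsilon> \<le> exp (T z)"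
      using exp_ge_add_one_self[of "T z"] by linarith
    then have "L' * cmod (B z) \<le> \<epsilon>"
      using pos by (simp add: nB exp_minus field_simps)
    have "cmod (K z * B z) \<le> L' * cmod (z - \<zeta>) * cmod (B z)"
      using lip'[OF zc] by (simp add: norm_mult mult_right_mono)
    also have "\<dots> = (L' * cmod (B z)) * cmod (z - \<zeta>)" by simp
    also have "\<dots> \<le> \<epsilon> * cmod (z - \<zeta>)"
      using \<open>L' * cmod (B z) \<le> \<epsilon>\<close> by (rule mult_right_mono) simp
    finally show ?thesis .
  qed
  have main: "cmod (K z * B z) \<le> \<epsilon> * cmod (z - \<zeta>)" if z: "z \<in> ball 0 1" for z
  proof (rule ccontr)
    assume neg: "\<not> ?thesis"
    define x where "x = cmod (K z * B z)"
    define d where "d = cmod (z - \<zeta>)"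
    have d: "0 < d" using z \<zeta> by (auto simp: d_def)
    have gt: "\<epsilon> * d < x" using neg by (simp add: x_def d_def)
    have pow: "(x / (\<epsilon> * d)) ^ Suc n \<le> 2 / d" for n
    proof -
      \<comment> \<open>With one factor \<open>w - \<zeta>\<close> fewer below than powers above,
        the Lipschitz bound forces \<open>P\<close> to 0 at \<zeta>, while on the circle
        \<open>P\<close> is at most \<open>2 * \<epsilon> ^ Suc n\<close>. Large \<open>n\<close>
        later beats the fixed factor \<open>2 / d\<close>.\<close>
      define P where "P w = (if w = \<zeta> then 0 else (K w * B w) ^ Suc n / (w - \<zeta>) ^ n)" for w
      have "cmod (P z) \<le> 2 * \<epsilon> ^ Suc n"
      proof (rule maximum_modulus_frontier[of P "ball 0 1"])
        have "(\<lambda>w. (K w * B w) ^ Suc n / (w - \<zeta>) ^ n) holomorphic_on ball 0 1"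
          unfolding B_def using \<zeta> by (intro holomorphic_intros hol) auto
        then show "P holomorphic_on interior (ball 0 1)"
          unfolding interior_ball by (rule holomorphic_transform) (use \<zeta> in \<open>auto simp: P_def\<close>)
        have bP: "cmod (P w) \<le> c ^ Suc n * cmod (w - \<zeta>)"
          if "cmod (K w * B w) \<le> c * cmod (w - \<zeta>)" for c w
        proof (cases "w = \<zeta>")
          case False
          have "cmod (P w) = cmod (K w * B w) ^ Suc n / cmod (w - \<zeta>) ^ n"
            using False by (simp add: P_def norm_divide norm_power norm_mult)
          also have "\<dots> \<le> (c * cmod (w - \<zeta>)) ^ Suc n / cmod (w - \<zeta>) ^ n"
            using that by (intro divide_right_mono power_mono) auto
          also have "\<dots> = c ^ Suc n * cmod (w - \<zeta>)"
            using False by (simp add: power_mult_distrib)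
          finally show ?thesis .
        qed (simp add: P_def)
        show "continuous_on (closure (ball 0 1)) P"
          unfolding continuous_on_def
        proof
          fix w :: complex assume w: "w \<in> closure (ball 0 1)"
          then have w: "w \<in> cball 0 1" by simp
          have "(P \<longlongrightarrow> P w) (at w within cball 0 1)"
          proof (cases "w = \<zeta>")
            case True
            have "((\<lambda>v. L' ^ Suc n * cmod (v - \<zeta>)) \<longlongrightarrow> L' ^ Suc n * cmod (\<zeta> - \<zeta>)) (at \<zeta> within cball 0 1)"
              by (intro tendsto_intros)
            then have "((\<lambda>v. L' ^ Suc n * cmod (v - \<zeta>)) \<longlongrightarrow> 0) (at \<zeta> within cball 0 1)" by simp
            then have "(P \<longlongrightarrow> 0) (at \<zeta> within cball 0 1)"
              by (rule Lim_null_comparison[rotated])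
                 (use bP[OF KB] in \<open>auto simp: eventually_at_filter simp del: power_Suc\<close>)
            then show ?thesis using True by (simp add: P_def)
          next
            case False
            have "((\<lambda>w. (K w * B w) ^ Suc n / (w - \<zeta>) ^ n) \<longlongrightarrow> (K w * B w) ^ Suc n / (w - \<zeta>) ^ n) (at w within cball 0 1)"
              unfolding B_def using False cont w by (intro tendsto_intros) (auto simp: continuous_on_def)
            then have "((\<lambda>w. (K w * B w) ^ Suc n / (w - \<zeta>) ^ n) \<longlongrightarrow> P w) (at w within cball 0 1)"
              using False by (simp add: P_def)
            then show ?thesis
            proof (rule Lim_transform_eventually)
              have "\<forall>\<^sub>F v in at w within cball 0 1. v \<noteq> \<zeta>"
                using False by (intro eventually_neq_at_within)
              then show "\<forall>\<^sub>F v in at w within cball 0 1. (K v * B v) ^ Suc n / (v - \<zeta>) ^ n = P v"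
                by eventually_elim (simp add: P_def)
            qed
          qed
          then show "(P \<longlongrightarrow> P w) (at w within closure (ball 0 1))" by simp
        qed
        show "cmod (P w) \<le> 2 * \<epsilon> ^ Suc n" if "w \<in> frontier (ball 0 1)" for w
        proof -
          have w: "cmod w = 1" using that by simp
          have "cmod (P w) \<le> \<epsilon> ^ Suc n * cmod (w - \<zeta>)" by (rule bP[OF KBs[OF w]])
          also have "\<dots> \<le> \<epsilon> ^ Suc n * 2"
            using norm_triangle_ineq4[of w \<zeta>] w \<zeta> pos by (intro mult_left_mono) auto
          finally show ?thesis by simp
        qed
      qed (use z in auto)
      moreover have "cmod (P z) = x ^ Suc n / d ^ n"
        using d by (auto simp: P_def x_def d_def norm_divide norm_power norm_mult)
      ultimately have "x ^ Suc n \<le> 2 * \<epsilon> ^ Suc n * d ^ n"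
        using d by (simp add: field_simps)
      then show ?thesis
        using d pos by (simp add: power_divide power_mult_distrib field_simps)
    qed
    have "1 < x / (\<epsilon> * d)" using gt d pos by simp
    then obtain n where "2 / d < (x / (\<epsilon> * d)) ^ n" using real_arch_pow by blast
    also have "\<dots> \<le> (x / (\<epsilon> * d)) ^ Suc n"
      using \<open>1 < x / (\<epsilon> * d)\<close> by (intro power_increasing) auto
    finally show False using pow[of n] by simp
  qed
  show ?thesis
  \<comment> \<open>Within this distance of \<zeta> the barrier has modulus at least 1/2, which
    costs the factor 2 in the claim.\<close>
  proof (intro exI[of _ "ln 2 / A"] conjI ballI impI)
    show "0 < ln 2 / A" using A by simp
    fix z assume z: "z \<in> ball 0 1" and d: "cmod (z - \<zeta>) < ln 2 / A"
    have "1 - Re (z * cnj \<zeta>) = Re ((\<zeta> - z) * cnj \<zeta>)"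
    proof -
      have "\<zeta> * cnj \<zeta> = 1" by (metis complex_norm_square \<zeta> of_real_1 one_power2)
      then show ?thesis by (simp only: left_diff_distrib minus_complex.sel one_complex.sel)
    qed
    also have "\<dots> \<le> cmod ((\<zeta> - z) * cnj \<zeta>)" by (rule complex_Re_le_cmod)
    also have "\<dots> = cmod (z - \<zeta>)" using \<zeta> by (simp add: norm_mult norm_minus_commute)
    finally have "T z \<le> A * cmod (z - \<zeta>)" unfolding T_def using A by (intro mult_left_mono) auto
    also have "\<dots> \<le> ln 2" using d A by (simp add: field_simps)
    finally have "exp (T z) \<le> exp (ln 2)" by (simp only: exp_le_cancel_iff)
    then have "1 \<le> 2 * cmod (B z)" by (simp add: nB exp_minus field_simps)
    then have "cmod (K z) \<le> cmod (K z) * (2 * cmod (B z))"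
      by (simp add: mult_le_cancel_left1)
    also have "\<dots> \<le> 2 * \<epsilon> * cmod (z - \<zeta>)" using main[OF z] by (simp add: norm_mult)
    finally show "cmod (K z) \<le> 2 * \<epsilon> * cmod (z - \<zeta>)" .
  qed
qed

section \<open>From derivatives along the circle to non-tangential limits\<close>

text \<open>Subtracting from \<open>h\<close> its linear approximation at \<zeta> leaves
  \<open>K\<close>, which is small compared with \<open>|z - \<zeta>|\<close> on the circle and
  then, by the preceding estimate, in the disc. Cauchy's inequality on a disc of radius comparable
  to \<open>1 - |z|\<close> turns this into smallness of \<open>f - c\<close>; in a Stolz region
  \<open>|z - \<zeta>|\<close> is bounded by a multiple of that radius.\<close>

lemma nontangential_limit_of_derivative:
  fixes f h :: "complex \<Rightarrow> complex"
  assumes h: "L-lipschitz_on (cball 0 1) h"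
    and dh: "\<And>z. z \<in> ball 0 1 \<Longrightarrow> (h has_field_derivative f z) (at z)"
    and D: "((\<lambda>t. h (cis t)) has_vector_derivative D) (at t)"
  shows "(f \<longlongrightarrow> D / (\<i> * cis t)) (at (cis t) within stolz_region M (cis t))"
proof -
  define c where "c = D / (\<i> * cis t)"
  define \<zeta> where "\<zeta> = cis t"
  have \<zeta>: "cmod \<zeta> = 1" "\<zeta> \<noteq> 0" by (simp_all add: \<zeta>_def)
  define K where "K z = h z - h \<zeta> - c * (z - \<zeta>)" for z
  have cont: "continuous_on (cball 0 1) h" by (rule lipschitz_on_continuous_on[OF h])
  have contK: "continuous_on (cball 0 1) K" unfolding K_def by (intro continuous_intros cont)
  have dK: "(K has_field_derivative f z - c) (at z)" if "z \<in> ball 0 1" for z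
    unfolding K_def by (auto intro!: derivative_eq_intros dh[OF that])
  have holK: "K holomorphic_on ball 0 1"
    unfolding holomorphic_on_open[OF open_ball] using dK by blast
  have lipK: "cmod (K z) \<le> (L + cmod c) * cmod (z - \<zeta>)" if "z \<in> cball 0 1" for z
  proof -
    have "cmod (K z) \<le> cmod (h z - h \<zeta>) + cmod (c * (z - \<zeta>))"
      unfolding K_def by (rule norm_triangle_ineq4)
    also have "cmod (h z - h \<zeta>) \<le> L * cmod (z - \<zeta>)"
      using lipschitz_onD[OF h that, of \<zeta>] \<zeta> by (simp add: dist_norm)
    finally show ?thesis by (simp add: norm_mult distrib_right)
  qed
  define \<Phi> where "\<Phi> y = h (cis y) - c * cis y" for y
  have "(\<Phi> has_vector_derivative D - c * (\<i> * cis t)) (at t)"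
    unfolding \<Phi>_def using D
    by (auto intro!: derivative_eq_intros simp: has_vector_derivative_def scaleR_diff_right)
  then have d\<Phi>: "(\<Phi> has_derivative (\<lambda>x. 0)) (at t)"
    by (simp add: c_def has_vector_derivative_def)
  \<comment> \<open>A local inverse of \<open>cis\<close> at \<zeta>, extended to complex
    \<open>z\<close>, so that the derivative in the angle yields a first-order estimate in
    \<open>z\<close>.\<close>
  define Y where "Y z = t + Im (Ln (z / \<zeta>))" for z
  have "((\<lambda>z. Ln (z / \<zeta>)) has_field_derivative 1 / \<zeta>) (at \<zeta>)"
    using \<zeta> by (auto intro!: derivative_eq_intros)
  then have "((\<lambda>z. Ln (z / \<zeta>)) has_derivative (\<lambda>x. (1 / \<zeta>) * x)) (at \<zeta>)"
    by (simp only: has_field_derivative_def)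
  then have "(Y has_derivative (\<lambda>x. 0 + Im ((1 / \<zeta>) * x))) (at \<zeta>)"
    unfolding Y_def by (intro has_derivative_add has_derivative_const has_derivative_Im)
  moreover have "Y \<zeta> = t" using \<zeta> by (simp add: Y_def)
  ultimately have "((\<lambda>z. \<Phi> (Y z)) has_derivative (\<lambda>x. 0)) (at \<zeta>)"
    using d\<Phi> by (auto intro: has_derivative_compose[of Y _ \<zeta> UNIV \<Phi> "\<lambda>x. 0"])
  then have o: "((\<lambda>z. norm (\<Phi> (Y z) - \<Phi> (Y \<zeta>)) / norm (z - \<zeta>)) \<longlongrightarrow> 0) (at \<zeta>)"
    by (simp add: has_derivative_iff_norm)
  have KY: "K z = \<Phi> (Y z) - \<Phi> (Y \<zeta>)" if "cmod z = 1" for z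
  proof -
    have "z / \<zeta> \<noteq> 0" using that \<zeta> by auto
    then have "cis (Im (Ln (z / \<zeta>))) = z / \<zeta>"
      using exp_Ln[of "z / \<zeta>"] that \<zeta> by (simp add: exp_eq_polar norm_divide)
    then have "cis (Y z) = z" using \<zeta> by (simp add: Y_def cis_mult[symmetric] \<zeta>_def)
    then show ?thesis using \<open>Y \<zeta> = t\<close> by (simp add: K_def \<Phi>_def \<zeta>_def algebra_simps)
  qed
  have "(f \<longlongrightarrow> c) (at \<zeta> within stolz_region M \<zeta>)"
    unfolding tendsto_iff
  proof (intro allI impI)
    fix e :: real assume e: "0 < e"
    \<comment> \<open>The disc estimate contributes the 2, and on the Cauchy circle
      \<open>|w - \<zeta>|\<close> is at most \<open>(2 * |M| + 1) * \<rho>\<close>; the extra unit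
      makes the final inequality strict.\<close>
    define \<epsilon> where "\<epsilon> = e / (2 * (2 * \<bar>M\<bar> + 2))"
    have \<epsilon>: "0 < \<epsilon>" using e by (simp add: \<epsilon>_def)
    obtain \<delta> where \<delta>: "0 < \<delta>" "\<And>z. z \<noteq> \<zeta> \<Longrightarrow> dist z \<zeta> < \<delta> \<Longrightarrow> norm (\<Phi> (Y z) - \<Phi> (Y \<zeta>)) / norm (z - \<zeta>) < \<epsilon>"
      using o \<epsilon> unfolding tendsto_iff eventually_at by fastforce
    have arc: "cmod (K z) \<le> \<epsilon> * cmod (z - \<zeta>)" if "cmod z = 1" "cmod (z - \<zeta>) < \<delta>" for z
    proof (cases "z = \<zeta>")
      case False
      then show ?thesis using \<delta>(2)[OF False] that unfolding KY[OF that(1)] by (simp add: dist_norm field_simps)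
    qed (simp add: K_def)
    obtain d where d: "0 < d" "\<And>z. z \<in> ball 0 1 \<Longrightarrow> cmod (z - \<zeta>) < d \<Longrightarrow> cmod (K z) \<le> 2 * \<epsilon> * cmod (z - \<zeta>)"
      using disc_estimate_near_boundary_point[OF holK contK \<zeta>(1) lipK \<epsilon> \<delta>(1) arc] by blast
    have "dist (f z) c < e" if z: "z \<in> stolz_region M \<zeta>" "dist z \<zeta> < d / 2" for z
    proof -
      \<comment> \<open>Half the distance to the unit circle: the closed disc around
        \<open>z\<close> stays inside, and the Stolz condition becomes
        \<open>|z - \<zeta>| \<le> 2 * |M| * \<rho>\<close>.\<close>
      define \<rho> where "\<rho> = (1 - cmod z) / 2"
      have zb: "z \<in> ball 0 1" and zM: "cmod (z - \<zeta>) < M * (1 - cmod z)"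
        using z by (auto simp: stolz_region_def)
      have \<rho>: "0 < \<rho>" using zb by (simp add: \<rho>_def)
      have "1 - cmod z \<le> cmod (z - \<zeta>)"
        using norm_triangle_ineq2[of \<zeta> z] \<zeta> by (simp add: norm_minus_commute)
      have sub: "cball z \<rho> \<subseteq> ball 0 1"
      proof
        fix w assume "w \<in> cball z \<rho>"
        then have "cmod w \<le> cmod z + \<rho>" using norm_triangle_sub[of w z] by (simp add: dist_norm norm_minus_commute)
        then show "w \<in> ball 0 1" using zb by (simp add: \<rho>_def field_simps)
      qed
      have bound: "cmod (K w) \<le> 2 * \<epsilon> * ((2 * \<bar>M\<bar> + 1) * \<rho>)" if "cmod (z - w) = \<rho>" for w
      proof -
        have wb: "w \<in> ball 0 1" using sub that by (auto simp: dist_norm)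
        have wd: "cmod (w - \<zeta>) \<le> \<rho> + cmod (z - \<zeta>)"
          using norm_triangle_ineq[of "w - z" "z - \<zeta>"] that by (simp add: norm_minus_commute)
        moreover have "\<rho> \<le> cmod (z - \<zeta>) / 2"
          using \<open>1 - cmod z \<le> cmod (z - \<zeta>)\<close> by (simp add: \<rho>_def)
        ultimately have "cmod (w - \<zeta>) < d" using z(2) d(1) by (simp add: dist_norm)
        from d(2)[OF wb this] have "cmod (K w) \<le> 2 * \<epsilon> * cmod (w - \<zeta>)" .
        also have "cmod (w - \<zeta>) \<le> (2 * \<bar>M\<bar> + 1) * \<rho>"
        proof -
          have "M * (1 - cmod z) \<le> \<bar>M\<bar> * (1 - cmod z)" using zb by (intro mult_right_mono) auto
          then have "cmod (z - \<zeta>) \<le> 2 * \<bar>M\<bar> * \<rho>" using zM by (simp add: \<rho>_def)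
          then show ?thesis using wd by (simp add: algebra_simps)
        qed
        finally show ?thesis using \<epsilon> by simp
      qed
      have "cmod ((deriv ^^ 1) K z) \<le> fact 1 * (2 * \<epsilon> * ((2 * \<bar>M\<bar> + 1) * \<rho>)) / \<rho> ^ 1"
        using sub \<rho> bound
        by (intro Cauchy_inequality holomorphic_on_subset[OF holK] continuous_on_subset[OF contK]) 
           (auto simp: subset_iff)
      moreover have "deriv K z = f z - c" using dK[OF zb] by (rule DERIV_imp_deriv)
      ultimately have "cmod (f z - c) \<le> 2 * \<epsilon> * (2 * \<bar>M\<bar> + 1)" using \<rho> by simp
      also have "\<dots> < 2 * \<epsilon> * (2 * \<bar>M\<bar> + 2)" using \<epsilon> by simp
      also have "\<dots> = e" using e by (simp add: \<epsilon>_def field_simps)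
      finally show ?thesis by (simp add: dist_norm)
    qed
    then show "\<forall>\<^sub>F z in at \<zeta> within stolz_region M \<zeta>. dist (f z) c < e"
      unfolding eventually_at using d(1) by (intro exI[of _ "d / 2"]) auto
  qed
  then show ?thesis by (simp add: c_def \<zeta>_def)
qed

text \<open>The limit is \<open>D / (\<i> * cis t)\<close>, where \<open>D\<close> is the derivative
  along the circle of the extended primitive. It does not involve \<open>M\<close>, so one
  \<open>c\<close> serves all Stolz regions. The two end points of the parameter interval join the
  null set because differentiability was studied only in its interior.\<close>

theorem Fatou_nontangential_limits:
  fixes f :: "complex \<Rightarrow> complex"
  assumes f: "f holomorphic_on ball 0 1" and bd: "bounded (f ` ball 0 1)"
  shows "AE t in lebesgue. t \<in> {0..2*pi} \<longrightarrow>
    (\<exists>c. \<forall>M. (f \<longlongrightarrow> c) (at (cis t) within stolz_region M (cis t)))"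
proof -
  obtain C where "\<forall>x\<in>f ` ball 0 1. cmod x \<le> C"
    using bd unfolding bounded_iff by blast
  then have C: "\<And>z. z \<in> ball 0 1 \<Longrightarrow> cmod (f z) \<le> C" by blast
  obtain h0 where h0: "\<And>z. z \<in> ball 0 1 \<Longrightarrow> (h0 has_field_derivative f z) (at z within ball 0 1)"
    by (rule holomorphic_convex_primitive'[OF convex_ball open_ball f]) (rule that)
  have L0: "C-lipschitz_on (ball 0 1) h0"
  proof (rule lipschitz_onI)
    show "0 \<le> C" by (rule order_trans[OF norm_ge_zero C[of 0]]) simp
    show "dist (h0 x) (h0 y) \<le> C * dist x y" if "x \<in> ball 0 1" "y \<in> ball 0 1" for x y
      unfolding dist_norm by (rule field_differentiable_bound[OF convex_ball h0 C that])
  qed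
  obtain h where h: "C-lipschitz_on (closure (ball 0 1)) h" "\<And>z. z \<in> ball 0 1 \<Longrightarrow> h z = h0 z"
    using lipschitz_extend_closure[OF L0] by blast
  have lh: "C-lipschitz_on (cball 0 1) h" using h(1) unfolding closure_ball[OF zero_less_one] .
  have dh: "(h has_field_derivative f z) (at z)" if "z \<in> ball 0 1" for z
  proof -
    have "(h0 has_field_derivative f z) (at z)" using h0[OF that] unfolding at_within_open[OF that open_ball] .
    then show ?thesis by (rule has_field_derivative_transform_within_open[OF _ open_ball that]) (simp add: h(2))
  qed
  let ?N = "{t \<in> {0<..<2*pi}. \<nexists>D. ((\<lambda>t. h (cis t)) has_vector_derivative D) (at t)}"
  have "negligible ?N"
    by (rule primitive_differentiable_ae_circle[OF f C lipschitz_on_continuous_on[OF lh] dh])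
  then have "negligible (insert 0 (insert (2*pi) ?N))" by simp
  then have "insert 0 (insert (2*pi) ?N) \<in> null_sets lebesgue" by (simp only: negligible_iff_null_sets)
  then show ?thesis
  proof (rule AE_I')
    show "{t \<in> space lebesgue. \<not> (t \<in> {0..2*pi} \<longrightarrow> (\<exists>c. \<forall>M. (f \<longlongrightarrow> c) (at (cis t) within stolz_region M (cis t))))}
      \<subseteq> insert 0 (insert (2*pi) ?N)"
    proof
      fix t assume t: "t \<in> {t \<in> space lebesgue. \<not> (t \<in> {0..2*pi} \<longrightarrow> (\<exists>c. \<forall>M. (f \<longlongrightarrow> c) (at (cis t) within stolz_region M (cis t))))}"
      then have "\<nexists>D. ((\<lambda>t. h (cis t)) has_vector_derivative D) (at t)"
        using nontangential_limit_of_derivative[OF lh dh] by blast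
      with t show "t \<in> insert 0 (insert (2*pi) ?N)" by auto
    qed
  qed
qed

section \<open>Boundary values as limits along radii\<close>

lemma stolz_region_nontrivial:
  assumes "cmod \<zeta> = 1" "1 < M" "0 < s" "s < 1"
  shows "of_real s * \<zeta> \<in> stolz_region M \<zeta>"
proof -
  have "of_real s * \<zeta> - \<zeta> = of_real (s - 1) * \<zeta>" by (simp add: algebra_simps)
  then have "cmod (of_real s * \<zeta> - \<zeta>) = \<bar>s - 1\<bar> * cmod \<zeta>" by (simp only: norm_mult norm_of_real)
  then show ?thesis using assms by (simp add: stolz_region_def norm_mult)
qed

lemma nontangential_imp_radial:
  assumes \<zeta>: "cmod \<zeta> = 1" and M: "1 < M" and lim: "(g \<longlongrightarrow> L) (at \<zeta> within stolz_region M \<zeta>)"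
    and s: "s \<longlonglongrightarrow> 1" "\<And>n. 0 < s n" "\<And>n. s n < 1"
  shows "(\<lambda>n. g (of_real (s n) * \<zeta>)) \<longlonglongrightarrow> L"
proof -
  have "(\<lambda>n. of_real (s n) * \<zeta>) \<longlonglongrightarrow> of_real 1 * \<zeta>"
    by (intro tendsto_intros s)
  moreover have "of_real (s n) * \<zeta> \<noteq> \<zeta>" for n
  proof -
    have "cmod (of_real (s n) * \<zeta>) < 1" using s(2,3)[of n] \<zeta> by (simp add: norm_mult)
    then show ?thesis using \<zeta> by auto
  qed
  ultimately have "filterlim (\<lambda>n. of_real (s n) * \<zeta>) (at \<zeta> within stolz_region M \<zeta>) sequentially"
    using stolz_region_nontrivial[OF \<zeta> M s(2,3)] by (simp add: filterlim_at)
  then show ?thesis by (rule filterlim_compose[OF lim])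
qed

text \<open>Uniqueness behind the definite description: radial points lie in every Stolz region with
  \<open>M > 1\<close>, so two candidate limits are limits of the same sequence.\<close>

lemma boundary_value_eqI:
  assumes "cmod \<zeta> = 1" "\<And>M. 1 < M \<Longrightarrow> (g \<longlongrightarrow> L) (at \<zeta> within stolz_region M \<zeta>)"
  shows "boundary_value g \<zeta> = L"
  unfolding boundary_value_def
proof (rule the_equality)
  show "\<forall>M>1. (g \<longlongrightarrow> L) (at \<zeta> within stolz_region M \<zeta>)" using assms by blast
  fix L' assume L': "\<forall>M>1. (g \<longlongrightarrow> L') (at \<zeta> within stolz_region M \<zeta>)"
  define s :: "nat \<Rightarrow> real" where "s n = 1 - 1 / (real n + 2)" for n
  have s: "s \<longlonglongrightarrow> 1" "\<And>n. 0 < s n" "\<And>n. s n < 1"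
    unfolding s_def by real_asymp (auto simp: field_simps)
  have "(\<lambda>n. g (of_real (s n) * \<zeta>)) \<longlonglongrightarrow> L'"
    using L' by (intro nontangential_imp_radial[OF assms(1) _ _ s, of 2]) auto
  moreover have "(\<lambda>n. g (of_real (s n) * \<zeta>)) \<longlonglongrightarrow> L"
    using assms(2) by (intro nontangential_imp_radial[OF assms(1) _ _ s, of 2]) auto
  ultimately show "L' = L" by (rule LIMSEQ_unique)
qed

lemma radial_limit_boundary_value:
  assumes f: "f holomorphic_on ball 0 1" "bounded (f ` ball 0 1)"
    and s: "s \<longlonglongrightarrow> 1" "\<And>n. 0 < s n" "\<And>n. s n < 1"
  shows "AE t in lebesgue. t \<in> {0..2*pi} \<longrightarrow> (\<lambda>n. f (of_real (s n) * cis t)) \<longlonglongrightarrow> boundary_value f (cis t)"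
  using Fatou_nontangential_limits[OF f]
proof eventually_elim
  case (elim t)
  show ?case
  proof
    assume "t \<in> {0..2*pi}"
    with elim obtain c where c: "\<And>M. (f \<longlongrightarrow> c) (at (cis t) within stolz_region M (cis t))" by blast
    have "boundary_value f (cis t) = c" by (rule boundary_value_eqI) (auto intro: c)
    then show "(\<lambda>n. f (of_real (s n) * cis t)) \<longlonglongrightarrow> boundary_value f (cis t)"
      using nontangential_imp_radial[OF _ _ c s, of 2] by simp
  qed
qed

section \<open>Poisson integrals and the weak topology\<close>

text \<open>A measurable stand-in for \<open>boundary_value\<close>: a limit along one fixed
  sequence of radii is visibly Borel in \<open>t\<close>, and for bounded holomorphic
  \<open>f\<close> the two agree almost everywhere. The shift by 2 keeps every radius strictly
  between 0 and 1.\<close>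

definition radial_limit :: "(complex \<Rightarrow> complex) \<Rightarrow> real \<Rightarrow> complex" where
  "radial_limit f t = lim (\<lambda>n. f (of_real (1 - 1 / (real n + 2)) * cis t))"

lemma radial_sequence:
  "(\<lambda>n. 1 - 1 / (real n + 2)) \<longlonglongrightarrow> 1" "0 < 1 - 1 / (real n + 2)" "1 - 1 / (real n + 2) < 1"
  by real_asymp (auto simp: field_simps)

lemma continuous_on_circle:
  assumes "f holomorphic_on ball 0 1" "0 < s" "s < 1"
  shows "continuous_on S (\<lambda>t. f (of_real s * cis t))"
  by (intro continuous_on_compose2[OF holomorphic_on_imp_continuous_on[OF assms(1)]] continuous_intros)
     (use assms in \<open>auto simp: norm_mult\<close>)

lemma borel_measurable_radial_limit:
  assumes "f holomorphic_on ball 0 1"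
  shows "radial_limit f \<in> borel_measurable borel"
  unfolding radial_limit_def[abs_def]
  by (intro borel_measurable_lim_metric borel_measurable_continuous_onI continuous_on_circle[OF assms] radial_sequence)

lemma boundary_value_radial_limit_ae:
  assumes f: "f holomorphic_on ball 0 1" and C: "\<forall>z\<in>ball 0 1. cmod (f z) \<le> C"
  shows "AE t in lborel. t \<in> {0..2*pi} \<longrightarrow> boundary_value f (cis t) = radial_limit f t \<and>
     (\<lambda>n. f (of_real (1 - 1 / (real n + 2)) * cis t)) \<longlonglongrightarrow> radial_limit f t \<and> cmod (radial_limit f t) \<le> C"
proof -
  have bd: "bounded (f ` ball 0 1)" unfolding bounded_iff using C by blast
  have "AE t in lebesgue. t \<in> {0..2*pi} \<longrightarrow> (\<lambda>n. f (of_real (1 - 1 / (real n + 2)) * cis t)) \<longlonglongrightarrow> boundary_value f (cis t)"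
    by (rule radial_limit_boundary_value[OF f bd radial_sequence])
  then have "AE t in lborel. t \<in> {0..2*pi} \<longrightarrow> (\<lambda>n. f (of_real (1 - 1 / (real n + 2)) * cis t)) \<longlonglongrightarrow> boundary_value f (cis t)"
    by (simp only: AE_completion_iff)
  then show ?thesis
  proof eventually_elim
    case (elim t)
    show ?case
    proof
      assume "t \<in> {0..2*pi}"
      with elim have lim: "(\<lambda>n. f (of_real (1 - 1 / (real n + 2)) * cis t)) \<longlonglongrightarrow> boundary_value f (cis t)" by blast
      then have eq: "radial_limit f t = boundary_value f (cis t)"
        unfolding radial_limit_def by (rule limI)
      have "cmod (boundary_value f (cis t)) \<le> C"
      proof (rule LIMSEQ_le_const2[OF tendsto_norm[OF lim]], intro exI allI impI)
        fix n :: nat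
        show "cmod (f (of_real (1 - 1 / (real n + 2)) * cis t)) \<le> C"
          by (rule bspec[OF C]) (use radial_sequence(2,3)[of n] in \<open>auto simp: norm_mult simp del: of_real_diff of_real_divide\<close>)
      qed
      with lim eq show "boundary_value f (cis t) = radial_limit f t \<and>
         (\<lambda>n. f (of_real (1 - 1 / (real n + 2)) * cis t)) \<longlonglongrightarrow> radial_limit f t \<and> cmod (radial_limit f t) \<le> C"
        by simp
    qed
  qed
qed

text \<open>The factor \<open>1 / (2 * pi)\<close> is included, so that the integral in the angle
  over \<open>{0..2*pi}\<close> is 1.\<close>

definition poisson_kernel :: "complex \<Rightarrow> complex \<Rightarrow> real" where
  "poisson_kernel z \<zeta> = (1 - (cmod z)\<^sup>2) / (2 * pi * (cmod (\<zeta> - z))\<^sup>2)"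

lemma poisson_kernel_nonneg: "z \<in> ball 0 1 \<Longrightarrow> 0 \<le> poisson_kernel z \<zeta>"
  by (auto simp: poisson_kernel_def power_le_one)

lemma continuous_poisson_kernel:
  assumes "z \<in> ball 0 1"
  shows "continuous_on S (\<lambda>t. poisson_kernel z (cis t))"
proof -
  have "cis t \<noteq> z" for t using assms by auto
  then show ?thesis unfolding poisson_kernel_def by (intro continuous_intros) auto
qed

text \<open>Cauchy's formula at \<open>z\<close> for \<open>f (s * u)\<close> times
  \<open>(1 - |z|\<^sup>2) / (1 - cnj z * u)\<close>, a factor equal to 1 at \<open>u = z\<close>.
  On the unit circle \<open>u * cnj (u - z) = 1 - cnj z * u\<close>, which turns the integrand into
  the Poisson kernel.\<close>

lemma poisson_integral_dilated:
  assumes f: "f holomorphic_on ball 0 1" and z: "z \<in> ball 0 1" and s: "0 < s" "s < 1"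
  shows "((\<lambda>t. poisson_kernel z (cis t) *\<^sub>R f (of_real s * cis t)) has_integral f (of_real s * z)) {0..2*pi}"
proof -
  define g where "g u = f (of_real s * u) * of_real (1 - (cmod z)\<^sup>2) / (1 - cnj z * u)" for u
  have ne: "1 - cnj z * u \<noteq> 0" if "u \<in> cball 0 1" for u
  proof -
    have "cmod (cnj z * u) \<le> cmod z * 1" unfolding norm_mult using that by (intro mult_mono) auto
    then have "cmod (cnj z * u) < 1" using z by simp
    then show ?thesis by auto
  qed
  have su: "of_real s * u \<in> ball 0 1" if "u \<in> cball 0 1" for u :: complex
  proof -
    have "s * cmod u \<le> s * 1" using that s by (intro mult_left_mono) auto
    then have "s * cmod u < 1" using s by linarith
    then show ?thesis using s by (simp add: norm_mult)
  qed
  have cg: "continuous_on (cball 0 1) g"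
    unfolding g_def
    by (intro continuous_intros continuous_on_compose2[OF holomorphic_on_imp_continuous_on[OF f]]) (use ne su in auto)
  have "(f \<circ> (\<lambda>u. of_real s * u)) holomorphic_on ball 0 1"
    by (rule holomorphic_on_compose_gen[OF _ f]) (use su in \<open>auto intro!: holomorphic_intros\<close>)
  then have "(\<lambda>u. f (of_real s * u)) holomorphic_on ball 0 1" by (simp only: o_def)
  then have hg: "g holomorphic_on ball 0 1"
    unfolding g_def by (intro holomorphic_intros) (use ne in auto)
  have zz: "1 - cnj z * z = of_real (1 - (cmod z)\<^sup>2)"
    by (simp add: complex_norm_square mult.commute del: of_real_power)
  have gz: "g z = f (of_real s * z)"
    using ne[of z] z unfolding g_def zz by simp
  have "((\<lambda>u. g u / (u - z)) has_contour_integral 2 * of_real pi * \<i> * g z) (circlepath 0 1)"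
    by (rule Cauchy_integral_circlepath[OF cg hg]) (use z in simp)
  then have "((\<lambda>t. g (0 + of_real 1 * cis t) / (0 + of_real 1 * cis t - z) * of_real 1 * \<i> * cis t) has_integral
      2 * of_real pi * \<i> * g z) {0..2*pi}"
    unfolding circlepath_def by (subst (asm) has_contour_integral_part_circlepath_iff) auto
  from has_integral_mult_right[OF this, of "1 / (2 * of_real pi * \<i>)"]
  have "((\<lambda>t. 1 / (2 * of_real pi * \<i>) * (g (cis t) / (cis t - z) * \<i> * cis t)) has_integral f (of_real s * z)) {0..2*pi}"
    by (simp add: gz)
  moreover have "1 / (2 * of_real pi * \<i>) * (g (cis t) / (cis t - z) * \<i> * cis t) = poisson_kernel z (cis t) *\<^sub>R f (of_real s * cis t)" for t
  proof -
    have cz: "cis t \<noteq> z" using z by auto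
    have nz: "1 - cnj z * cis t \<noteq> 0" using ne[of "cis t"] by simp
    have "cis t * cnj (cis t) = 1" by (simp add: cis_cnj cis_mult)
    then have e1: "cis t * cnj (cis t - z) = 1 - cnj z * cis t" by (simp add: algebra_simps)
    have e2: "complex_of_real ((cmod (cis t - z))\<^sup>2) = (cis t - z) * cnj (cis t - z)" by (rule complex_norm_square)
    have "cnj (cis t - z) \<noteq> 0" using cz by simp
    have "poisson_kernel z (cis t) *\<^sub>R f (of_real s * cis t)
       = of_real (1 - (cmod z)\<^sup>2) * f (of_real s * cis t) / (2 * of_real pi * ((cis t - z) * cnj (cis t - z)))"
      unfolding poisson_kernel_def scaleR_conv_of_real of_real_divide of_real_mult e2 by simp
    also have "\<dots> = of_real (1 - (cmod z)\<^sup>2) * f (of_real s * cis t) * cis t / (2 * of_real pi * ((cis t - z) * (cis t * cnj (cis t - z))))"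
      by simp
    also have "\<dots> = g (cis t) / (cis t - z) * cis t / (2 * of_real pi)"
      unfolding e1 g_def by (simp add: mult_ac)
    also have "\<dots> = 1 / (2 * of_real pi * \<i>) * (g (cis t) / (cis t - z) * \<i> * cis t)"
      by simp
    finally show ?thesis by simp
  qed
  ultimately show ?thesis by simp
qed

text \<open>Dominated convergence in the dilated formula, with majorant \<open>C\<close> times the
  kernel. The boundary function is any Borel member \<open>b\<close> of its almost everywhere class,
  so that a bounded one can be chosen later.\<close>

lemma poisson_integral:
  assumes f: "f holomorphic_on ball 0 1" and C: "\<forall>z\<in>ball 0 1. cmod (f z) \<le> C" and z: "z \<in> ball 0 1"
    and b: "b \<in> borel_measurable borel" and ae: "AE t in lborel. t \<in> {0..2*pi} \<longrightarrow> b t = radial_limit f t"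
  shows "(\<integral>t. (indicator {0..2*pi} t * poisson_kernel z (cis t)) *\<^sub>R b t \<partial>lborel) = f z"
proof -
  let ?s = "\<lambda>n::nat. 1 - 1 / (real n + 2)"
  let ?u = "\<lambda>n t. indicator {0..2*pi} t *\<^sub>R (poisson_kernel z (cis t) *\<^sub>R f (of_real (?s n) * cis t))"
  let ?w = "\<lambda>t. (indicator {0..2*pi} t * poisson_kernel z (cis t)) *\<^sub>R b t"
  have pm: "(\<lambda>t. poisson_kernel z (cis t)) \<in> borel_measurable borel"
    by (intro borel_measurable_continuous_onI continuous_poisson_kernel z)
  have int: "integrable lborel (?u n)" "integral\<^sup>L lborel (?u n) = f (of_real (?s n) * z)" for n
  proof -
    have c: "continuous_on {0..2*pi} (\<lambda>t. poisson_kernel z (cis t) *\<^sub>R f (of_real (?s n) * cis t))"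
      by (intro continuous_intros continuous_poisson_kernel z continuous_on_circle[OF f] radial_sequence)
    have i: "set_integrable lborel {0..2*pi} (\<lambda>t. poisson_kernel z (cis t) *\<^sub>R f (of_real (?s n) * cis t))"
      by (rule borel_integrable_atLeastAtMost'[OF c])
    then show "integrable lborel (?u n)" by (simp only: set_integrable_def)
    have "integral\<^sup>L lborel (?u n) = integral {0..2*pi} (\<lambda>t. poisson_kernel z (cis t) *\<^sub>R f (of_real (?s n) * cis t))"
      using set_borel_integral_eq_integral(2)[OF i] by (simp only: set_lebesgue_integral_def)
    then show "integral\<^sup>L lborel (?u n) = f (of_real (?s n) * z)"
      using integral_unique[OF poisson_integral_dilated[OF f z radial_sequence(2,3)[of n]]] by simp
  qed
  have "(\<lambda>n. integral\<^sup>L lborel (?u n)) \<longlonglongrightarrow> integral\<^sup>L lborel ?w"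
  proof (rule integral_dominated_convergence)
    show "?w \<in> borel_measurable lborel" using pm b by measurable
    show "?u n \<in> borel_measurable lborel" for n using int(1) by (rule borel_measurable_integrable)
    have "set_integrable lborel {0..2*pi} (\<lambda>t. C * poisson_kernel z (cis t))"
      by (intro borel_integrable_atLeastAtMost' continuous_intros continuous_poisson_kernel z)
    then show "integrable lborel (\<lambda>t. indicator {0..2*pi} t *\<^sub>R (C * poisson_kernel z (cis t)))"
      by (simp only: set_integrable_def)
    show "AE t in lborel. (\<lambda>n. ?u n t) \<longlonglongrightarrow> ?w t"
      using boundary_value_radial_limit_ae[OF f C] ae
    proof eventually_elim
      case (elim t)
      show ?case
      proof (cases "t \<in> {0..2*pi}")
        case True
        then have lim: "(\<lambda>n. f (of_real (?s n) * cis t)) \<longlonglongrightarrow> b t" using elim by simp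
        have "(\<lambda>n. poisson_kernel z (cis t) *\<^sub>R f (of_real (?s n) * cis t)) \<longlonglongrightarrow> poisson_kernel z (cis t) *\<^sub>R b t"
          by (rule tendsto_scaleR[OF tendsto_const lim])
        then show ?thesis using True by simp
      qed simp
    qed
    show "AE t in lborel. norm (?u n t) \<le> indicator {0..2*pi} t *\<^sub>R (C * poisson_kernel z (cis t))" for n
    proof (rule AE_I2)
      fix t
      have "cmod (f (of_real (?s n) * cis t)) \<le> C"
        by (rule bspec[OF C]) (use radial_sequence(2,3)[of n] in \<open>auto simp: norm_mult simp del: of_real_diff of_real_divide\<close>)
      then have "poisson_kernel z (cis t) * cmod (f (of_real (?s n) * cis t)) \<le> poisson_kernel z (cis t) * C"
        by (rule mult_left_mono) (rule poisson_kernel_nonneg[OF z])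
      then show "norm (?u n t) \<le> indicator {0..2*pi} t *\<^sub>R (C * poisson_kernel z (cis t))"
        using poisson_kernel_nonneg[OF z] by (auto simp: indicator_def mult.commute simp del: of_real_diff of_real_divide)
    qed
  qed
  moreover have "(\<lambda>n. f (of_real (?s n) * z)) \<longlonglongrightarrow> f z"
  proof -
    have "(\<lambda>n. of_real (?s n) * z) \<longlonglongrightarrow> of_real 1 * z" by (intro tendsto_intros radial_sequence)
    then have "(\<lambda>n. of_real (?s n) * z) \<longlonglongrightarrow> z" by simp
    moreover have "isCont f z" using f z holomorphic_on_imp_continuous_on continuous_on_eq_continuous_at open_ball by blast
    ultimately show ?thesis using isCont_tendsto_compose by blast
  qed
  ultimately show ?thesis unfolding int(2) by (rule LIMSEQ_unique)
qed

lemma poisson_kernel_integral_1: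
  assumes z: "z \<in> ball 0 1"
  shows "integrable lborel (\<lambda>t. indicator {0..2*pi} t * poisson_kernel z (cis t))"
    "(\<integral>t. indicator {0..2*pi} t * poisson_kernel z (cis t) \<partial>lborel) = 1"
proof -
  have "set_integrable lborel {0..2*pi} (\<lambda>t. poisson_kernel z (cis t))"
    by (intro borel_integrable_atLeastAtMost' continuous_poisson_kernel z)
  then show i: "integrable lborel (\<lambda>t. indicator {0..2*pi} t * poisson_kernel z (cis t))"
    by (simp add: set_integrable_def)
  have "(\<integral>t. (indicator {0..2*pi} t * poisson_kernel z (cis t)) *\<^sub>R (1::complex) \<partial>lborel) = 1"
    by (rule poisson_integral[where f = "\<lambda>_. 1" and C = 1]) (use z in \<open>auto simp: radial_limit_def\<close>)
  then have "complex_of_real (\<integral>t. indicator {0..2*pi} t * poisson_kernel z (cis t) \<partial>lborel) = 1"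
    by (simp add: scaleR_conv_of_real flip: integral_complex_of_real of_real_mult)
  then show "(\<integral>t. indicator {0..2*pi} t * poisson_kernel z (cis t) \<partial>lborel) = 1"
    by (simp only: of_real_eq_1_iff)
qed

text \<open>Setting \<open>radial_limit\<close> to 0 where it exceeds \<open>C\<close> changes it
  only on a null set of the parameter interval. The result is bounded at every \<open>t\<close>,
  which makes joint integrability over a product and domination immediate.\<close>

lemma boundary_value_borel_representative:
  assumes f: "f holomorphic_on ball 0 1" and C: "\<forall>z\<in>ball 0 1. cmod (f z) \<le> C"
  obtains b where "b \<in> borel_measurable borel" "\<And>t. cmod (b t) \<le> C"
    "AE t in lborel. t \<in> {0..2*pi} \<longrightarrow> b t = radial_limit f t"
    "AE t in lborel. t \<in> {0..2*pi} \<longrightarrow> boundary_value f (cis t) = b t"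
proof -
  define b where "b t = (if cmod (radial_limit f t) \<le> C then radial_limit f t else 0)" for t
  have "0 \<le> cmod (f 0)" by simp
  also have "\<dots> \<le> C" using C by simp
  finally have C0: "0 \<le> C" .
  note [measurable] = borel_measurable_radial_limit[OF f]
  show thesis
  proof (rule that)
    show "b \<in> borel_measurable borel" unfolding b_def[abs_def] by measurable
    show "cmod (b t) \<le> C" for t using C0 by (simp add: b_def)
    show "AE t in lborel. t \<in> {0..2*pi} \<longrightarrow> b t = radial_limit f t"
      using boundary_value_radial_limit_ae[OF f C] by eventually_elim (simp add: b_def)
    show "AE t in lborel. t \<in> {0..2*pi} \<longrightarrow> boundary_value f (cis t) = b t"
      using boundary_value_radial_limit_ae[OF f C] by eventually_elim (simp add: b_def)
  qed
qed

lemma Hinf_compose_biholomorphic: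
  assumes \<phi>: "biholomorphic_map \<phi> (ball 0 1) \<Omega>" and f: "f \<in> Hinf \<Omega>"
  shows "(f \<circ> \<phi>) holomorphic_on ball 0 1" "\<exists>C. \<forall>z\<in>ball 0 1. cmod ((f \<circ> \<phi>) z) \<le> C"
proof -
  have im: "\<phi> ` ball 0 1 = \<Omega>" and h: "\<phi> holomorphic_on ball 0 1"
    using \<phi> by (auto simp: biholomorphic_map_def bij_betw_def)
  have "f holomorphic_on \<Omega>" and "bounded (f ` \<Omega>)" using f by (auto simp: Hinf_def)
  then show "(f \<circ> \<phi>) holomorphic_on ball 0 1"
    by (intro holomorphic_on_compose_gen[OF h]) (use im in auto)
  obtain C where C: "\<forall>x\<in>f ` \<Omega>. cmod x \<le> C"
    using \<open>bounded (f ` \<Omega>)\<close> unfolding bounded_iff by blast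
  have "cmod ((f \<circ> \<phi>) z) \<le> C" if "z \<in> ball 0 1" for z
  proof -
    have "\<phi> z \<in> \<Omega>" using im that by blast
    then show ?thesis using C by simp
  qed
  then show "\<exists>C. \<forall>z\<in>ball 0 1. cmod ((f \<circ> \<phi>) z) \<le> C" by blast
qed

text \<open>The kernels are nonnegative with integral 1 and \<open>\<mu>\<close> is finite, so they
  are jointly integrable and Fubini's theorem applies; the inner integral over the circle is the
  Poisson formula for \<open>f \<circ> \<phi>\<close>.\<close>

lemma measure_integral_eq_boundary_functional:
  assumes \<phi>: "biholomorphic_map \<phi> (ball 0 1) \<Omega>" and S: "S \<subseteq> \<Omega>"
    and fin: "finite_measure \<mu>" and sets: "sets \<mu> = sets (restrict_space borel S)"
  obtains F where "circle_integrable F" "\<And>f. f \<in> Hinf \<Omega> \<Longrightarrow> boundary_functional \<phi> F f = (\<integral>z. f z \<partial>\<mu>)"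
proof -
  define q where "q = inv_into (ball 0 1) \<phi>"
  have bij: "bij_betw \<phi> (ball 0 1) \<Omega>" and hq: "q holomorphic_on \<Omega>"
    using \<phi> by (auto simp: biholomorphic_map_def q_def)
  have space: "space \<mu> = S" using sets_eq_imp_space_eq[OF sets] by (simp add: space_restrict_space)
  have qb: "q x \<in> ball 0 1" and \<phi>q: "\<phi> (q x) = x" if "x \<in> S" for x
  proof -
    have "x \<in> \<phi> ` ball 0 1" using that S bij by (auto simp: bij_betw_def)
    then show "q x \<in> ball 0 1" "\<phi> (q x) = x"
      unfolding q_def by (rule inv_into_into, rule f_inv_into_f)
  qed
  have "continuous_on S q" using holomorphic_on_imp_continuous_on[OF hq] S continuous_on_subset by blast
  then have qm [measurable]: "q \<in> borel_measurable \<mu>"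
    using borel_measurable_continuous_on_restrict[of S q] measurable_cong_sets[OF sets refl] by blast
  have cism [measurable]: "cis \<in> borel_measurable borel"
    by (intro borel_measurable_continuous_onI continuous_intros)
  interpret \<mu>: finite_measure \<mu> by fact
  interpret P: pair_sigma_finite \<mu> lborel ..
  define k where "k x t = indicator {0..2*pi} t * poisson_kernel (q x) (cis t)" for x t
  have km [measurable]: "case_prod k \<in> borel_measurable (\<mu> \<Otimes>\<^sub>M lborel)"
    unfolding k_def[abs_def] poisson_kernel_def by measurable
  have k0: "0 \<le> k x t" if "x \<in> S" for x t
    unfolding k_def using poisson_kernel_nonneg[OF qb[OF that]] by simp
  have ki: "integrable (\<mu> \<Otimes>\<^sub>M lborel) (case_prod k)"
  proof (rule P.Fubini_integrable[OF km])
    have n1: "(\<integral>y. norm (case_prod k (x, y)) \<partial>lborel) = 1" if "x \<in> space \<mu>" for x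
      using poisson_kernel_integral_1(2)[OF qb, of x] k0[of x] that by (simp add: space k_def)
    show "integrable \<mu> (\<lambda>x. \<integral>y. norm (case_prod k (x, y)) \<partial>lborel)"
      by (subst Bochner_Integration.integrable_cong[OF refl n1]) auto
    show "AE x in \<mu>. integrable lborel (\<lambda>y. case_prod k (x, y))"
      using poisson_kernel_integral_1(1)[OF qb] by (intro AE_I2) (simp add: space k_def)
  qed
  \<comment> \<open>\<open>F\<close> is a function on the circle, as
    \<open>circle_integrable\<close> demands; \<open>kk\<close> is its version in the angle, cut off
    outside \<open>{0..2*pi}\<close>, to which Fubini's theorem applies.\<close>
  define F where "F \<zeta> = complex_of_real (\<integral>x. poisson_kernel (q x) \<zeta> \<partial>\<mu>)" for \<zeta>
  define kk where "kk t = (\<integral>x. k x t \<partial>\<mu>)" for t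
  have Fk: "indicator {0..2*pi} t *\<^sub>R F (cis t) = complex_of_real (kk t)" for t
    by (simp add: F_def kk_def k_def scaleR_conv_of_real)
  have kki: "integrable lborel kk"
    unfolding kk_def[abs_def] by (rule P.integrable_snd[OF ki])
  then have [measurable]: "kk \<in> borel_measurable borel"
    using borel_measurable_integrable by fastforce
  have "integrable lborel (\<lambda>t. complex_of_real (kk t))" using kki by simp
  then have "integrable lebesgue (\<lambda>t. complex_of_real (kk t))"
    by (subst integrable_completion) auto
  then have ciF: "circle_integrable F"
    unfolding circle_integrable_def set_integrable_def Fk .
  moreover have "boundary_functional \<phi> F f = (\<integral>z. f z \<partial>\<mu>)" if f: "f \<in> Hinf \<Omega>" for f
  proof -
    note hg = Hinf_compose_biholomorphic[OF \<phi> f]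
    obtain C where C: "\<forall>z\<in>ball 0 1. cmod ((f \<circ> \<phi>) z) \<le> C" using hg(2) by blast
    obtain b where b [measurable]: "b \<in> borel_measurable borel" and bC: "\<And>t. cmod (b t) \<le> C"
      and br: "AE t in lborel. t \<in> {0..2*pi} \<longrightarrow> b t = radial_limit (f \<circ> \<phi>) t"
      and bv: "AE t in lborel. t \<in> {0..2*pi} \<longrightarrow> boundary_value (f \<circ> \<phi>) (cis t) = b t"
      by (rule boundary_value_borel_representative[OF hg(1) C]) (rule that)
    define K where "K x t = complex_of_real (k x t) * b t" for x t
    have Ki: "integrable (\<mu> \<Otimes>\<^sub>M lborel) (case_prod K)"
    proof (rule Bochner_Integration.integrable_bound)
      show "integrable (\<mu> \<Otimes>\<^sub>M lborel) (\<lambda>p. C * case_prod k p)" using ki by (rule integrable_mult_right)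
      show "case_prod K \<in> borel_measurable (\<mu> \<Otimes>\<^sub>M lborel)"
        unfolding K_def[abs_def] by measurable
      have "cmod (K x t) \<le> \<bar>C * k x t\<bar>" for x t
      proof -
        have "0 \<le> C" using bC[of 0] norm_ge_zero order_trans by blast
        then show ?thesis using mult_right_mono[OF bC[of t], of "\<bar>k x t\<bar>"]
          by (simp add: K_def norm_mult abs_mult mult.commute)
      qed
      then show "AE p in \<mu> \<Otimes>\<^sub>M lborel. norm (case_prod K p) \<le> norm (C * case_prod k p)"
        by (intro AE_I2) (simp add: case_prod_beta)
    qed
    have inner: "(\<integral>t. K x t \<partial>lborel) = f x" if x: "x \<in> space \<mu>" for x
    proof -
      have xS: "x \<in> S" using x space by simp
      have "(\<integral>t. (indicator {0..2*pi} t * poisson_kernel (q x) (cis t)) *\<^sub>R b t \<partial>lborel) = (f \<circ> \<phi>) (q x)"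
        by (rule poisson_integral[OF hg(1) C qb[OF xS] b br])
      then show ?thesis using \<phi>q[OF xS] by (simp add: K_def k_def scaleR_conv_of_real)
    qed
    have meas: "(\<lambda>t. complex_of_real (kk t) * b t) \<in> borel_measurable lborel" by measurable
    \<comment> \<open>The integrand of \<open>boundary_functional\<close> need not be Borel. Almost
      everywhere equality with a Borel function gives its measurability, Lebesgue measure being
      complete, and allows the return to \<open>lborel\<close>.\<close>
    have ae: "AE t in lebesgue. complex_of_real (kk t) * b t = indicator {0..2*pi} t *\<^sub>R (F (cis t) * boundary_value (f \<circ> \<phi>) (cis t))"
      unfolding AE_completion_iff using bv
    proof eventually_elim
      case (elim t)
      show ?case
      proof (cases "t \<in> {0..2*pi}")
        case True
        then show ?thesis using elim Fk[of t] by simp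
      next
        case False
        then show ?thesis using Fk[of t] by simp
      qed
    qed
    have "(\<integral>t. complex_of_real (kk t) * b t \<partial>lebesgue) = boundary_functional \<phi> F f"
      unfolding boundary_functional_def set_lebesgue_integral_def
    proof (rule integral_cong_AE[OF _ _ ae])
      show m: "(\<lambda>t. complex_of_real (kk t) * b t) \<in> borel_measurable lebesgue"
        using meas by (rule measurable_completion)
      show "(\<lambda>t. indicator {0..2*pi} t *\<^sub>R (F (cis t) * boundary_value (f \<circ> \<phi>) (cis t))) \<in> borel_measurable lebesgue"
        by (rule borel_measurable_AE[OF m ae])
    qed
    then have "boundary_functional \<phi> F f = (\<integral>t. complex_of_real (kk t) * b t \<partial>lborel)"
      using integral_completion[OF meas] by simp
    also have "\<dots> = (\<integral>t. (\<integral>x. K x t \<partial>\<mu>) \<partial>lborel)"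
      by (simp add: K_def kk_def)
    also have "\<dots> = (\<integral>x. (\<integral>t. K x t \<partial>lborel) \<partial>\<mu>)"
      by (rule P.Fubini_integral[OF Ki])
    also have "\<dots> = (\<integral>x. f x \<partial>\<mu>)"
      by (rule Bochner_Integration.integral_cong[OF refl inner])
    finally show ?thesis .
  qed
  ultimately show thesis by (rule that)
qed

section \<open>The weak topology and bounded convergence on the circle\<close>

lemma topspace_weak_topology: "topspace (weak_topology \<Omega> \<phi>) = Hinf \<Omega>"
proof -
  have "circle_integrable (\<lambda>_. 0)" by (simp add: circle_integrable_def set_integrable_def)
  then have "Hinf \<Omega> \<in> {{f \<in> Hinf \<Omega>. boundary_functional \<phi> F f \<in> U} |F U. circle_integrable F \<and> open U}"
    by (intro CollectI exI[of _ "\<lambda>_. 0"] exI[of _ UNIV]) auto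
  then show ?thesis unfolding weak_topology_def topology_generated_by_topspace by blast
qed

lemma continuous_map_boundary_functional:
  assumes F: "circle_integrable F" and eq: "\<And>f. f \<in> Hinf \<Omega> \<Longrightarrow> \<eta> f = boundary_functional \<phi> F f"
  shows "continuous_map (weak_topology \<Omega> \<phi>) euclidean \<eta>"
  unfolding continuous_map_def topspace_weak_topology
proof (intro conjI allI impI)
  show "\<eta> \<in> Hinf \<Omega> \<rightarrow> topspace euclidean" by simp
  fix U :: "complex set" assume "openin euclidean U"
  moreover have "{f \<in> Hinf \<Omega>. \<eta> f \<in> U} = {f \<in> Hinf \<Omega>. boundary_functional \<phi> F f \<in> U}"
    using eq by auto
  ultimately show "openin (weak_topology \<Omega> \<phi>) {f \<in> Hinf \<Omega>. \<eta> f \<in> U}"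
    unfolding weak_topology_def using F by (intro topology_generated_by_Basis) auto
qed

text \<open>Dominated convergence with majorant \<open>C * |G|\<close>. Both the measurability and
  the bound of each integrand come from the Borel representative of the boundary values.\<close>

lemma boundary_functional_convergence:
  assumes \<phi>: "biholomorphic_map \<phi> (ball 0 1) \<Omega>" and f: "f \<in> Hinf \<Omega>" and g: "\<And>n. g n \<in> Hinf \<Omega>"
    and C: "\<And>n z. z \<in> \<Omega> \<Longrightarrow> cmod (g n z) \<le> C" and G: "circle_integrable G"
    and lim: "AE t in lebesgue. t \<in> {0..2*pi} \<longrightarrow>
      (\<lambda>n. boundary_value (g n \<circ> \<phi>) (cis t)) \<longlonglongrightarrow> boundary_value (f \<circ> \<phi>) (cis t)"
  shows "(\<lambda>n. boundary_functional \<phi> G (g n)) \<longlonglongrightarrow> boundary_functional \<phi> G f"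
proof -
  let ?i = "\<lambda>h t. indicator {0..2*pi} t *\<^sub>R (G (cis t) * boundary_value (h \<circ> \<phi>) (cis t))"
  have Gi: "integrable lebesgue (\<lambda>t. indicator {0..2*pi} t *\<^sub>R G (cis t))"
    using G by (simp add: circle_integrable_def set_integrable_def)
  note Gm [measurable] = borel_measurable_integrable[OF Gi]
  have meas: "?i h \<in> borel_measurable lebesgue"
    and bound: "\<And>D. \<forall>z\<in>\<Omega>. cmod (h z) \<le> D \<Longrightarrow> AE t in lebesgue. norm (?i h t) \<le> D * norm (indicator {0..2*pi} t *\<^sub>R G (cis t))"
    if h: "h \<in> Hinf \<Omega>" for h
  proof -
    note hg = Hinf_compose_biholomorphic[OF \<phi> h]
    have *: "\<exists>b. b \<in> borel_measurable borel \<and> (\<forall>t. cmod (b t) \<le> D) \<and>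
       (AE t in lebesgue. indicator {0..2*pi} t *\<^sub>R G (cis t) * b t = ?i h t)"
      if D: "\<forall>z\<in>ball 0 1. cmod ((h \<circ> \<phi>) z) \<le> D" for D
    proof -
      obtain b where b: "b \<in> borel_measurable borel" "\<And>t. cmod (b t) \<le> D"
        "AE t in lborel. t \<in> {0..2*pi} \<longrightarrow> boundary_value (h \<circ> \<phi>) (cis t) = b t"
        by (rule boundary_value_borel_representative[OF hg(1) D]) (rule that)
      have "AE t in lebesgue. indicator {0..2*pi} t *\<^sub>R G (cis t) * b t = ?i h t"
        unfolding AE_completion_iff using b(3) by eventually_elim (auto simp: indicator_def)
      with b show ?thesis by blast
    qed
    obtain D where "\<forall>z\<in>ball 0 1. cmod ((h \<circ> \<phi>) z) \<le> D" using hg(2) by blast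
    then obtain b where b: "b \<in> borel_measurable borel"
       and ae: "AE t in lebesgue. indicator {0..2*pi} t *\<^sub>R G (cis t) * b t = ?i h t" using * by blast
    have "b \<in> borel_measurable lebesgue" using b by (intro measurable_completion) simp
    then have "(\<lambda>t. indicator {0..2*pi} t *\<^sub>R G (cis t) * b t) \<in> borel_measurable lebesgue"
      by (intro borel_measurable_times Gm)
    then show "?i h \<in> borel_measurable lebesgue" by (rule borel_measurable_AE[OF _ ae])
    fix D assume "\<forall>z\<in>\<Omega>. cmod (h z) \<le> D"
    moreover have "\<phi> ` ball 0 1 = \<Omega>" using \<phi> by (auto simp: biholomorphic_map_def bij_betw_def)
    ultimately have "\<forall>z\<in>ball 0 1. cmod ((h \<circ> \<phi>) z) \<le> D" unfolding o_def by blast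
    then obtain b where bD: "\<And>t. cmod (b t) \<le> D"
       and ae: "AE t in lebesgue. indicator {0..2*pi} t *\<^sub>R G (cis t) * b t = ?i h t" using * by blast
    show "AE t in lebesgue. norm (?i h t) \<le> D * norm (indicator {0..2*pi} t *\<^sub>R G (cis t))"
      using ae
    proof eventually_elim
      case (elim t)
      have "norm (indicator {0..2*pi} t *\<^sub>R G (cis t) * b t) \<le> norm (indicator {0..2*pi} t *\<^sub>R G (cis t)) * D"
        unfolding norm_mult by (intro mult_left_mono bD norm_ge_zero)
      then show ?case unfolding elim by (simp only: mult.commute)
    qed
  qed
  have "(\<lambda>n. integral\<^sup>L lebesgue (?i (g n))) \<longlonglongrightarrow> integral\<^sup>L lebesgue (?i f)"
  proof (rule integral_dominated_convergence)
    show "?i f \<in> borel_measurable lebesgue" "?i (g n) \<in> borel_measurable lebesgue" for n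
      by (rule meas[OF f], rule meas[OF g])
    show "integrable lebesgue (\<lambda>t. C * norm (indicator {0..2*pi} t *\<^sub>R G (cis t)))"
      by (intro integrable_mult_right integrable_norm Gi)
    show "AE t in lebesgue. norm (?i (g n) t) \<le> C * norm (indicator {0..2*pi} t *\<^sub>R G (cis t))" for n
      by (rule bound[OF g]) (use C in blast)
    show "AE t in lebesgue. (\<lambda>n. ?i (g n) t) \<longlonglongrightarrow> ?i f t"
      using lim
    proof eventually_elim
      case (elim t)
      show ?case
      proof (cases "t \<in> {0..2*pi}")
        case True
        with elim have "(\<lambda>n. boundary_value (g n \<circ> \<phi>) (cis t)) \<longlonglongrightarrow> boundary_value (f \<circ> \<phi>) (cis t)" by blast
        then show ?thesis by (intro tendsto_scaleR tendsto_mult tendsto_const)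
      qed simp
    qed
  qed
  then show ?thesis by (simp only: boundary_functional_def set_lebesgue_integral_def)
qed

text \<open>Convergence of a sequence in an initial topology can be tested on the subbasis, where it
  is convergence of the boundary functionals. Induction over \<open>generate_topology_on\<close>
  extends it to all open sets, and continuity carries it to the values of
  \<open>\<eta>\<close>.\<close>

lemma weakly_continuous_bounded_convergence:
  assumes \<phi>: "biholomorphic_map \<phi> (ball 0 1) \<Omega>" and f: "f \<in> Hinf \<Omega>" and g: "\<And>n. g n \<in> Hinf \<Omega>"
    and C: "\<And>n z. z \<in> \<Omega> \<Longrightarrow> cmod (g n z) \<le> C"
    and lim: "AE t in lebesgue. t \<in> {0..2*pi} \<longrightarrow>
      (\<lambda>n. boundary_value (g n \<circ> \<phi>) (cis t)) \<longlonglongrightarrow> boundary_value (f \<circ> \<phi>) (cis t)"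
    and \<eta>: "continuous_map (weak_topology \<Omega> \<phi>) euclidean \<eta>"
  shows "(\<lambda>n. \<eta> (g n)) \<longlonglongrightarrow> \<eta> f"
proof -
  let ?S = "{{f \<in> Hinf \<Omega>. boundary_functional \<phi> F f \<in> U} |F U. circle_integrable F \<and> open U}"
  have "f \<in> U \<longrightarrow> (\<forall>\<^sub>F n in sequentially. g n \<in> U)" if "generate_topology_on ?S U" for U
    using that
  proof (induction rule: generate_topology_on.induct)
    case (UN K)
    show ?case
    proof
      assume "f \<in> \<Union>K"
      then obtain k where "k \<in> K" "f \<in> k" by blast
      then have "\<forall>\<^sub>F n in sequentially. g n \<in> k" using UN.IH by blast
      then show "\<forall>\<^sub>F n in sequentially. g n \<in> \<Union>K" by eventually_elim (use \<open>k \<in> K\<close> in blast)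
    qed
  next
    case (Basis s)
    then obtain G U where G: "circle_integrable G" "open U" and s: "s = {f \<in> Hinf \<Omega>. boundary_functional \<phi> G f \<in> U}"
      by blast
    show ?case
    proof
      assume "f \<in> s"
      then have "\<forall>\<^sub>F n in sequentially. boundary_functional \<phi> G (g n) \<in> U"
        using s by (intro topological_tendstoD[OF boundary_functional_convergence[OF \<phi> f g C G(1) lim] G(2)]) auto
      then show "\<forall>\<^sub>F n in sequentially. g n \<in> s" by eventually_elim (use g s in blast)
    qed
  qed (auto simp: eventually_conj_iff)
  then have "limitin (weak_topology \<Omega> \<phi>) g f sequentially"
    unfolding limitin_def topspace_weak_topology
    using f by (auto simp: weak_topology_def openin_topology_generated_by_iff)
  from continuous_map_limit[OF \<eta> this] show ?thesis by (simp add: o_def)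
qed

section \<open>The Hausdorff moment problem\<close>

text \<open>The ratio is the product of \<open>(k - i) / (n - i)\<close> over \<open>i < j\<close>.
  All factors have modulus at most 1, so products differ by at most the sum of the differences of
  factors, each at most \<open>j / (n - j)\<close>.\<close>

lemma binomial_ratio_approx_power:
  assumes "k \<le> n" "2 * j < n"
  shows "\<bar>real (k choose j) / real (n choose j) - (real k / real n) ^ j\<bar> \<le> real j * (real j / (real n - real j))"
proof -
  have n: "0 < real n" "real j < real n" using assms by auto
  have bp: "real (a choose j) = (\<Prod>i<j. real a - real i) / fact j" for a
    by (simp add: binomial_gbinomial gbinomial_prod_rev atLeast0LessThan)
  have "real (k choose j) / real (n choose j) = (\<Prod>i<j. (real k - real i) / (real n - real i))"
    unfolding bp by (simp add: prod_dividef)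
  moreover have "(real k / real n) ^ j = (\<Prod>i<j. real k / real n)" by simp
  ultimately have "\<bar>real (k choose j) / real (n choose j) - (real k / real n) ^ j\<bar> =
     norm ((\<Prod>i<j. (real k - real i) / (real n - real i)) - (\<Prod>i<j. real k / real n))" by simp
  also have "\<dots> \<le> (\<Sum>i<j. norm ((real k - real i) / (real n - real i) - real k / real n))"
  proof (rule norm_prod_diff)
    fix i assume i: "i \<in> {..<j}"
    \<comment> \<open>For \<open>k < i\<close> the numerator is negative; \<open>2 * j < n\<close>
      keeps its modulus below the denominator.\<close>
    then have "\<bar>real k - real i\<bar> \<le> real n - real i" using assms by auto
    then show "norm ((real k - real i) / (real n - real i)) \<le> 1" using i assms by (simp add: abs_divide)
    show "norm (real k / real n) \<le> 1" using assms by simp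
  qed
  also have "\<dots> \<le> (\<Sum>i<j. real j / (real n - real j))"
  proof (rule sum_mono)
    fix i assume i: "i \<in> {..<j}"
    then have ni: "0 < real n - real i" using assms by auto
    have "(real k - real i) / (real n - real i) - real k / real n = - (real i / (real n - real i)) * ((real n - real k) / real n)"
      using ni n by (simp add: field_simps)
    then have "norm ((real k - real i) / (real n - real i) - real k / real n)
      = (real i / (real n - real i)) * ((real n - real k) / real n)"
      using ni n assms by (simp add: abs_mult)
    also have "\<dots> \<le> (real i / (real n - real i)) * 1"
      using ni n assms by (intro mult_left_mono) auto
    also have "\<dots> \<le> real j / (real n - real j)"
      using i n ni by (simp, intro frac_le) auto
    finally show "norm ((real k - real i) / (real n - real i) - real k / real n) \<le> real j / (real n - real j)" .
  qed
  also have "\<dots> = real j * (real j / (real n - real j))" by simp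
  finally show ?thesis .
qed

text \<open>The weights \<open>w n k\<close> are the values of a positive functional at the Bernstein polynomials
  \<open>(n choose k) x\<^sup>k (1 - x)\<^bsup>n-k\<^esup>\<close>; the moment condition is the expansion of \<open>x\<^sup>j\<close> in the
  Bernstein basis.\<close>

theorem Hausdorff_moment_problem:
  fixes m :: "nat \<Rightarrow> real" and w :: "nat \<Rightarrow> nat \<Rightarrow> real"
  assumes w: "\<And>n k. k \<le> n \<Longrightarrow> 0 \<le> w n k"
    and mom: "\<And>n j. j \<le> n \<Longrightarrow> (\<Sum>k\<le>n. w n k * (real (k choose j) / real (n choose j))) = m j"
  obtains \<nu> :: "real measure" where "finite_measure \<nu>" "sets \<nu> = sets borel" "AE x in \<nu>. x \<in> {0..1}"
    "\<And>j. (\<integral>x. x ^ j \<partial>\<nu>) = m j"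
proof -
  have m0: "(\<Sum>k\<le>n. w n k) = m 0" for n using mom[of 0 n] by simp
  have le1: "real k / real n \<le> 1" if "k \<le> n" for k n
    using that by (cases "n = 0") simp_all
  have "0 \<le> m 0" using m0[of 0] w[of 0 0] by simp
  \<comment> \<open>Binomial ratios are close to powers of \<open>k / n\<close> uniformly in
    \<open>k\<close>, and the total weight is always \<open>m 0\<close>. So the discrete measures
    with mass \<open>w n k\<close> at \<open>k / n\<close> have moments converging to the prescribed
    ones.\<close>
  have conv: "(\<lambda>n. \<Sum>k\<le>n. w n k * (real k / real n) ^ j) \<longlonglongrightarrow> m j" for j
  proof -
    have "(\<lambda>n. (\<Sum>k\<le>n. w n k * (real k / real n) ^ j) - m j) \<longlonglongrightarrow> 0"
    proof (rule Lim_null_comparison)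
      show "(\<lambda>n. m 0 * (real j * (real j / (real n - real j)))) \<longlonglongrightarrow> 0" by real_asymp
      show "\<forall>\<^sub>F n in sequentially. norm ((\<Sum>k\<le>n. w n k * (real k / real n) ^ j) - m j)
         \<le> m 0 * (real j * (real j / (real n - real j)))"
        using eventually_gt_at_top[of "2 * j"]
      proof eventually_elim
        case (elim n)
        have "(\<Sum>k\<le>n. w n k * (real k / real n) ^ j) - m j
           = (\<Sum>k\<le>n. w n k * ((real k / real n) ^ j - real (k choose j) / real (n choose j)))"
          using mom[of j n] elim by (simp add: right_diff_distrib sum_subtractf)
        then have "norm ((\<Sum>k\<le>n. w n k * (real k / real n) ^ j) - m j)
           \<le> (\<Sum>k\<le>n. norm (w n k * ((real k / real n) ^ j - real (k choose j) / real (n choose j))))"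
          by (simp only:) (rule norm_sum)
        also have "\<dots> \<le> (\<Sum>k\<le>n. w n k * (real j * (real j / (real n - real j))))"
        proof (rule sum_mono)
          fix k assume k: "k \<in> {..n}"
          then have a: "\<bar>(real k / real n) ^ j - real (k choose j) / real (n choose j)\<bar>
              \<le> real j * (real j / (real n - real j))"
            using binomial_ratio_approx_power[of k n j] elim by (simp add: abs_minus_commute)
          have b: "0 \<le> w n k" using w k by simp
          show "norm (w n k * ((real k / real n) ^ j - real (k choose j) / real (n choose j)))
             \<le> w n k * (real j * (real j / (real n - real j)))"
            unfolding real_norm_def abs_mult abs_of_nonneg[OF b] by (rule mult_left_mono[OF a b])
        qed
        also have "\<dots> = m 0 * (real j * (real j / (real n - real j)))"
          by (simp only: sum_distrib_right[symmetric] m0)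
        finally show ?case .
      qed
    qed
    then show ?thesis by (rule LIM_zero_cancel)
  qed
  show thesis
  proof (cases "m 0 = 0")
    case True
    \<comment> \<open>With total mass 0 no normalisation to probability measures is possible, but
      all weights and moments vanish.\<close>
    have "w n k = 0" if "k \<le> n" for n k
      using m0[of n] w True that sum_nonneg_eq_0_iff[of "{..n}" "w n"] by simp
    then have "m j = 0" for j using mom[of j j] by simp
    moreover have "finite_measure (null_measure (borel :: real measure))" by (rule finite_measureI) simp
    moreover have "AE x in null_measure (borel :: real measure). x \<in> {0..1}"
      by (rule AE_I'[of UNIV]) (auto simp: null_sets_def)
    ultimately show thesis by (intro that[of "null_measure borel"]) auto
  next
    case False
    then have pos: "0 < m 0" using \<open>0 \<le> m 0\<close> by simp
    define P where "P n = point_measure {..n} (\<lambda>k. ennreal (w n k / m 0))" for n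
    define N where "N n = distr (P n) borel (\<lambda>k. real k / real n)" for n
    have prob: "prob_space (P n)" for n
    proof
      have "(\<Sum>k\<le>n. ennreal (w n k / m 0)) = ennreal (\<Sum>k\<le>n. w n k / m 0)"
        using w pos by (intro sum_ennreal) auto
      also have "(\<Sum>k\<le>n. w n k / m 0) = 1" using m0[of n] pos by (simp add: sum_divide_distrib[symmetric])
      finally show "emeasure (P n) (space (P n)) = 1"
        by (simp add: P_def space_point_measure emeasure_point_measure_finite)
    qed
    have meas: "(\<lambda>k. real k / real n) \<in> borel_measurable (P n)" for n
      by (simp add: P_def measurable_point_measure_eq1)
    have rd: "real_distribution (N n)" for n
      unfolding N_def using prob_space.real_distribution_distr[OF prob meas] .
    have int: "(\<integral>x. g x \<partial>N n) = (\<Sum>k\<le>n. (w n k / m 0) * g (real k / real n))"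
      if g: "g \<in> borel_measurable borel" for g :: "real \<Rightarrow> real" and n
    proof -
      have "(\<integral>x. g x \<partial>N n) = (\<integral>k. g (real k / real n) \<partial>P n)"
        unfolding N_def by (rule integral_distr[OF meas g])
      also have "\<dots> = (\<Sum>k\<le>n. (w n k / m 0) * g (real k / real n))"
        unfolding P_def using w pos by (subst lebesgue_integral_point_measure_finite) auto
      finally show ?thesis .
    qed
    have "tight N"
      unfolding tight_def
    proof (intro conjI allI impI rd)
      fix \<epsilon> :: real assume "0 < \<epsilon>"
      \<comment> \<open>Tightness is stated with half-open intervals; the left end -1 keeps a
        possible atom at 0.\<close>
      have "measure (N n) {-1<..1} = 1" for n
      proof -
        have "measure (N n) {-1<..1} = measure (P n) ((\<lambda>k. real k / real n) -` {-1<..1} \<inter> space (P n))"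
          unfolding N_def by (rule measure_distr[OF meas]) simp
        also have "(\<lambda>k. real k / real n) -` {-1<..1} \<inter> space (P n) = space (P n)"
        proof -
          have "- 1 < real k / real n" for k
            using divide_nonneg_nonneg[of "real k" "real n"] by linarith
          then show ?thesis using le1 by (auto simp: P_def space_point_measure)
        qed
        also have "measure (P n) (space (P n)) = 1" by (rule prob_space.prob_space[OF prob])
        finally show ?thesis .
      qed
      then show "\<exists>a b. a < b \<and> (\<forall>n. 1 - \<epsilon> < measure (N n) {a<..b})"
        using \<open>0 < \<epsilon>\<close> by (intro exI[of _ "-1"] exI[of _ 1]) simp
    qed
    then obtain r M where r: "strict_mono r" and M: "real_distribution M" and wc: "weak_conv_m (N \<circ> id \<circ> r) M"
      using tight_imp_convergent_subsubsequence[of N id] by (auto simp: strict_mono_id)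
    interpret M: real_distribution M by fact
    \<comment> \<open>Clamping to the unit interval makes \<open>c x ^ j\<close> bounded and
      continuous, as weak convergence requires. Pushing the limit measure forward along
      \<open>c\<close> also places it on the unit interval without an inspection of
      \<open>M\<close>.\<close>
    define c where "c x = max 0 (min 1 x)" for x :: real
    have cm: "c \<in> borel_measurable borel" unfolding c_def by measurable
    have cM: "c \<in> borel_measurable M" using cm by (simp add: measurable_def)
    have momM: "m 0 * (\<integral>x. c x ^ j \<partial>M) = m j" for j
    proof -
      have "(\<lambda>n. \<integral>x. c x ^ j \<partial>(N \<circ> id \<circ> r) n) \<longlonglongrightarrow> (\<integral>x. c x ^ j \<partial>M)"
      proof (rule weak_conv_imp_integral_bdd_continuous_conv[OF _ M wc])
        show "real_distribution ((N \<circ> id \<circ> r) n)" for n by (simp add: rd)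
        show "isCont (\<lambda>x. c x ^ j) x" for x unfolding c_def by (intro continuous_intros)
        show "norm (c x ^ j) \<le> 1" for x by (auto simp: c_def power_le_one abs_if)
      qed
      moreover have "(\<integral>x. c x ^ j \<partial>N n) = (\<Sum>k\<le>n. w n k * (real k / real n) ^ j) / m 0" for n
      proof -
        have "c (real k / real n) = real k / real n" if "k \<le> n" for k
          using le1[OF that] by (simp add: c_def)
        then show ?thesis
          using cm by (subst int) (auto simp: sum_divide_distrib intro!: sum.cong)
      qed
      ultimately have "(\<lambda>n. (\<Sum>k\<le>r n. w (r n) k * (real k / real (r n)) ^ j) / m 0) \<longlonglongrightarrow> (\<integral>x. c x ^ j \<partial>M)"
        by simp
      moreover have "(\<lambda>n. (\<Sum>k\<le>r n. w (r n) k * (real k / real (r n)) ^ j) / m 0) \<longlonglongrightarrow> m j / m 0"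
        using LIMSEQ_subseq_LIMSEQ[OF conv r, unfolded o_def] pos by (intro tendsto_divide tendsto_const) auto
      ultimately have "(\<integral>x. c x ^ j \<partial>M) = m j / m 0" by (rule LIMSEQ_unique)
      then show ?thesis using pos by simp
    qed
    define \<nu> where "\<nu> = density (distr M borel c) (\<lambda>_. ennreal (m 0))"
    have "emeasure \<nu> (space \<nu>) = ennreal (m 0) * emeasure (distr M borel c) (space (distr M borel c))"
      unfolding \<nu>_def by (subst emeasure_density_const) auto
    also have "emeasure (distr M borel c) (space (distr M borel c)) = 1"
      by (rule prob_space.emeasure_space_1[OF M.prob_space_distr[OF cM]])
    finally have "finite_measure \<nu>" by (intro finite_measureI) simp
    moreover have "sets \<nu> = sets borel" by (simp add: \<nu>_def)
    moreover have "AE x in \<nu>. x \<in> {0..1}"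
    proof -
      have "AE x in distr M borel c. x \<in> {0..1}"
        using cM by (subst AE_distr_iff) (auto simp: c_def)
      then show ?thesis unfolding \<nu>_def by (subst AE_density) auto
    qed
    moreover have "(\<integral>x. x ^ j \<partial>\<nu>) = m j" for j
    proof -
      have "(\<integral>x. x ^ j \<partial>\<nu>) = (\<integral>x. m 0 *\<^sub>R x ^ j \<partial>distr M borel c)"
        unfolding \<nu>_def using pos by (subst integral_density) auto
      also have "\<dots> = (\<integral>x. m 0 *\<^sub>R c x ^ j \<partial>M)"
        by (rule integral_distr[OF cM]) measurable
      also have "\<dots> = m j" using momM[of j] by simp
      finally show ?thesis .
    qed
    ultimately show thesis by (rule that)
  qed
qed

section \<open>Antiholomorphic involutions of the disc\<close>

text \<open>Schwarz's lemma for the conjugates of \<kappa> and \<iota> gives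
  \<open>|\<kappa> z| \<le> |z|\<close> and
  \<open>|z| = |\<iota> (\<kappa> z)| \<le> |\<kappa> z|\<close>; equality at the single point 1/2
  already forces a rotation. The inverse is a separate map because the lemma is also applied to a
  map that need not be an involution.\<close>

lemma antiholomorphic_Schwarz_rotation:
  assumes \<kappa>: "\<And>z. z \<in> ball 0 1 \<Longrightarrow> \<kappa> z \<in> ball 0 1" and h\<kappa>: "(\<lambda>z. cnj (\<kappa> z)) holomorphic_on ball 0 1" and \<kappa>0: "\<kappa> 0 = 0"
    and \<iota>: "\<And>z. z \<in> ball 0 1 \<Longrightarrow> \<iota> z \<in> ball 0 1" and h\<iota>: "(\<lambda>z. cnj (\<iota> z)) holomorphic_on ball 0 1" and \<iota>0: "\<iota> 0 = 0"
    and inv: "\<And>z. z \<in> ball 0 1 \<Longrightarrow> \<iota> (\<kappa> z) = z"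
  obtains \<alpha> where "cmod \<alpha> = 1" "\<And>z. z \<in> ball 0 1 \<Longrightarrow> \<kappa> z = \<alpha> * cnj z"
proof -
  have le: "cmod (\<kappa> z) \<le> cmod z" "cmod (\<iota> z) \<le> cmod z" if "z \<in> ball 0 1" for z
  proof -
    have "cmod (cnj (\<kappa> z)) \<le> cmod z"
      by (rule Schwarz_Lemma(1)[OF h\<kappa>]) (use \<kappa> \<kappa>0 that in auto)
    then show "cmod (\<kappa> z) \<le> cmod z" by simp
    have "cmod (cnj (\<iota> z)) \<le> cmod z"
      by (rule Schwarz_Lemma(1)[OF h\<iota>]) (use \<iota> \<iota>0 that in auto)
    then show "cmod (\<iota> z) \<le> cmod z" by simp
  qed
  have half: "(1/2 :: complex) \<in> ball 0 1" by (simp add: norm_divide)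
  have "cmod (\<kappa> (1/2)) = cmod (1/2)"
    using le(1)[OF half] le(2)[OF \<kappa>[OF half]] inv[OF half] by simp
  then have "cmod (1/2 :: complex) < 1 \<and> (1/2 :: complex) \<noteq> 0 \<and> cmod (cnj (\<kappa> (1/2))) = cmod (1/2)"
    using half by simp
  then have "\<exists>\<alpha>. (\<forall>z. cmod z < 1 \<longrightarrow> cnj (\<kappa> z) = \<alpha> * z) \<and> cmod \<alpha> = 1"
    by (intro Schwarz_Lemma(3)[OF h\<kappa>, of 0]) (use \<kappa> \<kappa>0 in \<open>auto intro: exI[of _ "1/2"]\<close>)
  then obtain \<alpha> where \<alpha>: "\<And>z. cmod z < 1 \<Longrightarrow> cnj (\<kappa> z) = \<alpha> * z" "cmod \<alpha> = 1" by blast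
  show thesis
  proof (rule that[of "cnj \<alpha>"])
    show "cmod (cnj \<alpha>) = 1" using \<alpha> by simp
    fix z :: complex assume "z \<in> ball 0 1"
    then have "cnj (\<kappa> z) = \<alpha> * z" using \<alpha> by simp
    from arg_cong[OF this, of cnj] show "\<kappa> z = cnj \<alpha> * cnj z" by simp
  qed
qed

text \<open>The fixed point is found as the hyperbolic midpoint of \<open>0\<close> and \<open>\<tau> 0\<close>; moving it to the
  origin turns \<open>\<tau>\<close> into \<open>z \<mapsto> \<alpha> (cnj z)\<close> by Schwarz's lemma.\<close>

lemma disc_antiholomorphic_involution_conjugate_cnj:
  assumes \<tau>: "\<And>z. z \<in> ball 0 1 \<Longrightarrow> \<tau> z \<in> ball 0 1" and inv: "\<And>z. z \<in> ball 0 1 \<Longrightarrow> \<tau> (\<tau> z) = z"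
    and hol: "(\<lambda>z. cnj (\<tau> z)) holomorphic_on ball 0 1"
  obtains b u where "cmod b < 1" "cmod u = 1"
    "\<And>z. z \<in> ball 0 1 \<Longrightarrow> \<tau> (Moebius_function 0 b (u * z)) = Moebius_function 0 b (u * cnj z)"
proof -
  let ?M = "Moebius_function 0"
  have Mball: "?M a z \<in> ball 0 1" if "cmod a < 1" "z \<in> ball 0 1" for a z
    using Moebius_function_norm_lt_1 that by simp
  have Minv: "?M a (?M (-a) z) = z" "?M (-a) (?M a z) = z" if "cmod a < 1" "z \<in> ball 0 1" for a z
    using Moebius_function_compose[of a "-a" z] Moebius_function_compose[of "-a" a z] that by auto
  have Mcnj: "cnj (?M a z) = ?M (cnj a) (cnj z)" for a z
    by (simp add: Moebius_function_def)
  have holM: "(\<lambda>z. ?M a (f z)) holomorphic_on ball 0 1"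
    if "cmod a < 1" "f holomorphic_on ball 0 1" "\<And>z. z \<in> ball 0 1 \<Longrightarrow> f z \<in> ball 0 1" for a f
  proof -
    have "f ` ball 0 1 \<subseteq> ball 0 1" using that(3) by blast
    from holomorphic_on_compose_gen[OF that(2) Moebius_function_holomorphic[OF that(1), of 0] this]
    show ?thesis by (simp add: o_def)
  qed
  have hol\<tau>: "(\<lambda>z. cnj (\<tau> (f z))) holomorphic_on ball 0 1"
    if "f holomorphic_on ball 0 1" "\<And>z. z \<in> ball 0 1 \<Longrightarrow> f z \<in> ball 0 1" for f
  proof -
    have "f ` ball 0 1 \<subseteq> ball 0 1" using that(2) by blast
    from holomorphic_on_compose_gen[OF that(1) hol this] show ?thesis by (simp add: o_def)
  qed
  have cnjb: "cnj z \<in> ball 0 1" if "z \<in> ball 0 1" for z using that by simp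
  define p where "p = \<tau> 0"
  have p: "cmod p < 1" using \<tau>[of 0] by (simp add: p_def)
  have M0: "?M (-a) 0 = a" "?M a a = 0" for a by (simp_all add: Moebius_function_def)
  \<comment> \<open>\<open>?M p\<close> carries \<open>\<tau> 0\<close> to 0, so Schwarz's lemma
    applies and makes \<open>\<tau>\<close> explicit enough to solve for a fixed point.\<close>
  obtain \<alpha> where \<alpha>: "cmod \<alpha> = 1" "\<And>z. z \<in> ball 0 1 \<Longrightarrow> ?M p (\<tau> z) = \<alpha> * cnj z"
  proof (rule antiholomorphic_Schwarz_rotation[of "\<lambda>z. ?M p (\<tau> z)" "\<lambda>z. \<tau> (?M (-p) z)"])
    show "(\<lambda>z. cnj (?M p (\<tau> z))) holomorphic_on ball 0 1"
      unfolding Mcnj by (intro holM hol) (use p \<tau> in auto)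
    show "(\<lambda>z. cnj (\<tau> (?M (-p) z))) holomorphic_on ball 0 1"
      by (intro hol\<tau> holM holomorphic_on_ident) (use p Mball[of "-p"] in auto)
    show "\<tau> (?M (-p) (?M p (\<tau> z))) = z" if "z \<in> ball 0 1" for z
      using Minv(2)[OF p \<tau>[OF that]] inv[OF that] by simp
  qed (use p Mball \<tau> M0 inv[of 0] in \<open>auto simp: p_def\<close>)
  have \<tau>eq: "\<tau> z = ?M (-p) (\<alpha> * cnj z)" if "z \<in> ball 0 1" for z
    using Minv(2)[OF p \<tau>[OF that]] \<alpha>(2)[OF that] by simp
  \<comment> \<open>Read off at \<open>p\<close>, where \<open>\<tau> p = 0\<close>.\<close>
  have ap: "\<alpha> * cnj p = - p"
    using \<alpha>(2)[of p] inv[of 0] p by (simp add: p_def Moebius_function_def)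
  define s where "s = sqrt (1 - (cmod p)\<^sup>2)"
  \<comment> \<open>For a point \<open>t * p\<close> the fixed point equation is
    \<open>t\<^sup>2 * |p|\<^sup>2 - 2 * t + 1 = 0\<close>. This is its smaller root, in the form
    that makes sense for \<open>p = 0\<close> too.\<close>
  define t where "t = 1 / (1 + s)"
  have q1: "(cmod p)\<^sup>2 < 1" using p by (simp add: power_less_one_iff abs_square_less_1)
  have s: "0 < s" "s\<^sup>2 = 1 - (cmod p)\<^sup>2" using q1 by (auto simp: s_def)
  have t: "0 < t" "t \<le> 1" "1 - t = t * s" "1 - t * (cmod p)\<^sup>2 = s"
  proof -
    have "(cmod p)\<^sup>2 = (1 - s) * (1 + s)" using s(2) by (simp add: algebra_simps power2_eq_square)
    then show "1 - t * (cmod p)\<^sup>2 = s" using s(1) by (simp add: t_def)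
  qed (use s in \<open>auto simp: t_def field_simps\<close>)
  define b where "b = of_real t * p"
  have "cmod b \<le> 1 * cmod p" unfolding b_def norm_mult using t by (intro mult_right_mono) auto
  then have b: "cmod b < 1" using p by simp
  have \<tau>b: "\<tau> b = b"
  proof -
    have "\<tau> b = ?M (-p) (of_real t * (\<alpha> * cnj p))" using \<tau>eq[of b] b by (simp add: b_def mult_ac)
    also have "\<dots> = (p - of_real t * p) / (1 - of_real t * (cnj p * p))"
      unfolding ap by (simp add: Moebius_function_def mult_ac)
    also have "cnj p * p = of_real ((cmod p)\<^sup>2)" by (metis complex_norm_square mult.commute)
    also have "1 - of_real t * complex_of_real ((cmod p)\<^sup>2) = of_real (1 - t * (cmod p)\<^sup>2)" by simp
    also have "p - of_real t * p = of_real (1 - t) * p" by (simp add: algebra_simps)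
    also have "of_real (1 - t) * p / of_real (1 - t * (cmod p)\<^sup>2) = b"
      unfolding t b_def using s by simp
    finally show ?thesis .
  qed
  define \<kappa> where "\<kappa> z = ?M b (\<tau> (?M (-b) z))" for z
  have \<kappa>b: "\<kappa> z \<in> ball 0 1" if "z \<in> ball 0 1" for z
    unfolding \<kappa>_def using b Mball[of "-b"] Mball[of b] \<tau> that by auto
  have h\<kappa>: "(\<lambda>z. cnj (\<kappa> z)) holomorphic_on ball 0 1"
    unfolding \<kappa>_def Mcnj by (intro holM hol\<tau> holomorphic_on_ident) (use b \<tau> Mball[of "-b"] in auto)
  have \<kappa>0: "\<kappa> 0 = 0" by (simp add: \<kappa>_def M0 \<tau>b)
  have \<kappa>\<kappa>: "\<kappa> (\<kappa> z) = z" if z: "z \<in> ball 0 1" for z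
  proof -
    have z': "?M (-b) z \<in> ball 0 1" using Mball[of "-b"] b z by simp
    show ?thesis unfolding \<kappa>_def
      using Minv(2)[OF b \<tau>[OF z']] inv[OF z'] Minv(1)[OF b z] by simp
  qed
  obtain \<beta> where \<beta>: "cmod \<beta> = 1" "\<And>z. z \<in> ball 0 1 \<Longrightarrow> \<kappa> z = \<beta> * cnj z"
    by (rule antiholomorphic_Schwarz_rotation[OF \<kappa>b h\<kappa> \<kappa>0 \<kappa>b h\<kappa> \<kappa>0 \<kappa>\<kappa>]) (assumption, assumption, assumption, rule that)
  \<comment> \<open>A rotation by half the angle of \<beta> removes the factor:
    \<open>\<beta> * cnj (u * z) = u * cnj z\<close>.\<close>
  define u where "u = csqrt \<beta>"
  have u2: "u * u = \<beta>" by (simp add: u_def flip: power2_eq_square)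
  have u: "cmod u = 1" using \<beta>(1) by (simp add: u_def)
  show thesis
  proof (rule that[of "-b" u])
    show "cmod (-b) < 1" "cmod u = 1" using b u by auto
    fix z :: complex assume z: "z \<in> ball 0 1"
    then have uz: "u * z \<in> ball 0 1" using u by (simp add: norm_mult)
    have z': "?M (-b) (u * z) \<in> ball 0 1" using Mball[of "-b"] b uz by simp
    have "\<tau> (?M (-b) (u * z)) = ?M (-b) (\<kappa> (u * z))"
      unfolding \<kappa>_def using Minv(2)[OF b \<tau>[OF z']] by simp
    also have "\<kappa> (u * z) = u * (u * cnj u) * cnj z" using \<beta>(2)[OF uz] u2 by (simp add: mult_ac)
    also have "u * cnj u = 1" using u by (metis complex_norm_square of_real_1 one_power2)
    finally show "\<tau> (?M (-b) (u * z)) = ?M (-b) (u * cnj z)" by simp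
  qed
qed

section \<open>Weakly continuous positive functionals\<close>

lemma boundary_value_continuous:
  assumes G: "continuous_on (cball 0 1) G" and \<zeta>: "cmod \<zeta> = 1" and eq: "\<And>z. z \<in> ball 0 1 \<Longrightarrow> g z = G z"
  shows "boundary_value g \<zeta> = G \<zeta>"
proof (rule boundary_value_eqI[OF \<zeta>])
  fix M :: real
  have sub: "stolz_region M \<zeta> \<subseteq> cball 0 1" by (auto simp: stolz_region_def)
  have "(G \<longlongrightarrow> G \<zeta>) (at \<zeta> within cball 0 1)" using G \<zeta> by (auto simp: continuous_on_def)
  then have "(G \<longlongrightarrow> G \<zeta>) (at \<zeta> within stolz_region M \<zeta>)" using sub by (rule tendsto_within_subset)
  then show "(g \<longlongrightarrow> G \<zeta>) (at \<zeta> within stolz_region M \<zeta>)"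
  proof (rule Lim_transform_eventually)
    have "\<forall>z\<in>stolz_region M \<zeta>. G z = g z" using eq by (auto simp: stolz_region_def)
    then show "\<forall>\<^sub>F z in at \<zeta> within stolz_region M \<zeta>. G z = g z" by (simp add: eventually_at_filter)
  qed
qed

lemma AE_cis_neq: "AE t in lebesgue. cis t \<noteq> \<xi>"
proof (cases "\<exists>s. cis s = \<xi>")
  case True
  then obtain s where s: "cis s = \<xi>" by blast
  have "{t. cis t = \<xi>} \<subseteq> range (\<lambda>n::int. s + 2 * pi * n)"
  proof
    fix t assume "t \<in> {t. cis t = \<xi>}"
    then have "sin t = sin s \<and> cos t = cos s" using s by (auto simp: complex_eq_iff)
    then show "t \<in> range (\<lambda>n::int. s + 2 * pi * n)" unfolding sin_cos_eq_iff by blast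
  qed
  then have "countable {t. cis t = \<xi>}" by (rule countable_subset) simp
  then have "{t. cis t = \<xi>} \<in> null_sets lebesgue"
    by (intro null_sets_completionI countable_imp_null_set_lborel)
  then show ?thesis by (rule AE_I') auto
qed auto

text \<open>\<open>(n choose k) * (k choose j) = (n choose j) * ((n - j) choose (k - j))\<close>
  reduces the sum to \<open>X ^ j\<close> times the binomial expansion of
  \<open>(X + Y) ^ (n - j)\<close>.\<close>

lemma bernstein_power_expansion:
  fixes X Y :: "'a::field_char_0"
  assumes "X + Y = 1" "j \<le> n"
  shows "(\<Sum>k\<le>n. of_nat (n choose k) * (of_nat (k choose j) / of_nat (n choose j)) * (X ^ k * Y ^ (n - k))) = X ^ j"
proof -
  have nz: "of_nat (n choose j) \<noteq> (0::'a)" using assms by simp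
  let ?g = "\<lambda>k. of_nat (n choose k) * (of_nat (k choose j) / of_nat (n choose j)) * (X ^ k * Y ^ (n - k))"
  have "(\<Sum>k\<le>n. ?g k) = (\<Sum>k\<in>{j..n}. ?g k)"
    by (rule sum.mono_neutral_right) (auto simp: binomial_eq_0)
  also have "\<dots> = (\<Sum>i\<le>n - j. ?g (i + j))"
    using sum.shift_bounds_cl_nat_ivl[of ?g 0 j "n - j"] assms by (simp add: atMost_atLeast0)
  also have "\<dots> = (\<Sum>i\<le>n - j. X ^ j * (of_nat ((n - j) choose i) * X ^ i * Y ^ (n - j - i)))"
  proof (rule sum.cong[OF refl])
    fix i assume "i \<in> {..n - j}"
    then have "(n choose (i + j)) * ((i + j) choose j) = (n choose j) * ((n - j) choose i)"
      using choose_mult[of j "i + j" n] assms by simp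
    then have "of_nat (n choose (i + j)) * of_nat ((i + j) choose j) = (of_nat (n choose j) * of_nat ((n - j) choose i) :: 'a)"
      by (metis of_nat_mult)
    then have "of_nat (n choose (i + j)) * (of_nat ((i + j) choose j) / of_nat (n choose j)) = (of_nat ((n - j) choose i) :: 'a)"
      using nz by (simp add: field_simps)
    moreover have "n - (i + j) = n - j - i" by simp
    ultimately show "?g (i + j) = X ^ j * (of_nat ((n - j) choose i) * X ^ i * Y ^ (n - j - i))"
      by (simp only: power_add) (simp add: mult_ac)
  qed
  also have "\<dots> = X ^ j * (X + Y) ^ (n - j)"
    unfolding binomial_ring by (simp add: sum_distrib_left)
  finally show ?thesis using assms by simp
qed

text \<open>Makes the powers of \<open>(1 + w) / 2\<close> tend to 0 at every point of the closed
  disc other than 1.\<close>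

lemma norm_half_one_plus_less:
  fixes w :: complex
  assumes "cmod w \<le> 1" "w \<noteq> 1"
  shows "cmod ((1 + w) / 2) < 1"
proof -
  have "Re w < 1"
  proof (rule ccontr)
    assume "\<not> Re w < 1"
    then have "Re w = 1" using complex_Re_le_cmod[of w] assms by linarith
    moreover have "(Re w)\<^sup>2 + (Im w)\<^sup>2 \<le> 1"
      using assms(1) by (simp only: cmod_power2[symmetric]) (simp add: power_le_one)
    ultimately show False using assms(2) by (simp add: complex_eq_iff)
  qed
  have w1: "(cmod w)\<^sup>2 \<le> 1" using assms(1) by (simp add: power_le_one)
  have "(cmod (1 + w))\<^sup>2 = 1 + 2 * Re w + (cmod w)\<^sup>2"
    by (simp only: cmod_power2) (simp add: power2_eq_square algebra_simps)
  also have "\<dots> < 2\<^sup>2" using w1 \<open>Re w < 1\<close> by simp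
  finally have "cmod (1 + w) < 2" by (rule power_less_imp_less_base) simp
  then show ?thesis by (simp add: norm_divide)
qed

section \<open>The functional in a symmetric coordinate of the disc\<close>

text \<open>Differs from \<open>Hinf (ball 0 1)\<close> in leaving values off the disc free, so that
  polynomials can be used as they stand.\<close>

definition disc_bounded_holomorphic :: "(complex \<Rightarrow> complex) \<Rightarrow> bool" where
  "disc_bounded_holomorphic v \<longleftrightarrow> v holomorphic_on ball 0 1 \<and> bounded (v ` ball 0 1)"

lemma disc_bounded_holomorphicI:
  assumes "v holomorphic_on ball 0 1" "continuous_on (cball 0 1) v"
  shows "disc_bounded_holomorphic v"
proof -
  have "bounded (v ` cball 0 1)"
    using assms(2) by (intro compact_imp_bounded compact_continuous_image) auto
  then have "bounded (v ` ball 0 1)" by (rule bounded_subset) auto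
  then show ?thesis using assms by (simp add: disc_bounded_holomorphic_def)
qed

lemma disc_bounded_holomorphic_entire:
  "v holomorphic_on UNIV \<Longrightarrow> disc_bounded_holomorphic v"
  by (intro disc_bounded_holomorphicI) (auto intro: holomorphic_on_subset holomorphic_on_imp_continuous_on continuous_on_subset)

text \<open>\<open>\<psi>\<close> is a Moebius change of coordinate of the disc after which the involution \<open>\<sigma>\<close> becomes
  complex conjugation; \<open>\<psi>i\<close> is its inverse and \<open>q\<close> the resulting coordinate on \<open>\<Omega>\<close>.\<close>

locale weakly_continuous_positive_functional =
  fixes \<Omega> :: "complex set" and \<sigma> \<phi> :: "complex \<Rightarrow> complex" and \<eta> :: "(complex \<Rightarrow> complex) \<Rightarrow> complex"
    and b u :: complex
  assumes biholomorphic: "biholomorphic_map \<phi> (ball 0 1) \<Omega>"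
    and positive: "positive_functional \<Omega> \<sigma> \<eta>"
    and weakly_continuous: "continuous_map (weak_topology \<Omega> \<phi>) euclidean \<eta>"
    and involution: "antiholomorphic_involution \<Omega> \<sigma>"
    and b: "cmod b < 1" and u: "cmod u = 1"
    and conjugation: "\<And>z. z \<in> ball 0 1 \<Longrightarrow> inv_into (ball 0 1) \<phi> (\<sigma> (\<phi> (Moebius_function 0 b (u * z)))) = Moebius_function 0 b (u * cnj z)"
begin

definition "\<psi> z = Moebius_function 0 b (u * z)"
definition "\<psi>i w = cnj u * Moebius_function 0 (-b) w"
definition "q z = \<psi>i (inv_into (ball 0 1) \<phi> z)"
text \<open>Transport from the symmetric coordinate back to \<Omega>; the value 0 elsewhere is what
  membership in \<open>Hinf\<close> demands.\<close>

definition "pull v = (\<lambda>z. if z \<in> \<Omega> then v (q z) else 0)"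
definition "\<Lambda> v = \<eta> (pull v)"

lemma uu: "u * cnj u = 1" "cnj u * u = 1"
proof -
  show "u * cnj u = 1" using u by (metis complex_norm_square of_real_1 one_power2)
  then show "cnj u * u = 1" by (simp only: mult.commute)
qed

lemma \<psi>_ball: "z \<in> ball 0 1 \<Longrightarrow> \<psi> z \<in> ball 0 1"
  using Moebius_function_norm_lt_1[OF b, of "u * z" 0] u by (simp add: \<psi>_def norm_mult)

lemma \<psi>i_ball: "z \<in> ball 0 1 \<Longrightarrow> \<psi>i z \<in> ball 0 1"
  using Moebius_function_norm_lt_1[of "-b" z 0] b u by (simp add: \<psi>i_def norm_mult)

lemma \<psi>_\<psi>i: "z \<in> ball 0 1 \<Longrightarrow> \<psi> (\<psi>i z) = z"
  using Moebius_function_compose[of b "-b" z] b by (simp add: \<psi>_def \<psi>i_def uu flip: mult.assoc)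

lemma \<psi>i_\<psi>: "z \<in> ball 0 1 \<Longrightarrow> \<psi>i (\<psi> z) = z"
  using Moebius_function_compose[of "-b" b "u * z"] b u by (simp add: \<psi>_def \<psi>i_def norm_mult uu flip: mult.assoc)

lemma holomorphic_\<psi>i: "\<psi>i holomorphic_on ball 0 1"
  unfolding \<psi>i_def using Moebius_function_holomorphic[of "-b" 0] b by (intro holomorphic_intros) auto

lemma moebius_denominator: "w \<in> cball 0 1 \<Longrightarrow> 1 - cnj b * w \<noteq> 0" "w \<in> cball 0 1 \<Longrightarrow> 1 + cnj b * w \<noteq> 0"
proof -
  assume "w \<in> cball 0 1"
  then have "cmod (cnj b * w) \<le> cmod b * 1" unfolding norm_mult by (intro mult_mono) auto
  then have "cmod (cnj b * w) < 1" using b by linarith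
  then have "cnj b * w \<noteq> 1" "cnj b * w \<noteq> - 1"
    by (metis norm_one less_irrefl, metis norm_one norm_minus_cancel less_irrefl)
  then show "1 - cnj b * w \<noteq> 0" "1 + cnj b * w \<noteq> 0"
    by (auto simp: add_eq_0_iff)
qed

lemma continuous_\<psi>i: "continuous_on (cball 0 1) \<psi>i"
  unfolding \<psi>i_def Moebius_function_simple
  by (intro continuous_intros) (use moebius_denominator(2) in auto)

lemma \<psi>i_cball: "z \<in> cball 0 1 \<Longrightarrow> \<psi>i z \<in> cball 0 1"
proof -
  have "\<psi>i ` closure (ball 0 1) \<subseteq> cball 0 1"
    by (rule image_closure_subset) (use continuous_\<psi>i \<psi>i_ball in \<open>auto simp: less_imp_le\<close>)
  then show "z \<in> cball 0 1 \<Longrightarrow> \<psi>i z \<in> cball 0 1" by (simp add: image_subset_iff)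
qed

lemma \<psi>i_cis: "\<psi>i (cis t) \<in> cball 0 1"
  by (rule \<psi>i_cball) simp

text \<open>Solving the Moebius equation leaves one candidate for \<open>cis t\<close>, and a single
  point of the circle corresponds to a null set of angles.\<close>

lemma AE_\<psi>i_neq:
  assumes e: "cmod e = 1"
  shows "AE t in lebesgue. \<psi>i (cis t) \<noteq> e"
proof -
  let ?e = "u * e"
  have "cis t = (?e - b) / (1 - cnj b * ?e)" if "\<psi>i (cis t) = e" for t
  proof -
    have "u * (cnj u * Moebius_function 0 (-b) (cis t)) = ?e" using that by (simp add: \<psi>i_def)
    then have "(cis t + b) / (1 + cnj b * cis t) = ?e"
      by (simp add: uu Moebius_function_simple flip: mult.assoc)
    then have "cis t + b = ?e * (1 + cnj b * cis t)"
      using moebius_denominator(2)[of "cis t"] by (simp add: divide_eq_eq)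
    then have "cis t * (1 - cnj b * ?e) = ?e - b" by (simp add: algebra_simps)
    moreover have "1 - cnj b * ?e \<noteq> 0" by (rule moebius_denominator(1)) (use e u in \<open>simp add: norm_mult\<close>)
    ultimately show ?thesis by (simp add: eq_divide_eq)
  qed
  with AE_cis_neq[of "(?e - b) / (1 - cnj b * ?e)"] show ?thesis
    by (auto elim!: eventually_mono)
qed

lemma \<phi>_bij: "bij_betw \<phi> (ball 0 1) \<Omega>"
  and inv\<phi>_holomorphic: "inv_into (ball 0 1) \<phi> holomorphic_on \<Omega>"
  and \<phi>_holomorphic: "\<phi> holomorphic_on ball 0 1"
  using biholomorphic by (auto simp: biholomorphic_map_def)

lemma \<phi>_in: "z \<in> ball 0 1 \<Longrightarrow> \<phi> z \<in> \<Omega>"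
  using \<phi>_bij by (rule bij_betw_apply)

lemma inv\<phi>: "z \<in> \<Omega> \<Longrightarrow> inv_into (ball 0 1) \<phi> z \<in> ball 0 1" "z \<in> \<Omega> \<Longrightarrow> \<phi> (inv_into (ball 0 1) \<phi> z) = z"
  "w \<in> ball 0 1 \<Longrightarrow> inv_into (ball 0 1) \<phi> (\<phi> w) = w"
proof -
  show "w \<in> ball 0 1 \<Longrightarrow> inv_into (ball 0 1) \<phi> (\<phi> w) = w" by (rule bij_betw_inv_into_left[OF \<phi>_bij])
  show "z \<in> \<Omega> \<Longrightarrow> \<phi> (inv_into (ball 0 1) \<phi> z) = z" by (rule bij_betw_inv_into_right[OF \<phi>_bij])
  show "z \<in> \<Omega> \<Longrightarrow> inv_into (ball 0 1) \<phi> z \<in> ball 0 1" by (rule bij_betw_apply[OF bij_betw_inv_into[OF \<phi>_bij]])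
qed

lemma q_ball: "z \<in> \<Omega> \<Longrightarrow> q z \<in> ball 0 1"
  unfolding q_def by (intro \<psi>i_ball inv\<phi>)

lemma q_\<phi>: "w \<in> ball 0 1 \<Longrightarrow> q (\<phi> w) = \<psi>i w"
  by (simp only: q_def inv\<phi>(3))

lemma \<phi>_\<psi>_q: "z \<in> \<Omega> \<Longrightarrow> \<phi> (\<psi> (q z)) = z"
  unfolding q_def by (simp only: \<psi>_\<psi>i inv\<phi>)

lemma \<sigma>_in: "z \<in> \<Omega> \<Longrightarrow> \<sigma> z \<in> \<Omega>"
  using involution by (auto simp: antiholomorphic_involution_def)

lemma \<sigma>_\<phi>\<psi>: "z \<in> ball 0 1 \<Longrightarrow> \<sigma> (\<phi> (\<psi> z)) = \<phi> (\<psi> (cnj z))"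
proof -
  assume z: "z \<in> ball 0 1"
  have "inv_into (ball 0 1) \<phi> (\<sigma> (\<phi> (\<psi> z))) = \<psi> (cnj z)"
    using conjugation[OF z] by (simp add: \<psi>_def)
  then have "\<phi> (inv_into (ball 0 1) \<phi> (\<sigma> (\<phi> (\<psi> z)))) = \<phi> (\<psi> (cnj z))" by simp
  then show ?thesis using inv\<phi>(2)[OF \<sigma>_in[OF \<phi>_in[OF \<psi>_ball[OF z]]]] by simp
qed

lemma q_\<sigma>: "z \<in> \<Omega> \<Longrightarrow> q (\<sigma> z) = cnj (q z)"
proof -
  assume z: "z \<in> \<Omega>"
  have cq: "cnj (q z) \<in> ball 0 1" using q_ball[OF z] by simp
  have "\<sigma> z = \<phi> (\<psi> (cnj (q z)))" using \<sigma>_\<phi>\<psi>[OF q_ball[OF z]] \<phi>_\<psi>_q[OF z] by simp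
  then show ?thesis using q_\<phi>[OF \<psi>_ball[OF cq]] \<psi>i_\<psi>[OF cq] by simp
qed

lemma q_holomorphic: "q holomorphic_on \<Omega>"
proof -
  have "(\<psi>i \<circ> inv_into (ball 0 1) \<phi>) holomorphic_on \<Omega>"
    by (rule holomorphic_on_compose_gen[OF inv\<phi>_holomorphic holomorphic_\<psi>i]) (use inv\<phi>(1) in blast)
  then show ?thesis by (simp add: q_def[abs_def] o_def)
qed

lemma pull_Hinf:
  assumes "disc_bounded_holomorphic v"
  shows "pull v \<in> Hinf \<Omega>"
proof -
  have "(v \<circ> q) holomorphic_on \<Omega>"
    by (rule holomorphic_on_compose_gen[OF q_holomorphic]) (use assms q_ball in \<open>auto simp: disc_bounded_holomorphic_def\<close>)
  then have "pull v holomorphic_on \<Omega>"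
    by (rule holomorphic_transform) (simp add: pull_def)
  moreover have "pull v ` \<Omega> \<subseteq> v ` ball 0 1" using q_ball by (auto simp: pull_def simp del: mem_ball)
  then have "bounded (pull v ` \<Omega>)"
    using assms bounded_subset unfolding disc_bounded_holomorphic_def by blast
  ultimately show ?thesis by (simp add: Hinf_def pull_def)
qed

lemma \<Lambda>_cong: "(\<And>z. z \<in> ball 0 1 \<Longrightarrow> v z = w z) \<Longrightarrow> \<Lambda> v = \<Lambda> w"
proof -
  assume "\<And>z. z \<in> ball 0 1 \<Longrightarrow> v z = w z"
  then have "pull v = pull w" unfolding pull_def using q_ball by fastforce
  then show ?thesis by (simp add: \<Lambda>_def)
qed

lemma linear: "linear_functional \<Omega> \<eta>" and \<eta>_nonneg: "f \<in> Hinf \<Omega> \<Longrightarrow> \<eta> (\<lambda>z. sharp \<Omega> \<sigma> f z * f z) \<in> \<real>\<^sub>\<ge>\<^sub>0"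
  using positive by (auto simp: positive_functional_def)

lemma \<Lambda>_add:
  assumes "disc_bounded_holomorphic v" "disc_bounded_holomorphic w"
  shows "\<Lambda> (\<lambda>z. v z + w z) = \<Lambda> v + \<Lambda> w"
proof -
  have "pull (\<lambda>z. v z + w z) = (\<lambda>z. pull v z + pull w z)" by (auto simp: pull_def)
  then show ?thesis
    using linear pull_Hinf[OF assms(1)] pull_Hinf[OF assms(2)] by (simp add: \<Lambda>_def linear_functional_def)
qed

lemma \<Lambda>_cmult:
  assumes "disc_bounded_holomorphic v"
  shows "\<Lambda> (\<lambda>z. c * v z) = c * \<Lambda> v"
proof -
  have "pull (\<lambda>z. c * v z) = (\<lambda>z. c * pull v z)" by (auto simp: pull_def)
  then show ?thesis
    using linear pull_Hinf[OF assms(1)] by (simp add: \<Lambda>_def linear_functional_def)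
qed

lemma \<Lambda>_zero: "\<Lambda> (\<lambda>_. 0) = 0"
  using \<Lambda>_cmult[OF disc_bounded_holomorphic_entire, of "\<lambda>_. 0" 0] by simp

lemma \<Lambda>_sum:
  assumes "finite A" "\<And>i. v i holomorphic_on UNIV"
  shows "\<Lambda> (\<lambda>z. \<Sum>i\<in>A. c i * v i z) = (\<Sum>i\<in>A. c i * \<Lambda> (v i))"
  using assms(1)
proof (induction A rule: finite_induct)
  case (insert i A)
  have "\<Lambda> (\<lambda>z. c i * v i z + (\<Sum>i\<in>A. c i * v i z)) = \<Lambda> (\<lambda>z. c i * v i z) + \<Lambda> (\<lambda>z. \<Sum>i\<in>A. c i * v i z)"
    by (intro \<Lambda>_add disc_bounded_holomorphic_entire holomorphic_intros assms(2))
  also have "\<Lambda> (\<lambda>z. c i * v i z) = c i * \<Lambda> (v i)"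
    by (intro \<Lambda>_cmult disc_bounded_holomorphic_entire assms(2))
  finally show ?case using insert by simp
qed (simp add: \<Lambda>_zero)

text \<open>The coordinate \<open>q\<close> turns \<sigma> into conjugation, so the symmetry of
  \<open>v\<close> says that \<open>sharp\<close> fixes \<open>pull v\<close>; positivity then
  speaks about the plain square.\<close>

lemma \<Lambda>_square_nonneg:
  assumes v: "disc_bounded_holomorphic v" and sym: "\<And>z. z \<in> ball 0 1 \<Longrightarrow> v (cnj z) = cnj (v z)"
  shows "\<Lambda> (\<lambda>z. v z * v z) \<in> \<real>\<^sub>\<ge>\<^sub>0"
proof -
  have "sharp \<Omega> \<sigma> (pull v) z * pull v z = pull (\<lambda>z. v z * v z) z" for z
    using \<sigma>_in[of z] q_\<sigma>[of z] sym[of "q z"] q_ball[of z] by (simp add: sharp_def pull_def)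
  then have "(\<lambda>z. sharp \<Omega> \<sigma> (pull v) z * pull v z) = pull (\<lambda>z. v z * v z)" by blast
  with \<eta>_nonneg[OF pull_Hinf[OF v]] show ?thesis by (simp add: \<Lambda>_def)
qed

text \<open>On the disc \<open>(1 + z) / 2\<close> and \<open>(1 - z) / 2\<close> have positive real
  part. The principal square root is therefore holomorphic at their values and commutes with
  conjugation there.\<close>

lemma \<Lambda>_bernstein_nonneg: "\<Lambda> (\<lambda>z. ((1 + z) / 2) ^ k * ((1 - z) / 2) ^ l) \<in> \<real>\<^sub>\<ge>\<^sub>0"
proof -
  define v where "v z = csqrt ((1 + z) / 2) ^ k * csqrt ((1 - z) / 2) ^ l" for z
  have re: "0 < Re ((1 + z) / 2)" "0 < Re ((1 - z) / 2)" if "z \<in> ball 0 1" for z :: complex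
    using that abs_Re_le_cmod[of z] by auto
  have notin: "(1 + z) / 2 \<notin> \<real>\<^sub>\<le>\<^sub>0" "(1 - z) / 2 \<notin> \<real>\<^sub>\<le>\<^sub>0" if "z \<in> ball 0 1" for z :: complex
    using re[OF that] by (auto simp: complex_nonpos_Reals_iff simp del: Re_divide_numeral)
  have "v holomorphic_on ball 0 1"
    unfolding v_def by (intro holomorphic_intros) (use notin in auto)
  moreover have "cmod (v z) \<le> 1" if "z \<in> ball 0 1" for z
  proof -
    have "cmod ((1 + z) / 2) \<le> 1" "cmod ((1 - z) / 2) \<le> 1"
      using that norm_triangle_ineq[of 1 z] norm_triangle_ineq4[of 1 z] by (auto simp: norm_divide)
    then show ?thesis unfolding v_def norm_mult norm_power
      by (intro mult_le_one power_le_one) (auto simp: norm_csqrt)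
  qed
  then have "bounded (v ` ball 0 1)" unfolding bounded_iff by blast
  ultimately have "disc_bounded_holomorphic v" by (simp add: disc_bounded_holomorphic_def)
  moreover have "v (cnj z) = cnj (v z)" if "z \<in> ball 0 1" for z
    using cnj_csqrt[OF notin(1)[OF that]] cnj_csqrt[OF notin(2)[OF that]] by (simp add: v_def)
  ultimately have "\<Lambda> (\<lambda>z. v z * v z) \<in> \<real>\<^sub>\<ge>\<^sub>0" by (rule \<Lambda>_square_nonneg)
  moreover have "v z * v z = ((1 + z) / 2) ^ k * ((1 - z) / 2) ^ l" for z
  proof -
    have "v z * v z = (csqrt ((1 + z) / 2))\<^sup>2 ^ k * (csqrt ((1 - z) / 2))\<^sup>2 ^ l"
      unfolding v_def power2_eq_square power_mult_distrib by (simp only: mult_ac)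
    then show ?thesis by simp
  qed
  ultimately show ?thesis by simp
qed

text \<open>Hausdorff's problem is posed on the unit interval, hence the variable
  \<open>x = (1 + z) / 2\<close>: a point \<open>x\<close> of the support of \<open>\<nu>\<close>
  stands for the real point \<open>2 * x - 1\<close> of the disc coordinate.\<close>

lemma \<Lambda>_moments:
  obtains \<nu> :: "real measure" where "finite_measure \<nu>" "sets \<nu> = sets borel" "AE x in \<nu>. x \<in> {0..1}"
    "\<And>j. \<Lambda> (\<lambda>z. ((1 + z) / 2) ^ j) = of_real (\<integral>x. x ^ j \<partial>\<nu>)"
proof -
  define B where "B n k z = ((1 + z) / 2) ^ k * ((1 - z) / 2) ^ (n - k)" for n k :: nat and z :: complex
  \<comment> \<open>The values of \<open>\<Lambda>\<close> here are nonnegative reals already;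
    \<open>Re\<close> only changes the type.\<close>
  define w where "w n k = real (n choose k) * Re (\<Lambda> (B n k))" for n k
  define m where "m j = Re (\<Lambda> (\<lambda>z. ((1 + z) / 2) ^ j))" for j
  have Bnn: "\<Lambda> (B n k) \<in> \<real>\<^sub>\<ge>\<^sub>0" for n k
    unfolding B_def by (rule \<Lambda>_bernstein_nonneg)
  have w: "0 \<le> w n k" for n k
    using Bnn[of n k] by (simp add: w_def complex_nonneg_Reals_iff)
  have mom: "(\<Sum>k\<le>n. w n k * (real (k choose j) / real (n choose j))) = m j" if "j \<le> n" for n j
  proof -
    define c where "c k = real (n choose k) * (real (k choose j) / real (n choose j))" for k
    have "\<Lambda> (\<lambda>z. \<Sum>k\<le>n. of_real (c k) * B n k z) = (\<Sum>k\<le>n. of_real (c k) * \<Lambda> (B n k))"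
      by (rule \<Lambda>_sum) (auto simp: B_def intro!: holomorphic_intros)
    moreover have "(\<Sum>k\<le>n. of_real (c k) * B n k z) = ((1 + z) / 2) ^ j" for z
    proof -
      have "(1 + z) / 2 + (1 - z) / 2 = 1" by (simp add: field_simps)
      from bernstein_power_expansion[OF this that] show ?thesis by (simp add: c_def B_def)
    qed
    ultimately have "\<Lambda> (\<lambda>z. ((1 + z) / 2) ^ j) = (\<Sum>k\<le>n. of_real (c k) * \<Lambda> (B n k))" by simp
    then have "m j = (\<Sum>k\<le>n. c k * Re (\<Lambda> (B n k)))" by (simp add: m_def)
    also have "\<dots> = (\<Sum>k\<le>n. w n k * (real (k choose j) / real (n choose j)))"
      by (simp add: w_def c_def mult_ac)
    finally show ?thesis by simp
  qed
  obtain \<nu> :: "real measure" where \<nu>: "finite_measure \<nu>" "sets \<nu> = sets borel" "AE x in \<nu>. x \<in> {0..1}"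
    "\<And>j. (\<integral>x. x ^ j \<partial>\<nu>) = m j"
    by (rule Hausdorff_moment_problem[of w m, OF w mom]) (assumption, rule that)
  have "\<Lambda> (\<lambda>z. ((1 + z) / 2) ^ j) = of_real (m j)" for j
  proof -
    have "\<Lambda> (\<lambda>z. ((1 + z) / 2) ^ j) \<in> \<real>\<^sub>\<ge>\<^sub>0" using \<Lambda>_bernstein_nonneg[of j 0] by simp
    then show ?thesis by (simp add: m_def complex_nonneg_Reals_iff complex_eq_iff)
  qed
  with \<nu> show thesis by (intro that) auto
qed

lemma \<eta>_limit:
  assumes "\<And>n. g n \<in> Hinf \<Omega>" "f \<in> Hinf \<Omega>" "\<And>n z. z \<in> \<Omega> \<Longrightarrow> cmod (g n z) \<le> C"
    "AE t in lebesgue. t \<in> {0..2*pi} \<longrightarrow>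
      (\<lambda>n. boundary_value (g n \<circ> \<phi>) (cis t)) \<longlonglongrightarrow> boundary_value (f \<circ> \<phi>) (cis t)"
  shows "(\<lambda>n. \<eta> (g n)) \<longlonglongrightarrow> \<eta> f"
  by (rule weakly_continuous_bounded_convergence[OF biholomorphic assms(2,1,3,4) weakly_continuous])

lemma boundary_value_pull:
  assumes "continuous_on (cball 0 1) v"
  shows "boundary_value (pull v \<circ> \<phi>) (cis t) = v (\<psi>i (cis t))"
proof (rule boundary_value_continuous)
  show "continuous_on (cball 0 1) (\<lambda>z. v (\<psi>i z))"
    by (intro continuous_on_compose2[OF assms continuous_\<psi>i]) (use \<psi>i_cball in blast)
  show "(pull v \<circ> \<phi>) z = v (\<psi>i z)" if "z \<in> ball 0 1" for z
    using \<phi>_in[OF that] q_\<phi>[OF that] by (simp add: pull_def)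
qed simp

text \<open>The weak topology sees boundary values in the coordinate of \<open>\<phi>\<close>. For
  functions continuous on the closed disc these are the values at \<open>\<psi>i (cis t)\<close>, so
  pointwise convergence there suffices.\<close>

lemma \<Lambda>_limit:
  assumes v: "\<And>n. v n holomorphic_on ball 0 1" "\<And>n. continuous_on (cball 0 1) (v n)"
    and w: "w holomorphic_on ball 0 1" "continuous_on (cball 0 1) w"
    and C: "\<And>n z. z \<in> ball 0 1 \<Longrightarrow> cmod (v n z) \<le> C"
    and lim: "AE t in lebesgue. (\<lambda>n. v n (\<psi>i (cis t))) \<longlonglongrightarrow> w (\<psi>i (cis t))"
  shows "(\<lambda>n. \<Lambda> (v n)) \<longlonglongrightarrow> \<Lambda> w"
  unfolding \<Lambda>_def
proof (rule \<eta>_limit)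
  show "pull (v n) \<in> Hinf \<Omega>" "pull w \<in> Hinf \<Omega>" for n
    by (intro pull_Hinf disc_bounded_holomorphicI v w)+
  show "cmod (pull (v n) z) \<le> C" if "z \<in> \<Omega>" for n z
    using C[OF q_ball[OF that]] that by (simp add: pull_def)
  show "AE t in lebesgue. t \<in> {0..2*pi} \<longrightarrow> (\<lambda>n. boundary_value (pull (v n) \<circ> \<phi>) (cis t))
        \<longlonglongrightarrow> boundary_value (pull w \<circ> \<phi>) (cis t)"
    using lim by (simp only: boundary_value_pull v w) (auto elim: eventually_mono)
qed

end

section \<open>From the moments to a measure on the fixed points\<close>

locale moment_measure = weakly_continuous_positive_functional +
  fixes \<nu> :: "real measure"
  assumes finite_\<nu>: "finite_measure \<nu>" and sets_\<nu>: "sets \<nu> = sets borel"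
    and AE_unit: "AE x in \<nu>. x \<in> {0..1}"
    and moments: "\<Lambda> (\<lambda>z. ((1 + z) / 2) ^ j) = of_real (\<integral>x. x ^ j \<partial>\<nu>)"
begin

interpretation \<nu>: finite_measure \<nu> by (rule finite_\<nu>)

lemma measurable_\<nu>: "f \<in> borel_measurable borel \<Longrightarrow> f \<in> borel_measurable \<nu>"
  by (subst measurable_cong_sets[OF sets_\<nu> refl])

lemma integrable_power: "integrable \<nu> (\<lambda>x. x ^ j)"
proof (rule \<nu>.integrable_const_bound[where B = 1])
  show "AE x in \<nu>. norm (x ^ j) \<le> 1"
    using AE_unit by eventually_elim (simp add: power_le_one)
qed (rule measurable_\<nu>, measurable)

text \<open>The moments are given in powers of \<open>(1 + z) / 2\<close>, so \<open>p\<close> is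
  re-expanded in that variable by substituting \<open>2 * x - 1\<close>.\<close>

lemma \<Lambda>_poly: "\<Lambda> (poly p) = (\<integral>x. poly p (of_real (2 * x - 1)) \<partial>\<nu>)"
proof -
  define p' where "p' = pcompose p [:-1, 2:]"
  have p': "poly p z = poly p' ((1 + z) / 2)" for z
    by (simp add: p'_def poly_pcompose field_simps)
  have px: "poly p (of_real (2 * x - 1)) = poly p' (of_real x)" for x
    by (simp add: p'_def poly_pcompose algebra_simps)
  have "\<Lambda> (poly p) = \<Lambda> (\<lambda>z. \<Sum>i\<le>degree p'. coeff p' i * ((1 + z) / 2) ^ i)"
    by (rule \<Lambda>_cong) (simp only: p', simp only: poly_altdef)
  also have "\<dots> = (\<Sum>i\<le>degree p'. coeff p' i * \<Lambda> (\<lambda>z. ((1 + z) / 2) ^ i))"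
    by (rule \<Lambda>_sum) (auto intro!: holomorphic_intros)
  also have "\<dots> = (\<Sum>i\<le>degree p'. (\<integral>x. coeff p' i * of_real (x ^ i) \<partial>\<nu>))"
    by (simp only: moments integral_mult_right_zero integral_complex_of_real)
  also have "\<dots> = (\<integral>x. (\<Sum>i\<le>degree p'. coeff p' i * of_real (x ^ i)) \<partial>\<nu>)"
    by (rule Bochner_Integration.integral_sum[symmetric])
       (intro integrable_mult_right integrable_of_real integrable_power)
  also have "\<dots> = (\<integral>x. poly p (of_real (2 * x - 1)) \<partial>\<nu>)"
    by (simp only: px) (simp only: poly_altdef of_real_power)
  finally show ?thesis .
qed

lemma holomorphic_poly: "poly p holomorphic_on A" for p :: "complex poly"
  unfolding poly_altdef by (intro holomorphic_intros)

lemma no_endpoint_mass: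
  assumes e: "e = 1 \<or> e = - 1"
  shows "measure \<nu> {(1 + e) / 2} = 0"
proof -
  define p where "p n = [:1/2, complex_of_real e / 2:] ^ n" for n
  have pv: "poly (p n) z = ((1 + of_real e * z) / 2) ^ n" for n z
    by (simp add: p_def field_simps)
  have ce: "cmod (of_real e) = 1" "complex_of_real e * of_real e = 1" using e by auto
  have "(\<lambda>n. \<Lambda> (poly (p n))) \<longlonglongrightarrow> \<Lambda> (\<lambda>_. 0)"
  proof (rule \<Lambda>_limit)
    show "cmod (poly (p n) z) \<le> 1" if "z \<in> ball 0 1" for n z
    proof -
      have "cmod (1 + of_real e * z) \<le> 2"
        using norm_triangle_ineq[of 1 "of_real e * z"] ce that by (simp add: norm_mult)
      then show ?thesis by (simp add: pv norm_power norm_divide power_le_one)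
    qed
    show "AE t in lebesgue. (\<lambda>n. poly (p n) (\<psi>i (cis t))) \<longlonglongrightarrow> 0"
      using AE_\<psi>i_neq[OF ce(1)]
    proof eventually_elim
      case (elim t)
      have "of_real e * \<psi>i (cis t) \<noteq> 1"
      proof
        assume "of_real e * \<psi>i (cis t) = 1"
        then have "of_real e * (of_real e * \<psi>i (cis t)) = of_real e" by simp
        then show False using elim ce(2) by (simp add: mult.assoc[symmetric] del: of_real_mult)
      qed
      moreover have "cmod (of_real e * \<psi>i (cis t)) \<le> 1"
        using \<psi>i_cis[of t] ce(1) by (simp add: norm_mult)
      ultimately have "cmod ((1 + of_real e * \<psi>i (cis t)) / 2) < 1" by (intro norm_half_one_plus_less)
      then show ?case unfolding pv by (rule LIMSEQ_power_zero)
    qed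
  qed (auto intro: holomorphic_poly holomorphic_on_imp_continuous_on)
  then have "(\<lambda>n. \<Lambda> (poly (p n))) \<longlonglongrightarrow> 0" by (simp only: \<Lambda>_zero)
  moreover have "\<Lambda> (poly (p n)) = of_real (\<integral>x. ((1 + e * (2 * x - 1)) / 2) ^ n \<partial>\<nu>)" for n
    unfolding \<Lambda>_poly pv by (simp flip: integral_complex_of_real)
  ultimately have "(\<lambda>n. complex_of_real (\<integral>x. ((1 + e * (2 * x - 1)) / 2) ^ n \<partial>\<nu>)) \<longlonglongrightarrow> of_real 0" by simp
  then have lim: "(\<lambda>n. \<integral>x. ((1 + e * (2 * x - 1)) / 2) ^ n \<partial>\<nu>) \<longlonglongrightarrow> 0"
    unfolding tendsto_of_real_iff .
  \<comment> \<open>On the unit interval the integrand lies between 0 and 1 and equals 1 at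
    \<open>(1 + e) / 2\<close>, the point standing for \<open>z = e\<close>; so it dominates the
    indicator of that point for every \<open>n\<close>.\<close>
  have "measure \<nu> {(1 + e) / 2} \<le> (\<integral>x. ((1 + e * (2 * x - 1)) / 2) ^ n \<partial>\<nu>)" for n
  proof -
    have sing: "{(1 + e) / 2} \<in> sets \<nu>" by (simp add: sets_\<nu>)
    have "measure \<nu> {(1 + e) / 2} = (\<integral>x. indicator {(1 + e) / 2} x \<partial>\<nu>)"
      using sing by (simp add: sets.Int_space_eq2)
    also have "\<dots> \<le> (\<integral>x. ((1 + e * (2 * x - 1)) / 2) ^ n \<partial>\<nu>)"
    proof (rule integral_mono_AE)
      show "integrable \<nu> (\<lambda>x. indicator {(1 + e) / 2} x :: real)"
        using sing by (intro \<nu>.integrable_const_bound[where B = 1]) auto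
      show "integrable \<nu> (\<lambda>x. ((1 + e * (2 * x - 1)) / 2) ^ n)"
      proof (rule \<nu>.integrable_const_bound[where B = 1])
        show "AE x in \<nu>. norm (((1 + e * (2 * x - 1)) / 2) ^ n) \<le> 1"
          using AE_unit
        proof eventually_elim
          case (elim x)
          then have "\<bar>(1 + e * (2 * x - 1)) / 2\<bar> \<le> 1" using e by auto
          then show ?case by (simp only: real_norm_def power_abs) (intro power_le_one abs_ge_zero)
        qed
      qed (rule measurable_\<nu>, measurable)
      show "AE x in \<nu>. indicator {(1 + e) / 2} x \<le> ((1 + e * (2 * x - 1)) / 2) ^ n"
        using AE_unit
      proof eventually_elim
        case (elim x)
        show ?case
        proof (cases "x = (1 + e) / 2")
          case True
          have "(1 + e * (2 * x - 1)) / 2 = 1" unfolding True using e by auto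
          then show ?thesis by (simp only: power_one indicator_le_1)
        next
          case False
          have "0 \<le> (1 + e * (2 * x - 1)) / 2" using elim e by auto
          then have "0 \<le> ((1 + e * (2 * x - 1)) / 2) ^ n" by (rule zero_le_power)
          then show ?thesis using False by simp
        qed
      qed
    qed
    finally show ?thesis .
  qed
  then have "measure \<nu> {(1 + e) / 2} \<le> 0" by (intro LIMSEQ_le_const[OF lim]) auto
  then show ?thesis using measure_nonneg by (intro antisym)
qed

lemma AE_open_unit: "AE x in \<nu>. x \<in> {0<..<1}"
proof -
  have "{c} \<in> null_sets \<nu>" if "measure \<nu> {c} = 0" for c
    using that by (simp add: null_sets_def sets_\<nu> \<nu>.emeasure_eq_measure)
  then have n: "{0} \<in> null_sets \<nu>" "{1} \<in> null_sets \<nu>"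
    using no_endpoint_mass[of 1] no_endpoint_mass[of "-1"] by simp_all
  show ?thesis using AE_not_in[OF n(1)] AE_not_in[OF n(2)] AE_unit by eventually_elim auto
qed

text \<open>Holomorphy past the closed disc makes the Taylor coefficients absolutely summable. The
  Taylor polynomials are then uniformly bounded and converge at every point of the closed disc, so
  both sides pass to the limit. The cut to \<open>{0<..<1}\<close> anticipates general
  \<open>f\<close>, whose values are available only at interior points.\<close>

lemma \<Lambda>_holomorphic_beyond_disc:
  assumes v: "v holomorphic_on ball 0 R" and R: "1 < R"
  shows "\<Lambda> v = (\<integral>x. indicator {0<..<1} x *\<^sub>R v (of_real (2 * x - 1)) \<partial>\<nu>)"
proof -
  define a where "a n = (deriv ^^ n) v 0 / fact n" for n
  have sums: "(\<lambda>n. a n * z ^ n) sums v z" if "cmod z < R" for z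
    using holomorphic_power_series[OF v, of z] that by (simp add: a_def)
  have abs: "summable (\<lambda>n. cmod (a n))"
  proof -
    obtain r where r: "1 < r" "r < R" using R dense by blast
    have "summable (\<lambda>n. a n * (complex_of_real r) ^ n)"
      using sums[of "of_real r"] r by (auto simp: sums_iff)
    then have "summable (\<lambda>n. norm (a n * 1 ^ n))"
      by (rule powser_insidea) (use r in auto)
    then show ?thesis by simp
  qed
  define p where "p N = (\<Sum>n<N. monom (a n) n)" for N
  have pv: "poly (p N) z = (\<Sum>n<N. a n * z ^ n)" for N z
    by (simp add: p_def poly_sum poly_monom)
  have lim: "(\<lambda>N. poly (p N) z) \<longlonglongrightarrow> v z" if "cmod z \<le> 1" for z
    using sums[of z] that R by (simp add: pv sums_def)
  define C where "C = (\<Sum>n. cmod (a n))"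
  have C: "cmod (poly (p N) z) \<le> C" if "cmod z \<le> 1" for N z
  proof -
    have "cmod (poly (p N) z) \<le> (\<Sum>n<N. cmod (a n * z ^ n))"
      unfolding pv by (rule norm_sum)
    also have "\<dots> \<le> (\<Sum>n<N. cmod (a n))"
    proof (rule sum_mono)
      fix n
      have "cmod (a n) * cmod z ^ n \<le> cmod (a n) * 1"
        using that by (intro mult_left_mono power_le_one) auto
      then show "cmod (a n * z ^ n) \<le> cmod (a n)" by (simp add: norm_mult norm_power)
    qed
    also have "\<dots> \<le> C" unfolding C_def by (rule sum_le_suminf[OF abs]) auto
    finally show ?thesis .
  qed
  have sub: "cball 0 1 \<subseteq> ball (0::complex) R" using R by auto
  have L1: "(\<lambda>N. \<Lambda> (poly (p N))) \<longlonglongrightarrow> \<Lambda> v"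
  proof (rule \<Lambda>_limit)
    show "v holomorphic_on ball 0 1" using v sub by (rule holomorphic_on_subset[OF _ order_trans[rotated]]) auto
    show "continuous_on (cball 0 1) v" using holomorphic_on_imp_continuous_on[OF v] sub by (rule continuous_on_subset)
    show "cmod (poly (p n) z) \<le> C" if "z \<in> ball 0 1" for n z using C[of z n] that by simp
    show "AE t in lebesgue. (\<lambda>n. poly (p n) (\<psi>i (cis t))) \<longlonglongrightarrow> v (\<psi>i (cis t))"
    proof (rule AE_I2, rule lim)
      show "cmod (\<psi>i (cis t)) \<le> 1" for t using \<psi>i_cis[of t] by simp
    qed
  qed (auto intro: holomorphic_poly holomorphic_on_imp_continuous_on)
  have unit: "cmod (of_real (2 * x - 1)) \<le> 1" if "x \<in> {0..1}" for x
    using that unfolding norm_of_real by auto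
  have L2: "(\<lambda>N. \<integral>x. poly (p N) (of_real (2 * x - 1)) \<partial>\<nu>) \<longlonglongrightarrow> (\<integral>x. indicator {0<..<1} x *\<^sub>R v (of_real (2 * x - 1)) \<partial>\<nu>)"
  proof (rule integral_dominated_convergence)
    have "continuous_on {0<..<1} (\<lambda>x. v (of_real (2 * x - 1)))"
      by (intro continuous_on_compose2[OF holomorphic_on_imp_continuous_on[OF v]] continuous_intros)
         (use unit R in \<open>fastforce simp del: of_real_diff of_real_mult\<close>)
    then show "(\<lambda>x. indicator {0<..<1} x *\<^sub>R v (of_real (2 * x - 1))) \<in> borel_measurable \<nu>"
      by (intro measurable_\<nu> borel_measurable_continuous_on_indicator) auto
    show "(\<lambda>x. poly (p N) (of_real (2 * x - 1))) \<in> borel_measurable \<nu>" for N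
      by (intro measurable_\<nu> borel_measurable_continuous_onI continuous_intros)
    show "integrable \<nu> (\<lambda>_. C)" by simp
    show "AE x in \<nu>. (\<lambda>N. poly (p N) (of_real (2 * x - 1))) \<longlonglongrightarrow> indicator {0<..<1} x *\<^sub>R v (of_real (2 * x - 1))"
      using AE_open_unit
    proof eventually_elim
      case (elim x)
      then have "(\<lambda>N. poly (p N) (of_real (2 * x - 1))) \<longlonglongrightarrow> v (of_real (2 * x - 1))"
        by (intro lim unit) simp
      then show ?case using elim by simp
    qed
    show "AE x in \<nu>. norm (poly (p N) (of_real (2 * x - 1))) \<le> C" for N
      using AE_unit by eventually_elim (rule C, rule unit)
  qed
  show ?thesis
    using L1 L2 unfolding \<Lambda>_poly by (rule LIMSEQ_unique)
qed

lemma holomorphic_\<psi>: "\<psi> holomorphic_on {z. 1 - cnj b * (u * z) \<noteq> 0}"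
  unfolding \<psi>_def[abs_def] Moebius_function_simple by (intro holomorphic_intros) auto

text \<open>Dilation in the coordinate of \<open>\<phi>\<close> reads \<open>s * \<psi> z\<close> in
  the symmetric one. As \<open>\<psi>\<close> maps the closed disc into itself, these values stay in
  the unit disc on a neighbourhood of it, and compactness leaves room for a larger concentric
  disc.\<close>

lemma \<psi>_dilated_extension:
  assumes s: "0 < s" "s < 1"
  obtains R where "1 < R" "\<psi> holomorphic_on ball 0 R" "\<And>z. z \<in> ball 0 R \<Longrightarrow> of_real s * \<psi> z \<in> ball 0 1"
proof -
  let ?O = "{z. 1 - cnj b * (u * z) \<noteq> 0}"
  have "open ((\<lambda>z. 1 - cnj b * (u * z)) -` (- {0}))"
    by (intro open_vimage continuous_intros)
  then have O: "open ?O" by (simp add: vimage_def)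
  define W where "W = ?O \<inter> \<psi> -` ball 0 (1 / s)"
  have "open W"
    unfolding W_def
    by (intro continuous_open_preimage O open_ball holomorphic_on_imp_continuous_on[OF holomorphic_\<psi>])
  have subO: "cball 0 1 \<subseteq> ?O"
    using moebius_denominator(1) u by (auto simp: norm_mult)
  have "\<psi> ` closure (ball 0 1) \<subseteq> cball 0 1"
  proof (rule image_closure_subset)
    show "continuous_on (closure (ball 0 1)) \<psi>"
      using continuous_on_subset[OF holomorphic_on_imp_continuous_on[OF holomorphic_\<psi>] subO] by simp
    show "\<psi> ` ball 0 1 \<subseteq> cball 0 1" using \<psi>_ball by (auto simp: less_imp_le)
  qed simp
  then have "\<psi> z \<in> cball 0 1" if "z \<in> cball 0 1" for z using that by (auto simp: image_subset_iff)
  moreover have "1 < 1 / s" using s by simp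
  then have "cball 0 1 \<subseteq> ball (0::complex) (1 / s)" by auto
  ultimately have "cball 0 1 \<subseteq> W" using subO unfolding W_def by blast
  then obtain e where e: "0 < e" "(\<Union>x\<in>cball 0 1. ball x e) \<subseteq> W"
    using compact_subset_open_imp_ball_epsilon_subset[OF compact_cball \<open>open W\<close>] by metis
  have sub: "ball 0 (1 + e) \<subseteq> W"
  proof
    fix z :: complex assume z: "z \<in> ball 0 (1 + e)"
    have "\<exists>x\<in>cball 0 1. z \<in> ball x e"
    proof (cases "cmod z \<le> 1")
      case True
      then show ?thesis using e(1) by (intro bexI[of _ z]) auto
    next
      case False
      \<comment> \<open>Outside the closed disc, the nearest point of it is the radial projection
        \<open>sgn z\<close>.\<close>
      have z0: "z \<noteq> 0" using False by auto
      then have "sgn z - z = of_real (1 / cmod z - 1) * z"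
        by (simp add: sgn_div_norm scaleR_conv_of_real field_simps)
      then have "cmod (sgn z - z) = \<bar>1 / cmod z - 1\<bar> * cmod z" by (simp only: norm_mult norm_of_real)
      also have "\<dots> = cmod z - 1" using False z0 by (simp add: abs_if field_simps)
      finally have "z \<in> ball (sgn z) e" using z by (simp add: dist_norm)
      moreover have "sgn z \<in> cball 0 1" by (simp add: norm_sgn)
      ultimately show ?thesis by blast
    qed
    then show "z \<in> W" using e(2) by blast
  qed
  show thesis
  proof (rule that)
    show "1 < 1 + e" using e by simp
    show "\<psi> holomorphic_on ball 0 (1 + e)"
      using holomorphic_\<psi> by (rule holomorphic_on_subset) (use sub in \<open>auto simp: W_def\<close>)
    show "of_real s * \<psi> z \<in> ball 0 1" if "z \<in> ball 0 (1 + e)" for z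
    proof -
      have "cmod (\<psi> z) < 1 / s" using sub that by (auto simp: W_def)
      then show ?thesis using s by (simp add: norm_mult field_simps)
    qed
  qed
qed

lemma two_x_minus_one: "x \<in> {0<..<1} \<Longrightarrow> complex_of_real (2 * x - 1) \<in> ball 0 1"
proof -
  assume "x \<in> {0<..<1}"
  then have "\<bar>2 * x - 1\<bar> < 1" by auto
  then show ?thesis by (simp only: mem_ball_0 norm_of_real)
qed

lemma continuous_\<psi>: "continuous_on (ball 0 1) \<psi>"
proof -
  have "ball 0 1 \<subseteq> {z. 1 - cnj b * (u * z) \<noteq> 0}"
    using moebius_denominator(1) u by (auto simp: norm_mult)
  then show ?thesis
    using holomorphic_on_imp_continuous_on[OF holomorphic_\<psi>] continuous_on_subset by blast
qed

lemma continuous_\<phi>\<psi>: "continuous_on {0<..<1} (\<lambda>x. \<phi> (\<psi> (of_real (2 * x - 1))))"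
proof -
  have "continuous_on (ball 0 1) (\<lambda>z. \<phi> (\<psi> z))"
    by (intro continuous_on_compose2[OF holomorphic_on_imp_continuous_on[OF \<phi>_holomorphic]] continuous_\<psi>) (use \<psi>_ball in blast)
  then show ?thesis
    by (rule continuous_on_compose2) (intro continuous_intros, use two_x_minus_one in blast)
qed

text \<open>The dilation is made in the coordinate of \<open>\<phi>\<close>, where the radial limits
  of \<open>f \<circ> \<phi>\<close> give convergence of boundary values. Read in the symmetric
  coordinate it is \<open>v n\<close>, which is holomorphic beyond the closed disc and so already
  represented; then the dilation factor tends to 1 on both sides.\<close>

lemma \<eta>_eq_integral:
  assumes f: "f \<in> Hinf \<Omega>"
  shows "\<eta> f = (\<integral>x. indicator {0<..<1} x *\<^sub>R f (\<phi> (\<psi> (of_real (2 * x - 1)))) \<partial>\<nu>)"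
proof -
  define g where "g = f \<circ> \<phi>"
  have g: "g holomorphic_on ball 0 1" and "\<exists>C. \<forall>z\<in>ball 0 1. cmod (g z) \<le> C"
    unfolding g_def by (rule Hinf_compose_biholomorphic[OF biholomorphic f])+
  then obtain C where C: "\<forall>z\<in>ball 0 1. cmod (g z) \<le> C" by blast
  have bg: "bounded (g ` ball 0 1)" unfolding bounded_iff using C by blast
  define s where "s n = 1 - 1 / (real n + 2)" for n :: nat
  have s: "s \<longlonglongrightarrow> 1" "\<And>n. 0 < s n" "\<And>n. s n < 1"
    unfolding s_def by (rule radial_sequence)+
  define v where "v n z = g (of_real (s n) * \<psi> z)" for n z
  have sb: "of_real (s n) * z \<in> ball 0 1" if "z \<in> cball 0 1" for n and z :: complex
  proof -
    have "s n * cmod z \<le> s n * 1" using that s(2)[of n] by (intro mult_left_mono) auto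
    then have "s n * cmod z < 1" using s(3)[of n] by linarith
    then show ?thesis using s(2)[of n] by (simp add: norm_mult)
  qed
  have sb': "of_real (s n) * z \<in> ball 0 1" if "z \<in> ball 0 1" for n and z :: complex
    using that by (intro sb) auto
  have vext: "\<exists>R>1. v n holomorphic_on ball 0 R" for n
  proof -
    obtain R where R: "1 < R" "\<psi> holomorphic_on ball 0 R" "\<And>z. z \<in> ball 0 R \<Longrightarrow> of_real (s n) * \<psi> z \<in> ball 0 1"
      by (rule \<psi>_dilated_extension[OF s(2,3)[of n]]) (rule that)
    have "(\<lambda>z. of_real (s n) * \<psi> z) holomorphic_on ball 0 R" by (intro holomorphic_intros R)
    then have "(g \<circ> (\<lambda>z. of_real (s n) * \<psi> z)) holomorphic_on ball 0 R"
      by (rule holomorphic_on_compose_gen[OF _ g]) (use R(3) in blast)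
    then show ?thesis using R(1) by (auto simp: v_def[abs_def] o_def)
  qed
  have dv: "disc_bounded_holomorphic (v n)" for n
  proof -
    obtain R where R: "1 < R" "v n holomorphic_on ball 0 R" using vext by blast
    have "ball 0 1 \<subseteq> ball (0::complex) R" "cball 0 1 \<subseteq> ball (0::complex) R" using R(1) by auto
    then show ?thesis
      using R(2) by (intro disc_bounded_holomorphicI) (auto intro: holomorphic_on_subset holomorphic_on_imp_continuous_on continuous_on_subset)
  qed
  have pv: "pull (v n) z = g (of_real (s n) * inv_into (ball 0 1) \<phi> z)" if "z \<in> \<Omega>" for n z
    using that \<psi>_\<psi>i[OF inv\<phi>(1)[OF that]] by (simp add: pull_def v_def q_def)
  have "(\<lambda>n. \<eta> (pull (v n))) \<longlonglongrightarrow> \<eta> f"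
  proof (rule \<eta>_limit[OF pull_Hinf[OF dv] f])
    show "cmod (pull (v n) z) \<le> C" if "z \<in> \<Omega>" for n z
      unfolding pv[OF that] using sb[of "inv_into (ball 0 1) \<phi> z" n] inv\<phi>(1)[OF that] C by auto
    have "boundary_value (pull (v n) \<circ> \<phi>) (cis t) = g (of_real (s n) * cis t)" for n t
    proof (rule boundary_value_continuous)
      show "continuous_on (cball 0 1) (\<lambda>z. g (of_real (s n) * z))"
        by (intro continuous_on_compose2[OF holomorphic_on_imp_continuous_on[OF g]] continuous_intros) (use sb in blast)
      show "(pull (v n) \<circ> \<phi>) z = g (of_real (s n) * z)" if "z \<in> ball 0 1" for z
        using pv[OF \<phi>_in[OF that]] inv\<phi>(3)[OF that] by simp
    qed simp
    then show "AE t in lebesgue. t \<in> {0..2*pi} \<longrightarrow> (\<lambda>n. boundary_value (pull (v n) \<circ> \<phi>) (cis t))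
        \<longlonglongrightarrow> boundary_value (f \<circ> \<phi>) (cis t)"
      using radial_limit_boundary_value[OF g bg s] by (simp only: g_def)
  qed
  moreover have "(\<lambda>n. \<eta> (pull (v n))) \<longlonglongrightarrow> (\<integral>x. indicator {0<..<1} x *\<^sub>R f (\<phi> (\<psi> (of_real (2 * x - 1)))) \<partial>\<nu>)"
  proof -
    have eq: "\<eta> (pull (v n)) = (\<integral>x. indicator {0<..<1} x *\<^sub>R v n (of_real (2 * x - 1)) \<partial>\<nu>)" for n
      using vext[of n] \<Lambda>_holomorphic_beyond_disc[of "v n"] unfolding \<Lambda>_def by blast
    have meas: "(\<lambda>x. indicator {0<..<1} x *\<^sub>R w (\<psi> (of_real (2 * x - 1)))) \<in> borel_measurable \<nu>"
      if w: "continuous_on (ball 0 1) w" for w :: "complex \<Rightarrow> complex"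
    proof -
      have "continuous_on (ball 0 1) (\<lambda>z. w (\<psi> z))"
        by (intro continuous_on_compose2[OF w] continuous_\<psi>) (use \<psi>_ball in blast)
      then have "continuous_on {0<..<1} (\<lambda>x. w (\<psi> (of_real (2 * x - 1))))"
        by (rule continuous_on_compose2) (intro continuous_intros, use two_x_minus_one in blast)
      then show ?thesis by (intro measurable_\<nu> borel_measurable_continuous_on_indicator) auto
    qed
    have cg: "continuous_on (ball 0 1) g" by (rule holomorphic_on_imp_continuous_on[OF g])
    show ?thesis
      unfolding eq
    proof (rule integral_dominated_convergence)
      show "(\<lambda>x. indicator {0<..<1} x *\<^sub>R f (\<phi> (\<psi> (of_real (2 * x - 1))))) \<in> borel_measurable \<nu>"
        using meas[OF cg] by (simp add: g_def)
      have "continuous_on (ball 0 1) (\<lambda>z. g (of_real (s n) * z))" for n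
        by (intro continuous_on_compose2[OF cg] continuous_intros) (use sb' in blast)
      then show "(\<lambda>x. indicator {0<..<1} x *\<^sub>R v n (of_real (2 * x - 1))) \<in> borel_measurable \<nu>" for n
        unfolding v_def by (rule meas)
      show "integrable \<nu> (\<lambda>_. C)" by simp
      have \<psi>b: "\<psi> (of_real (2 * x - 1)) \<in> ball 0 1" if "x \<in> {0<..<1}" for x
        by (rule \<psi>_ball[OF two_x_minus_one[OF that]])
      show "AE x in \<nu>. norm (indicator {0<..<1} x *\<^sub>R v n (of_real (2 * x - 1))) \<le> C" for n
        using AE_open_unit
      proof eventually_elim
        case (elim x)
        have "of_real (s n) * \<psi> (of_real (2 * x - 1)) \<in> ball 0 1" using \<psi>b[OF elim] by (intro sb) auto
        then show ?case using C elim by (simp add: v_def)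
      qed
      show "AE x in \<nu>. (\<lambda>n. indicator {0<..<1} x *\<^sub>R v n (of_real (2 * x - 1)))
          \<longlonglongrightarrow> indicator {0<..<1} x *\<^sub>R f (\<phi> (\<psi> (of_real (2 * x - 1))))"
        using AE_open_unit
      proof eventually_elim
        case (elim x)
        have "(\<lambda>n. of_real (s n) * \<psi> (of_real (2 * x - 1))) \<longlonglongrightarrow> of_real 1 * \<psi> (of_real (2 * x - 1))"
          by (intro tendsto_intros s)
        then have "(\<lambda>n. of_real (s n) * \<psi> (of_real (2 * x - 1))) \<longlonglongrightarrow> \<psi> (of_real (2 * x - 1))" by simp
        moreover have "isCont g (\<psi> (of_real (2 * x - 1)))"
          using cg \<psi>b[OF elim] continuous_on_eq_continuous_at open_ball by blast
        ultimately have "(\<lambda>n. g (of_real (s n) * \<psi> (of_real (2 * x - 1)))) \<longlonglongrightarrow> g (\<psi> (of_real (2 * x - 1)))"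
          by (rule isCont_tendsto_compose[rotated])
        then show ?case using elim by (simp add: v_def g_def)
      qed
    qed
  qed
  ultimately show ?thesis by (rule LIMSEQ_unique)
qed

text \<open>The image of \<open>\<nu>\<close> under
  \<open>x \<mapsto> \<phi> (\<psi> (2 * x - 1))\<close>. Points of the real axis are fixed by
  conjugation, so the images are fixed by \<sigma>; the restriction to \<open>{0<..<1}\<close> loses
  no mass because the end points are null.\<close>

lemma representing_measure:
  "\<exists>\<mu>. finite_measure \<mu> \<and> sets \<mu> = sets (restrict_space borel (fixed_points \<Omega> \<sigma>)) \<and>
     (\<forall>f\<in>Hinf \<Omega>. \<eta> f = (\<integral>z. f z \<partial>\<mu>))"
proof -
  define X where "X = restrict_space (borel :: complex measure) (fixed_points \<Omega> \<sigma>)"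
  define N where "N = restrict_space \<nu> {0<..<1}"
  define p where "p x = \<phi> (\<psi> (of_real (2 * x - 1)))" for x
  have sN: "sets N = sets (restrict_space borel {0<..<1})"
    unfolding N_def by (rule sets_restrict_space_cong[OF sets_\<nu>])
  have unit: "{0<..<1} \<inter> space \<nu> \<in> sets \<nu>"
    using sets_eq_imp_space_eq[OF sets_\<nu>] by (simp add: sets_\<nu>)
  have fixp: "p x \<in> fixed_points \<Omega> \<sigma>" if "x \<in> {0<..<1}" for x
    using \<phi>_in[OF \<psi>_ball[OF two_x_minus_one[OF that]]] \<sigma>_\<phi>\<psi>[OF two_x_minus_one[OF that]]
    by (simp add: fixed_points_def p_def)
  have pb: "p \<in> measurable N borel"
    using borel_measurable_continuous_on_restrict[OF continuous_\<phi>\<psi>] measurable_cong_sets[OF sN refl, of borel]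
    unfolding p_def[abs_def] by blast
  have pX: "p \<in> measurable N X"
    unfolding X_def using fixp pb
    by (intro measurable_restrict_space2) (auto simp: N_def space_restrict_space)
  have "finite_measure N"
    unfolding N_def by (rule finite_measure_restrict_space[OF finite_\<nu>]) (simp add: sets_\<nu>)
  then have "finite_measure (distr N X p)" by (rule finite_measure.finite_measure_distr[OF _ pX])
  moreover have "\<eta> f = (\<integral>z. f z \<partial>distr N X p)" if f: "f \<in> Hinf \<Omega>" for f
  proof -
    have "continuous_on (fixed_points \<Omega> \<sigma>) f"
      using f by (auto simp: Hinf_def fixed_points_def intro: holomorphic_on_imp_continuous_on continuous_on_subset)
    then have fm: "f \<in> borel_measurable X"
      unfolding X_def by (rule borel_measurable_continuous_on_restrict)
    have "(\<integral>z. f z \<partial>distr N X p) = (\<integral>x. f (p x) \<partial>N)" by (rule integral_distr[OF pX fm])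
    also have "\<dots> = (\<integral>x. indicator {0<..<1} x *\<^sub>R f (p x) \<partial>\<nu>)"
      unfolding N_def by (rule integral_restrict_space[OF unit])
    also have "\<dots> = \<eta> f" unfolding p_def by (rule \<eta>_eq_integral[OF f, symmetric])
    finally show ?thesis by simp
  qed
  ultimately show ?thesis by (intro exI[of _ "distr N X p"]) (auto simp: X_def)
qed

end

section \<open>Functionals given by measures, and the characterisation\<close>

lemma open_cnj_image: "open A \<Longrightarrow> open (cnj ` A)"
proof -
  assume "open A"
  then have "open (cnj -` A)" by (intro open_vimage continuous_intros)
  moreover have "cnj ` A = cnj -` A"
  proof
    show "cnj -` A \<subseteq> cnj ` A"
    proof
      fix z assume "z \<in> cnj -` A"
      then have "cnj z \<in> A" "z = cnj (cnj z)" by simp_all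
      then show "z \<in> cnj ` A" by (rule rev_image_eqI)
    qed
  qed auto
  ultimately show ?thesis by simp
qed

lemma sharp_Hinf:
  assumes \<Omega>: "open \<Omega>" and \<sigma>: "antiholomorphic_involution \<Omega> \<sigma>" and f: "f \<in> Hinf \<Omega>"
  shows "sharp \<Omega> \<sigma> f \<in> Hinf \<Omega>"
proof -
  have \<sigma>in: "\<sigma> z \<in> \<Omega>" if "z \<in> \<Omega>" for z using \<sigma> that by (auto simp: antiholomorphic_involution_def)
  have hf: "f holomorphic_on \<Omega>" using f by (simp add: Hinf_def)
  have "cnj ` cnj ` \<Omega> = \<Omega>" by (simp add: image_image)
  moreover have "open (cnj ` \<Omega>)"
    by (rule open_cnj_image[OF \<Omega>])
  ultimately have 1: "(cnj \<circ> f \<circ> cnj) holomorphic_on cnj ` \<Omega>"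
    by (intro holomorphic_on_compose_cnj_cnj) (simp_all add: hf)
  have 2: "(\<lambda>z. cnj (\<sigma> z)) holomorphic_on \<Omega>" using \<sigma> by (simp add: antiholomorphic_involution_def)
  have "((cnj \<circ> f \<circ> cnj) \<circ> (\<lambda>z. cnj (\<sigma> z))) holomorphic_on \<Omega>"
    by (rule holomorphic_on_compose_gen[OF 2 1]) (use \<sigma>in in blast)
  then have "sharp \<Omega> \<sigma> f holomorphic_on \<Omega>"
    by (rule holomorphic_transform) (simp add: sharp_def)
  moreover have "bounded (sharp \<Omega> \<sigma> f ` \<Omega>)"
  proof -
    have "bounded (f ` \<Omega>)" using f by (simp add: Hinf_def)
    then obtain C where "\<forall>x\<in>f ` \<Omega>. cmod x \<le> C" unfolding bounded_iff by blast
    then have "cmod (sharp \<Omega> \<sigma> f z) \<le> C" if "z \<in> \<Omega>" for z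
      using \<sigma>in[OF that] that by (simp add: sharp_def)
    then show ?thesis unfolding bounded_iff by blast
  qed
  ultimately show ?thesis by (simp add: Hinf_def sharp_def)
qed

lemma Hinf_mult:
  assumes "f \<in> Hinf \<Omega>" "g \<in> Hinf \<Omega>"
  shows "(\<lambda>z. f z * g z) \<in> Hinf \<Omega>"
proof -
  obtain C where C: "\<forall>x\<in>f ` \<Omega>. cmod x \<le> C" using assms(1) unfolding Hinf_def bounded_iff by blast
  obtain D where D: "\<forall>x\<in>g ` \<Omega>. cmod x \<le> D" using assms(2) unfolding Hinf_def bounded_iff by blast
  have "cmod (f z * g z) \<le> C * D" if "z \<in> \<Omega>" for z
  proof -
    have f: "cmod (f z) \<le> C" and g: "cmod (g z) \<le> D" using C D that by auto
    show ?thesis unfolding norm_mult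
      using f g order_trans[OF norm_ge_zero f] by (intro mult_mono) auto
  qed
  then have "bounded ((\<lambda>z. f z * g z) ` \<Omega>)" unfolding bounded_iff by blast
  moreover have "(\<lambda>z. f z * g z) holomorphic_on \<Omega>"
    using assms by (intro holomorphic_intros) (auto simp: Hinf_def)
  ultimately show ?thesis using assms by (simp add: Hinf_def)
qed

lemma Hinf_integrable:
  assumes fin: "finite_measure \<mu>" and sets: "sets \<mu> = sets (restrict_space borel S)" and S: "S \<subseteq> \<Omega>"
    and f: "f \<in> Hinf \<Omega>"
  shows "integrable \<mu> f"
proof -
  interpret finite_measure \<mu> by fact
  have sp: "space \<mu> = S" using sets_eq_imp_space_eq[OF sets] by (simp add: space_restrict_space)
  obtain C where C: "\<forall>x\<in>f ` \<Omega>. cmod x \<le> C" using f unfolding Hinf_def bounded_iff by blast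
  have "f holomorphic_on \<Omega>" using f by (simp add: Hinf_def)
  then have "continuous_on S f" using S holomorphic_on_imp_continuous_on continuous_on_subset by blast
  then have "f \<in> borel_measurable \<mu>"
    using borel_measurable_continuous_on_restrict[of S f] measurable_cong_sets[OF sets refl, of borel] by blast
  then show ?thesis
    using C S sp by (intro integrable_const_bound[where B = C] AE_I2) auto
qed

text \<open>As \<open>\<eta>\<close> is a total function on maps of the plane, both sides of the
  equivalence constrain only its values on \<open>Hinf \<Omega>\<close>. The map
  \<open>\<phi>\<close> is an arbitrary biholomorphism and serves to express the weak
  topology.\<close>

theorem propositionB8:
  fixes \<Omega> :: "complex set" and \<sigma> \<phi> :: "complex \<Rightarrow> complex"
    and \<eta> :: "(complex \<Rightarrow> complex) \<Rightarrow> complex"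
  assumes "open \<Omega>" and "connected \<Omega>" and "simply_connected \<Omega>"
    and "\<Omega> \<noteq> {}" and "\<Omega> \<noteq> UNIV"
    and "antiholomorphic_involution \<Omega> \<sigma>"
    and "biholomorphic_map \<phi> (ball 0 1) \<Omega>"
  shows "positive_functional \<Omega> \<sigma> \<eta> \<and> continuous_map (weak_topology \<Omega> \<phi>) euclidean \<eta> \<longleftrightarrow>
    (\<exists>\<mu>. finite_measure \<mu> \<and> sets \<mu> = sets (restrict_space borel (fixed_points \<Omega> \<sigma>)) \<and>
         (\<forall>f\<in>Hinf \<Omega>. \<eta> f = (\<integral>z. f z \<partial>\<mu>)))"
proof
  let ?D = "ball 0 1 :: complex set"
  let ?q = "inv_into ?D \<phi>"
  note \<sigma> = assms(6) and \<phi> = assms(7)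
  assume \<eta>: "positive_functional \<Omega> \<sigma> \<eta> \<and> continuous_map (weak_topology \<Omega> \<phi>) euclidean \<eta>"
  have bij: "bij_betw \<phi> ?D \<Omega>" and h\<phi>: "\<phi> holomorphic_on ?D" and hq: "?q holomorphic_on \<Omega>"
    using \<phi> by (auto simp: biholomorphic_map_def)
  have q: "?q z \<in> ?D" "\<phi> (?q z) = z" if "z \<in> \<Omega>" for z
    using bij_betw_apply[OF bij_betw_inv_into[OF bij] that] bij_betw_inv_into_right[OF bij that] by auto
  have \<phi>in: "\<phi> z \<in> \<Omega>" if "z \<in> ?D" for z using bij_betw_apply[OF bij that] .
  have \<sigma>in: "\<sigma> z \<in> \<Omega>" and \<sigma>\<sigma>: "\<sigma> (\<sigma> z) = z" if "z \<in> \<Omega>" for z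
    using \<sigma> that by (auto simp: antiholomorphic_involution_def)
  \<comment> \<open>The involution read in the disc; conjugating it to \<open>cnj\<close> supplies
    the parameters \<open>b\<close> and \<open>u\<close> of the symmetric coordinate.\<close>
  define \<tau> where "\<tau> z = ?q (\<sigma> (\<phi> z))" for z
  have \<tau>in: "\<tau> z \<in> ?D" if "z \<in> ?D" for z
    unfolding \<tau>_def by (intro q(1) \<sigma>in \<phi>in that)
  have \<tau>\<tau>: "\<tau> (\<tau> z) = z" if "z \<in> ?D" for z
    unfolding \<tau>_def q(2)[OF \<sigma>in[OF \<phi>in[OF that]]] \<sigma>\<sigma>[OF \<phi>in[OF that]] by (rule bij_betw_inv_into_left[OF bij that])
  have h\<tau>: "(\<lambda>z. cnj (\<tau> z)) holomorphic_on ?D"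
  proof -
    have "cnj ` cnj ` \<Omega> = \<Omega>" by (simp add: image_image)
    moreover have "open (cnj ` \<Omega>)" by (rule open_cnj_image[OF assms(1)])
    ultimately have 1: "(cnj \<circ> ?q \<circ> cnj) holomorphic_on cnj ` \<Omega>"
      by (intro holomorphic_on_compose_cnj_cnj) (simp_all add: hq)
    have 2: "(\<lambda>z. cnj (\<sigma> z)) holomorphic_on \<Omega>" using \<sigma> by (simp add: antiholomorphic_involution_def)
    have "((\<lambda>z. cnj (\<sigma> z)) \<circ> \<phi>) holomorphic_on ?D"
      by (rule holomorphic_on_compose_gen[OF h\<phi> 2]) (use \<phi>in in blast)
    then have "((cnj \<circ> ?q \<circ> cnj) \<circ> ((\<lambda>z. cnj (\<sigma> z)) \<circ> \<phi>)) holomorphic_on ?D"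
      by (rule holomorphic_on_compose_gen[OF _ 1]) (use \<phi>in \<sigma>in in \<open>auto simp del: mem_ball\<close>)
    then show ?thesis by (simp add: \<tau>_def o_def)
  qed
  obtain b u where b: "cmod b < 1" and u: "cmod u = 1"
    and conj: "\<And>z. z \<in> ?D \<Longrightarrow> \<tau> (Moebius_function 0 b (u * z)) = Moebius_function 0 b (u * cnj z)"
    by (rule disc_antiholomorphic_involution_conjugate_cnj[OF \<tau>in \<tau>\<tau> h\<tau>]) (assumption, assumption, rule that)
  interpret weakly_continuous_positive_functional \<Omega> \<sigma> \<phi> \<eta> b u
    using \<eta> \<sigma> \<phi> b u conj by unfold_locales (auto simp: \<tau>_def)
  obtain \<nu> :: "real measure" where \<nu>: "finite_measure \<nu>" "sets \<nu> = sets borel" "AE x in \<nu>. x \<in> {0..1}"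
    "\<And>j. \<Lambda> (\<lambda>z. ((1 + z) / 2) ^ j) = of_real (\<integral>x. x ^ j \<partial>\<nu>)"
    by (rule \<Lambda>_moments) (rule that)
  interpret moment_measure \<Omega> \<sigma> \<phi> \<eta> b u \<nu>
    by (intro moment_measure.intro moment_measure_axioms.intro weakly_continuous_positive_functional_axioms \<nu>)
  show "\<exists>\<mu>. finite_measure \<mu> \<and> sets \<mu> = sets (restrict_space borel (fixed_points \<Omega> \<sigma>)) \<and>
         (\<forall>f\<in>Hinf \<Omega>. \<eta> f = (\<integral>z. f z \<partial>\<mu>))"
    by (rule representing_measure)
next
  note \<sigma> = assms(6) and \<phi> = assms(7)
  assume "\<exists>\<mu>. finite_measure \<mu> \<and> sets \<mu> = sets (restrict_space borel (fixed_points \<Omega> \<sigma>)) \<and>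
         (\<forall>f\<in>Hinf \<Omega>. \<eta> f = (\<integral>z. f z \<partial>\<mu>))"
  then obtain \<mu> where fin: "finite_measure \<mu>" and sets: "sets \<mu> = sets (restrict_space borel (fixed_points \<Omega> \<sigma>))"
    and \<eta>: "\<And>f. f \<in> Hinf \<Omega> \<Longrightarrow> \<eta> f = (\<integral>z. f z \<partial>\<mu>)" by blast
  have sub: "fixed_points \<Omega> \<sigma> \<subseteq> \<Omega>" by (auto simp: fixed_points_def)
  have sp: "space \<mu> = fixed_points \<Omega> \<sigma>" using sets_eq_imp_space_eq[OF sets] by (simp add: space_restrict_space)
  note int = Hinf_integrable[OF fin sets sub]
  obtain F where "circle_integrable F" "\<And>f. f \<in> Hinf \<Omega> \<Longrightarrow> boundary_functional \<phi> F f = (\<integral>z. f z \<partial>\<mu>)"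
    by (rule measure_integral_eq_boundary_functional[OF \<phi> sub fin sets]) (rule that)
  then have "continuous_map (weak_topology \<Omega> \<phi>) euclidean \<eta>"
    by (intro continuous_map_boundary_functional[of F]) (simp_all add: \<eta>)
  moreover have "linear_functional \<Omega> \<eta>"
    unfolding linear_functional_def
  proof (intro conjI ballI allI)
    fix f g assume f: "f \<in> Hinf \<Omega>" and g: "g \<in> Hinf \<Omega>"
    have "bounded ((\<lambda>z. f z + g z) ` \<Omega>)"
      using f g by (intro bounded_plus_comp) (auto simp: Hinf_def)
    then have "(\<lambda>z. f z + g z) \<in> Hinf \<Omega>"
      using f g by (auto simp: Hinf_def intro: holomorphic_intros)
    then show "\<eta> (\<lambda>z. f z + g z) = \<eta> f + \<eta> g"
      using int[OF f] int[OF g] by (simp add: \<eta> f g)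
  next
    fix c f assume f: "f \<in> Hinf \<Omega>"
    then have "bounded (f ` \<Omega>)" by (simp add: Hinf_def)
    then have "bounded ((*) c ` f ` \<Omega>)" by (rule bounded_linear_image) (rule bounded_linear_mult_right)
    then have "(\<lambda>z. c * f z) \<in> Hinf \<Omega>"
      using f by (auto simp: Hinf_def image_image intro: holomorphic_intros)
    then show "\<eta> (\<lambda>z. c * f z) = c * \<eta> f" by (simp add: \<eta> f)
  qed
  moreover have "\<eta> (\<lambda>z. sharp \<Omega> \<sigma> f z * f z) \<in> \<real>\<^sub>\<ge>\<^sub>0" if f: "f \<in> Hinf \<Omega>" for f
  proof -
    have "\<eta> (\<lambda>z. sharp \<Omega> \<sigma> f z * f z) = (\<integral>z. sharp \<Omega> \<sigma> f z * f z \<partial>\<mu>)"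
      by (intro \<eta> Hinf_mult sharp_Hinf assms(1) \<sigma> f)
    \<comment> \<open>The measure lives on fixed points of \<sigma>, where \<open>sharp\<close> is
      plain conjugation of the value.\<close>
    also have "\<dots> = (\<integral>z. complex_of_real ((cmod (f z))\<^sup>2) \<partial>\<mu>)"
    proof (rule Bochner_Integration.integral_cong[OF refl])
      fix z assume "z \<in> space \<mu>"
      then show "sharp \<Omega> \<sigma> f z * f z = complex_of_real ((cmod (f z))\<^sup>2)"
        unfolding complex_norm_square by (simp add: sp fixed_points_def sharp_def mult.commute)
    qed
    also have "\<dots> = complex_of_real (\<integral>z. (cmod (f z))\<^sup>2 \<partial>\<mu>)" by (rule integral_complex_of_real)
    also have "\<dots> \<in> \<real>\<^sub>\<ge>\<^sub>0" by (simp add: integral_nonneg)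
    finally show ?thesis .
  qed
  ultimately show "positive_functional \<Omega> \<sigma> \<eta> \<and> continuous_map (weak_topology \<Omega> \<phi>) euclidean \<eta>"
    by (simp add: positive_functional_def)
qed

end
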